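(* Let $X$ be a topological space. Then, the following assertions are equivalent: (i) the space $X$ is compact and $2$-flimsy; (ii) the space $X$ is Hausdorff and $2$-big-path-flimsy; (iii) the space $X$ is $2$-flimsy and $2$-big-path-flimsy; (iv) the space $X$ is a big circle. Furthermore, if they hold, a subset of $X$ is connected if and only if it is big-path-connected.
   Context: The empty space is considered connected and big-path-connected. "Compact" means that every open cover has a finite subcover (no Hausdorff assumption). A linear order $(L,<)$ is dense if $|L|\geq 2$ and for all $x<y$ there is $z\in L$ with $x<z<y$; it is order-complete if every non-empty subset with an upper bound has a supremum; it is with ends if it has both a minimum and a maximum. A big interval is a topological space $L$ whose topology is the order topology of a dense order-complete linear order with ends on $L$. A big circle is a topological space obtained by identifying the minimum and the maximum of a big interval, equipped with the quotient topology. A big path on a space $X$ from $x$ to $y$ is a continuous map $\gamma\colon L\to X$, with $L$ a big interval, such that $\gamma(\min L)=x$ and $\gamma(\max L)=y$. A space is big-path-connected if any two of its points are joined by a big path in it. A topological space $X$ is $2$-flimsy (resp. $2$-big-path-flimsy) if $|X|>2$ and if, for any subset $S\subseteq X$, the subspace $X\setminus S$ is connected (resp. big-path-connected) whenever $|S|<2$ and is not connected (resp. not big-path-connected) whenever $|S|=2$. *)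

theory Defs
  imports "HOL-Analysis.Analysis"
begin

section \<open>Big intervals and big circles\<close>

text \<open>A linear order on a set \<open>L\<close> is given by its reflexive relation \<open>r\<close>, so \<open>r - Id\<close> is
  the strict order.\<close>

definition dense_order_on :: "'l set \<Rightarrow> 'l rel \<Rightarrow> bool" where
  "dense_order_on L r \<longleftrightarrow> (\<exists>x\<in>L. \<exists>y\<in>L. x \<noteq> y) \<and>
     (\<forall>x\<in>L. \<forall>y\<in>L. (x, y) \<in> r - Id \<longrightarrow> (\<exists>z\<in>L. (x, z) \<in> r - Id \<and> (z, y) \<in> r - Id))"

definition upper_bound_in :: "'l set \<Rightarrow> 'l rel \<Rightarrow> 'l set \<Rightarrow> 'l \<Rightarrow> bool" where
  "upper_bound_in L r S b \<longleftrightarrow> b \<in> L \<and> (\<forall>x\<in>S. (x, b) \<in> r)"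

definition supremum_in :: "'l set \<Rightarrow> 'l rel \<Rightarrow> 'l set \<Rightarrow> 'l \<Rightarrow> bool" where
  "supremum_in L r S s \<longleftrightarrow>
     upper_bound_in L r S s \<and> (\<forall>b. upper_bound_in L r S b \<longrightarrow> (s, b) \<in> r)"

definition order_complete_on :: "'l set \<Rightarrow> 'l rel \<Rightarrow> bool" where
  "order_complete_on L r \<longleftrightarrow>
     (\<forall>S. S \<subseteq> L \<and> S \<noteq> {} \<and> (\<exists>b. upper_bound_in L r S b) \<longrightarrow> (\<exists>s. supremum_in L r S s))"

definition minimum_of :: "'l set \<Rightarrow> 'l rel \<Rightarrow> 'l \<Rightarrow> bool" where
  "minimum_of L r a \<longleftrightarrow> a \<in> L \<and> (\<forall>x\<in>L. (a, x) \<in> r)"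

definition maximum_of :: "'l set \<Rightarrow> 'l rel \<Rightarrow> 'l \<Rightarrow> bool" where
  "maximum_of L r b \<longleftrightarrow> b \<in> L \<and> (\<forall>x\<in>L. (x, b) \<in> r)"

definition order_topology_on :: "'l set \<Rightarrow> 'l rel \<Rightarrow> 'l topology" where
  "order_topology_on L r = topology_generated_by
     (insert L ({{y \<in> L. (x, y) \<in> r - Id} | x. x \<in> L} \<union> {{y \<in> L. (y, x) \<in> r - Id} | x. x \<in> L}))"

text \<open>The big interval itself is the topological space \<^term>\<open>order_topology_on L r\<close>.\<close>

definition big_interval :: "'l set \<Rightarrow> 'l rel \<Rightarrow> bool" where
  "big_interval L r \<longleftrightarrow> linear_order_on L r \<and> dense_order_on L r \<and> order_complete_on L r \<and>
     (\<exists>a. minimum_of L r a) \<and> (\<exists>b. maximum_of L r b)"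

definition big_path :: "'a topology \<Rightarrow> 'l set \<Rightarrow> 'l rel \<Rightarrow> ('l \<Rightarrow> 'a) \<Rightarrow> 'a \<Rightarrow> 'a \<Rightarrow> bool" where
  "big_path X L r \<gamma> x y \<longleftrightarrow> big_interval L r \<and> continuous_map (order_topology_on L r) X \<gamma> \<and>
     (\<exists>a b. minimum_of L r a \<and> maximum_of L r b \<and> \<gamma> a = x \<and> \<gamma> b = y)"

text \<open>\<open>X\<close> carries the quotient topology induced by a surjection from a big interval that identifies
  the minimum with the maximum and nothing else.\<close>

definition big_circle_from :: "'l set \<Rightarrow> 'l rel \<Rightarrow> 'a topology \<Rightarrow> bool" where
  "big_circle_from L r X \<longleftrightarrow> big_interval L r \<and>
     (\<exists>a b q. minimum_of L r a \<and> maximum_of L r b \<and> quotient_map (order_topology_on L r) X q \<and>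
        (\<forall>s\<in>L. \<forall>t\<in>L. q s = q t \<longleftrightarrow> s = t \<or> {s, t} = {a, b}))"

text \<open>Existential quantification over big intervals of arbitrary size is not available in HOL. For a
  space with points in \<^typ>\<open>'a\<close> we quantify over big intervals carried by subsets of the following
  type. This is no restriction: the lemmas \<open>big_path_imp_joined\<close> and
  \<open>big_circle_from_imp_big_circle\<close> below show that a big interval in any type whatsoever can be
  replaced by one in this type.\<close>

type_synonym 'a big = "('a set + nat) set"

definition big_path_joined :: "'a topology \<Rightarrow> 'a \<Rightarrow> 'a \<Rightarrow> bool" where
  "big_path_joined X x y \<longleftrightarrow> (\<exists>(L :: 'a big set) r \<gamma>. big_path X L r \<gamma> x y)"

definition big_path_connected_space :: "'a topology \<Rightarrow> bool" where
  "big_path_connected_space X \<longleftrightarrow> (\<forall>x\<in>topspace X. \<forall>y\<in>topspace X. big_path_joined X x y)"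

definition big_circle :: "'a topology \<Rightarrow> bool" where
  "big_circle X \<longleftrightarrow> (\<exists>(L :: 'a big set) r. big_circle_from L r X)"


section \<open>Flimsy spaces\<close>

definition two_flimsy :: "'a topology \<Rightarrow> bool" where
  "two_flimsy X \<longleftrightarrow> (infinite (topspace X) \<or> card (topspace X) > 2) \<and>
     (\<forall>S \<subseteq> topspace X.
        (finite S \<and> card S < 2 \<longrightarrow> connected_space (subtopology X (topspace X - S))) \<and>
        (card S = 2 \<longrightarrow> \<not> connected_space (subtopology X (topspace X - S))))"

definition two_big_path_flimsy :: "'a topology \<Rightarrow> bool" where
  "two_big_path_flimsy X \<longleftrightarrow> (infinite (topspace X) \<or> card (topspace X) > 2) \<and>
     (\<forall>S \<subseteq> topspace X.
        (finite S \<and> card S < 2 \<longrightarrow> big_path_connected_space (subtopology X (topspace X - S))) \<and>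
        (card S = 2 \<longrightarrow> \<not> big_path_connected_space (subtopology X (topspace X - S))))"


section \<open>Independence of the choice of type\<close>

subsection \<open>Transport along injections\<close>

lemma topspace_order_topology_on [simp]: "topspace (order_topology_on L r) = L"
  unfolding order_topology_on_def topology_generated_by_topspace by auto

lemma openin_upper_ray: "x \<in> L \<Longrightarrow> openin (order_topology_on L r) {y \<in> L. (x, y) \<in> r - Id}"
  unfolding order_topology_on_def by (rule topology_generated_by_Basis) blast

lemma openin_lower_ray: "x \<in> L \<Longrightarrow> openin (order_topology_on L r) {y \<in> L. (y, x) \<in> r - Id}"
  unfolding order_topology_on_def by (rule topology_generated_by_Basis) blast

lemma continuous_map_order_iso:
  assumes f: "bij_betw f L L'" and iso: "\<And>x y. x \<in> L \<Longrightarrow> y \<in> L \<Longrightarrow> (f x, f y) \<in> r' \<longleftrightarrow> (x, y) \<in> r"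
  shows "continuous_map (order_topology_on L r) (order_topology_on L' r') f"
proof -
  have fL: "f x \<in> L'" if "x \<in> L" for x using f that by (auto simp: bij_betw_def)
  have iso': "(f x, f y) \<in> r' - Id \<longleftrightarrow> (x, y) \<in> r - Id" if "x \<in> L" "y \<in> L" for x y
    using iso f that by (auto simp: bij_betw_def inj_on_def)
  have "openin (order_topology_on L r) (f -` U \<inter> L)"
    if "U = L' \<or> (\<exists>x\<in>L'. U = {y \<in> L'. (x, y) \<in> r' - Id} \<or> U = {y \<in> L'. (y, x) \<in> r' - Id})" for U
    using that
  proof (elim disjE bexE)
    assume "U = L'"
    then have "f -` U \<inter> L = L" using fL by auto
    then show ?thesis by (metis openin_topspace topspace_order_topology_on)
  next
    fix x assume x: "x \<in> L'" "U = {y \<in> L'. (x, y) \<in> r' - Id}"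
    then obtain x0 where x0: "x0 \<in> L" "x = f x0" using f by (auto simp: bij_betw_def)
    have "f -` U \<inter> L = {y \<in> L. (x0, y) \<in> r - Id}" using x x0 iso' fL by blast
    then show ?thesis using openin_upper_ray[OF x0(1)] by metis
  next
    fix x assume x: "x \<in> L'" "U = {y \<in> L'. (y, x) \<in> r' - Id}"
    then obtain x0 where x0: "x0 \<in> L" "x = f x0" using f by (auto simp: bij_betw_def)
    have "f -` U \<inter> L = {y \<in> L. (y, x0) \<in> r - Id}" using x x0 iso' fL by blast
    then show ?thesis using openin_lower_ray[OF x0(1)] by metis
  qed
  moreover have "f ` L \<subseteq> \<Union> (insert L' ({{y \<in> L'. (x, y) \<in> r' - Id} | x. x \<in> L'} \<union>
      {{y \<in> L'. (y, x) \<in> r' - Id} | x. x \<in> L'}))"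
    using fL by blast
  ultimately show ?thesis
    unfolding order_topology_on_def[of L' r'] continuous_on_generated_topo_iff topspace_order_topology_on
    by blast
qed

context
  fixes L :: "'l set" and r :: "'l rel" and h :: "'l \<Rightarrow> 'm" and L' r' g
  assumes bi: "big_interval L r" and h: "inj_on h L"
  defines "L' \<equiv> h ` L" and "r' \<equiv> map_prod h h ` r" and "g \<equiv> inv_into L h"
begin

lemma transport_g: "x \<in> L \<Longrightarrow> g (h x) = x"
  using h by (simp add: g_def)

lemma transport_le: "x \<in> L \<Longrightarrow> y \<in> L \<Longrightarrow> (h x, h y) \<in> r' \<longleftrightarrow> (x, y) \<in> r"
proof -
  assume xy: "x \<in> L" "y \<in> L"
  have sub: "r \<subseteq> L \<times> L" using bi by (auto simp: big_interval_def order_on_defs)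
  show ?thesis
  proof
    assume "(h x, h y) \<in> r'"
    then obtain x0 y0 where 1: "(x0, y0) \<in> r" "h x = h x0" "h y = h y0" by (auto simp: r'_def)
    then have "x = x0" "y = y0" using xy sub h by (meson inj_onD mem_Sigma_iff subsetD)+
    then show "(x, y) \<in> r" using 1 by simp
  qed (auto simp: r'_def)
qed

lemma transport_lt: "x \<in> L \<Longrightarrow> y \<in> L \<Longrightarrow> (h x, h y) \<in> r' - Id \<longleftrightarrow> (x, y) \<in> r - Id"
  using transport_le h by (auto simp: inj_on_def)

lemma transport_min: "minimum_of L r a \<Longrightarrow> minimum_of L' r' (h a)"
  using transport_le by (auto simp: minimum_of_def L'_def)

lemma transport_max: "maximum_of L r a \<Longrightarrow> maximum_of L' r' (h a)"
  using transport_le by (auto simp: maximum_of_def L'_def)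

lemma transport_big_interval: "big_interval L' r'"
  unfolding big_interval_def
proof (intro conjI)
  have lin: "linear_order_on L r" using bi by (simp add: big_interval_def)
  have sub: "r \<subseteq> L \<times> L" using lin by (simp add: order_on_defs)
  have sub': "r' \<subseteq> L' \<times> L'" using sub by (auto simp: r'_def L'_def)
  have "refl_on L' r'"
    using lin transport_le by (auto simp: order_on_defs refl_on_def L'_def)
  moreover have "trans r'"
  proof (rule transI)
    fix x y z assume 1: "(x, y) \<in> r'" "(y, z) \<in> r'"
    then have "x \<in> L'" "y \<in> L'" "z \<in> L'" using sub' by blast+
    then obtain x0 y0 z0 where 2: "x0 \<in> L" "y0 \<in> L" "z0 \<in> L" "x = h x0" "y = h y0" "z = h z0"
      unfolding L'_def by blast
    then have "(x0, y0) \<in> r" "(y0, z0) \<in> r" using 1 transport_le by auto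
    then have "(x0, z0) \<in> r" using lin unfolding order_on_defs by (meson transD)
    then show "(x, z) \<in> r'" using 2 transport_le by auto
  qed
  moreover have "antisym r'"
  proof (rule antisymI)
    fix x y assume 1: "(x, y) \<in> r'" "(y, x) \<in> r'"
    then have "x \<in> L'" "y \<in> L'" using sub' by blast+
    then obtain x0 y0 where 2: "x0 \<in> L" "y0 \<in> L" "x = h x0" "y = h y0"
      unfolding L'_def by blast
    then have "(x0, y0) \<in> r" "(y0, x0) \<in> r" using 1 transport_le by auto
    then have "x0 = y0" using lin unfolding order_on_defs by (meson antisymD)
    then show "x = y" using 2 by simp
  qed
  moreover have "total_on L' r'"
    using lin transport_le by (fastforce simp: order_on_defs total_on_def L'_def)
  ultimately show "linear_order_on L' r'" using sub' by (simp add: order_on_defs)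
  have d: "dense_order_on L r" using bi by (simp add: big_interval_def)
  show "dense_order_on L' r'"
    unfolding dense_order_on_def
  proof (intro conjI ballI impI)
    show "\<exists>x\<in>L'. \<exists>y\<in>L'. x \<noteq> y"
      using d h unfolding dense_order_on_def L'_def inj_on_def by blast
    fix x y assume 1: "x \<in> L'" "y \<in> L'" "(x, y) \<in> r' - Id"
    then obtain x0 y0 where 2: "x0 \<in> L" "y0 \<in> L" "x = h x0" "y = h y0"
      by (auto simp: L'_def)
    then obtain z where "z \<in> L" "(x0, z) \<in> r - Id" "(z, y0) \<in> r - Id"
      using 1 d transport_lt unfolding dense_order_on_def by metis
    then show "\<exists>z\<in>L'. (x, z) \<in> r' - Id \<and> (z, y) \<in> r' - Id"
      using 2 transport_lt unfolding L'_def by blast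
  qed
  show "order_complete_on L' r'"
    unfolding order_complete_on_def
  proof (intro allI impI, elim conjE exE)
    fix S b assume S: "S \<subseteq> L'" "S \<noteq> {}" and b: "upper_bound_in L' r' S b"
    define T where "T = {x \<in> L. h x \<in> S}"
    have TL: "T \<subseteq> L" by (auto simp: T_def)
    have ST: "S = h ` T" using S by (auto simp: T_def L'_def)
    have ub: "upper_bound_in L' r' S (h c) \<longleftrightarrow> upper_bound_in L r T c" if "c \<in> L" for c
    proof -
      have "(h x, h c) \<in> r' \<longleftrightarrow> (x, c) \<in> r" if "x \<in> T" for x
        using TL transport_le \<open>c \<in> L\<close> that by blast
      then show ?thesis using \<open>c \<in> L\<close> unfolding upper_bound_in_def L'_def ST by blast
    qed
    obtain b0 where "b0 \<in> L" "b = h b0" using b by (auto simp: upper_bound_in_def L'_def)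
    then have "upper_bound_in L r T b0" using b ub by blast
    moreover have "T \<noteq> {}" using S ST by blast
    moreover have "order_complete_on L r" using bi by (simp add: big_interval_def)
    ultimately obtain s where s: "supremum_in L r T s"
      using TL unfolding order_complete_on_def by blast
    have sL: "s \<in> L" using s by (simp add: supremum_in_def upper_bound_in_def)
    have "(h s, c) \<in> r'" if c: "upper_bound_in L' r' S c" for c
    proof -
      obtain c0 where c0: "c0 \<in> L" "c = h c0" using c by (auto simp: upper_bound_in_def L'_def)
      then have "upper_bound_in L r T c0" using c ub by blast
      then have "(s, c0) \<in> r" using s by (simp add: supremum_in_def)
      then show ?thesis using c0 sL transport_le by blast
    qed
    then have "supremum_in L' r' S (h s)" using s ub sL by (simp add: supremum_in_def)
    then show "\<exists>s. supremum_in L' r' S s" by blast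
  qed
  show "\<exists>a. minimum_of L' r' a" "\<exists>a. maximum_of L' r' a"
    using bi transport_min transport_max unfolding big_interval_def by blast+
qed

lemma transport_bij: "bij_betw h L L'" "bij_betw g L' L"
  using h by (auto simp: L'_def g_def bij_betw_def inj_on_inv_into)

lemma transport_homeomorphic: "homeomorphic_map (order_topology_on L' r') (order_topology_on L r) g"
proof -
  have "continuous_map (order_topology_on L r) (order_topology_on L' r') h"
    by (rule continuous_map_order_iso[OF transport_bij(1)]) (rule transport_le)
  moreover have "continuous_map (order_topology_on L' r') (order_topology_on L r) g"
    by (rule continuous_map_order_iso[OF transport_bij(2)])
      (auto simp: L'_def transport_g transport_le)
  ultimately have "homeomorphic_maps (order_topology_on L' r') (order_topology_on L r) g h"
    by (auto simp: homeomorphic_maps_def transport_g L'_def)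
  then show ?thesis using homeomorphic_map_maps by blast
qed

lemma transport_big_path:
  assumes "big_path X L r \<gamma> x y" shows "big_path X L' r' (\<gamma> \<circ> g) x y"
proof -
  obtain a b where ab: "minimum_of L r a" "maximum_of L r b" "\<gamma> a = x" "\<gamma> b = y"
    using assms by (auto simp: big_path_def)
  then have "(\<gamma> \<circ> g) (h a) = x" "(\<gamma> \<circ> g) (h b) = y"
    by (auto simp: transport_g minimum_of_def maximum_of_def)
  moreover have "continuous_map (order_topology_on L' r') X (\<gamma> \<circ> g)"
    using assms transport_homeomorphic
    by (auto simp: big_path_def intro: continuous_map_compose homeomorphic_imp_continuous_map)
  ultimately show ?thesis
    using transport_big_interval transport_min[OF ab(1)] transport_max[OF ab(2)]
    unfolding big_path_def by blast
qed

lemma transport_big_circle: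
  assumes "big_circle_from L r X" shows "big_circle_from L' r' X"
proof -
  obtain a b q where ab: "minimum_of L r a" "maximum_of L r b"
    and q: "quotient_map (order_topology_on L r) X q"
    and fib: "\<forall>s\<in>L. \<forall>t\<in>L. q s = q t \<longleftrightarrow> s = t \<or> {s, t} = {a, b}"
    using assms unfolding big_circle_from_def by (elim conjE exE, intro that)
  have "quotient_map (order_topology_on L' r') X (q \<circ> g)"
    using q transport_homeomorphic by (meson homeomorphic_map_def quotient_map_compose)
  moreover have "(q \<circ> g) s = (q \<circ> g) t \<longleftrightarrow> s = t \<or> {s, t} = {h a, h b}"
    if "s \<in> L'" "t \<in> L'" for s t
  proof -
    obtain s0 t0 where st: "s0 \<in> L" "t0 \<in> L" "s = h s0" "t = h t0"
      using \<open>s \<in> L'\<close> \<open>t \<in> L'\<close> by (auto simp: L'_def)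
    have "a \<in> L" "b \<in> L" using ab by (auto simp: minimum_of_def maximum_of_def)
    then have "{s, t} = {h a, h b} \<longleftrightarrow> {s0, t0} = {a, b}"
      using h st by (auto simp: inj_on_def doubleton_eq_iff)
    moreover have "s = t \<longleftrightarrow> s0 = t0" using h st by (auto simp: inj_on_def)
    ultimately show ?thesis using fib st by (simp add: transport_g)
  qed
  ultimately show ?thesis
    unfolding big_circle_from_def
    by (intro conjI exI[of _ "h a"] exI[of _ "h b"] exI[of _ "q \<circ> g"] ballI
        transport_big_interval transport_min transport_max ab)
qed

end

lemma big_circle_from_imp_big_circle:
  fixes X :: "'a topology" and L :: "'l set"
  assumes "big_circle_from L r X"
  shows "big_circle X"
proof -
  have bi: "big_interval L r" using assms by (simp add: big_circle_from_def)
  obtain a b and q :: "'l \<Rightarrow> 'a"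
    where fib: "\<forall>s\<in>L. \<forall>t\<in>L. q s = q t \<longleftrightarrow> s = t \<or> {s, t} = {a, b}"
    using assms unfolding big_circle_from_def by (elim conjE exE, intro that)
  define h :: "'l \<Rightarrow> 'a big" where "h = (\<lambda>t. if t = a then {} else {Inl {q t}})"
  have "s = t" if "s \<in> L" "t \<in> L" "h s = h t" for s t
  proof -
    have "(s = a \<longleftrightarrow> t = a) \<and> (s \<noteq> a \<longrightarrow> q s = q t)"
      using that by (auto simp: h_def split: if_splits)
    then show ?thesis using fib that by (metis doubleton_eq_iff)
  qed
  then have "inj_on h L" by (rule inj_onI)
  from transport_big_circle[OF bi this assms] show ?thesis
    unfolding big_circle_def by blast
qed

subsection \<open>A small subset closed under given operations\<close>

lemma small_closed_set:
  fixes f :: "'l \<Rightarrow> 'l \<Rightarrow> 'l" and g k :: "'u \<Rightarrow> 'l \<Rightarrow> 'l" and a b :: 'l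
  obtains M and e :: "'l \<Rightarrow> 'u + nat" where "a \<in> M" "b \<in> M" "inj_on e M"
    "\<And>x y. x \<in> M \<Longrightarrow> y \<in> M \<Longrightarrow> f x y \<in> M"
    "\<And>u x. x \<in> M \<Longrightarrow> g u x \<in> M" "\<And>u x. x \<in> M \<Longrightarrow> k u x \<in> M"
proof -
  define K where "K = (UNIV :: ('u + nat) set)"
  have inf: "infinite K"
    unfolding K_def by simp
  have infF: "infinite (Field (card_of K))" using inf by (simp add: Field_card_of)
  have u: "(card_of (UNIV :: 'u set), card_of K) \<in> ordLeq"
    unfolding K_def using card_of_ordLeq[of "UNIV :: 'u set" "UNIV :: ('u + nat) set"] inj_Inl
    by blast
  define step where "step = (\<lambda>S. S \<union> (\<lambda>(x, y). f x y) ` (S \<times> S) \<union>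
    (\<lambda>(u, x). g u x) ` (UNIV \<times> S) \<union> (\<lambda>(u, x). k u x) ` (UNIV \<times> S))"
  define N where "N = (\<lambda>n. (step ^^ n) {a, b})"
  have N_Suc: "N (Suc n) = step (N n)" for n by (simp add: N_def)
  have sm: "(card_of (N n), card_of K) \<in> ordLeq" for n
  proof (induction n)
    case 0
    have "inj_on (\<lambda>x. Inr (if x = a then 0 else Suc 0) :: 'u + nat) {a, b}"
      by (auto simp: inj_on_def)
    then have "(card_of {a, b}, card_of K) \<in> ordLeq"
      unfolding K_def card_of_ordLeq[symmetric] by blast
    then show ?case by (simp add: N_def)
  next
    case (Suc n)
    have *: "(card_of (\<phi> ` (A \<times> B)), card_of K) \<in> ordLeq"
      if "(card_of A, card_of K) \<in> ordLeq" "(card_of B, card_of K) \<in> ordLeq"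
      for \<phi> :: "'c \<times> 'd \<Rightarrow> 'l" and A B
      using card_of_Times_ordLeq_infinite_Field[OF infF that card_of_Card_order]
        card_of_image ordLeq_transitive by blast
    show ?case unfolding N_Suc step_def
      by (intro card_of_Un_ordLeq_infinite_Field[OF infF] card_of_Card_order * Suc u)
  qed
  define M where "M = (\<Union>n. N n)"
  have mono: "N m \<subseteq> N n" if "m \<le> n" for m n
    using that by (rule lift_Suc_mono_le[rotated]) (auto simp: N_Suc step_def)
  have "(card_of (UNIV :: nat set), card_of K) \<in> ordLeq"
    using inf infinite_iff_card_of_nat by blast
  then have "(card_of M, card_of K) \<in> ordLeq"
    unfolding M_def using card_of_UNION_ordLeq_infinite[OF inf] sm by blast
  then obtain e where e: "inj_on e M" "e ` M \<subseteq> K"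
    using card_of_ordLeq[of M K] by blast
  show ?thesis
  proof (rule that[of M e])
    have "N 0 \<subseteq> M" by (auto simp: M_def)
    then show "a \<in> M" "b \<in> M" by (auto simp: N_def)
    show "inj_on e M" by (fact e)
    show "f x y \<in> M" if xy: "x \<in> M" "y \<in> M" for x y
    proof -
      obtain m n where "x \<in> N m" "y \<in> N n" using xy by (auto simp: M_def)
      then have "x \<in> N (max m n)" "y \<in> N (max m n)"
        using mono[of m "max m n"] mono[of n "max m n"] by auto
      then have "f x y \<in> N (Suc (max m n))" by (auto simp: N_Suc step_def)
      then show ?thesis by (auto simp: M_def)
    qed
    show "g u x \<in> M" if x: "x \<in> M" for u x
    proof -
      obtain n where "x \<in> N n" using x by (auto simp: M_def)
      then have "g u x \<in> N (Suc n)" by (auto simp: N_Suc step_def)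
      then show ?thesis by (auto simp: M_def)
    qed
    show "k u x \<in> M" if x: "x \<in> M" for u x
    proof -
      obtain n where "x \<in> N n" using x by (auto simp: M_def)
      then have "k u x \<in> N (Suc n)" by (auto simp: N_Suc step_def)
      then show ?thesis by (auto simp: M_def)
    qed
  qed
qed


subsection \<open>Replacing the domain of a big path by a small one\<close>

text \<open>A Loewenheim-Skolem argument: pass to a small subset \<open>M\<close> of the big interval that is closed
  under enough operations definable from the path, and take its Dedekind completion.\<close>

locale big_interval_ends =
  fixes L :: "'l set" and r :: "'l rel" and a b :: 'l
  assumes bi: "big_interval L r" and mina: "minimum_of L r a" and maxb: "maximum_of L r b"
begin

abbreviation le (infix "\<sqsubseteq>" 50) where "x \<sqsubseteq> y \<equiv> (x, y) \<in> r"
abbreviation lt (infix "\<sqsubset>" 50) where "x \<sqsubset> y \<equiv> x \<sqsubseteq> y \<and> x \<noteq> y"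

lemma lin: "linear_order_on L r"
  using bi by (simp add: big_interval_def)

lemma sub: "x \<sqsubseteq> y \<Longrightarrow> x \<in> L \<and> y \<in> L"
  using lin by (auto simp: order_on_defs)

lemma le_refl: "x \<in> L \<Longrightarrow> x \<sqsubseteq> x"
  using lin by (auto simp: order_on_defs refl_on_def)

lemma le_trans: "x \<sqsubseteq> y \<Longrightarrow> y \<sqsubseteq> z \<Longrightarrow> x \<sqsubseteq> z"
  using lin unfolding order_on_defs by (meson transD)

lemma le_antisym: "x \<sqsubseteq> y \<Longrightarrow> y \<sqsubseteq> x \<Longrightarrow> x = y"
  using lin unfolding order_on_defs by (meson antisymD)

lemma le_total: "x \<in> L \<Longrightarrow> y \<in> L \<Longrightarrow> x \<sqsubseteq> y \<or> y \<sqsubset> x"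
  using lin le_refl unfolding order_on_defs total_on_def by metis

lemma le_lt_trans: "x \<sqsubseteq> y \<Longrightarrow> y \<sqsubset> z \<Longrightarrow> x \<sqsubset> z"
  using le_trans le_antisym by blast

lemma lt_le_trans: "x \<sqsubset> y \<Longrightarrow> y \<sqsubseteq> z \<Longrightarrow> x \<sqsubset> z"
  using le_trans le_antisym by blast

lemma aL: "a \<in> L" and a_le: "x \<in> L \<Longrightarrow> a \<sqsubseteq> x"
  using mina by (auto simp: minimum_of_def)

lemma bL: "b \<in> L" and le_b: "x \<in> L \<Longrightarrow> x \<sqsubseteq> b"
  using maxb by (auto simp: maximum_of_def)

lemma between: "x \<sqsubset> y \<Longrightarrow> \<exists>z\<in>L. x \<sqsubset> z \<and> z \<sqsubset> y"
proof -
  assume xy: "x \<sqsubset> y"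
  have "dense_order_on L r" using bi by (simp add: big_interval_def)
  then have "\<exists>z\<in>L. (x, z) \<in> r - Id \<and> (z, y) \<in> r - Id"
    using xy sub unfolding dense_order_on_def by blast
  then show ?thesis by blast
qed

lemma a_lt_b: "a \<sqsubset> b"
proof -
  have "\<exists>x\<in>L. \<exists>y\<in>L. x \<noteq> y" using bi by (auto simp: big_interval_def dense_order_on_def)
  then have "a \<noteq> b" using a_le le_b le_antisym by blast
  then show ?thesis using a_le bL by blast
qed

definition lub :: "'l set \<Rightarrow> 'l" where "lub S = (SOME s. supremum_in L r S s)"

lemma lub:
  assumes "S \<subseteq> L" "S \<noteq> {}"
  shows "lub S \<in> L" "x \<in> S \<Longrightarrow> x \<sqsubseteq> lub S" "c \<in> L \<Longrightarrow> (\<And>x. x \<in> S \<Longrightarrow> x \<sqsubseteq> c) \<Longrightarrow> lub S \<sqsubseteq> c"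
proof -
  have "upper_bound_in L r S b" using assms bL le_b by (auto simp: upper_bound_in_def)
  then have "\<exists>s. supremum_in L r S s"
    using bi assms unfolding big_interval_def order_complete_on_def by blast
  then have "supremum_in L r S (lub S)" unfolding lub_def by (rule someI_ex)
  then show "lub S \<in> L" "x \<in> S \<Longrightarrow> x \<sqsubseteq> lub S" "c \<in> L \<Longrightarrow> (\<And>x. x \<in> S \<Longrightarrow> x \<sqsubseteq> c) \<Longrightarrow> lub S \<sqsubseteq> c"
    by (auto simp: supremum_in_def upper_bound_in_def)
qed

lemma lt_lub:
  assumes "S \<subseteq> L" "S \<noteq> {}" "c \<sqsubset> lub S"
  shows "\<exists>x\<in>S. c \<sqsubset> x"
proof (rule ccontr)
  assume "\<not> ?thesis"
  then have "\<And>x. x \<in> S \<Longrightarrow> x \<sqsubseteq> c" using assms le_total sub by blast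
  then have "lub S \<sqsubseteq> c" using lub(3)[OF assms(1,2)] assms(3) sub by blast
  then show False using assms(3) le_antisym by blast
qed

lemma nbhd:
  assumes "openin (order_topology_on L r) V" "p \<in> V"
  shows "p \<in> L \<and> (p \<noteq> a \<longrightarrow> (\<exists>l. l \<sqsubset> p \<and> (\<forall>t. l \<sqsubset> t \<and> t \<sqsubseteq> p \<longrightarrow> t \<in> V))) \<and>
    (p \<noteq> b \<longrightarrow> (\<exists>u. p \<sqsubset> u \<and> (\<forall>t. p \<sqsubseteq> t \<and> t \<sqsubset> u \<longrightarrow> t \<in> V)))"
    (is "?P V p")
proof -
  have "generate_topology_on
    (insert L ({{y \<in> L. (x, y) \<in> r - Id} | x. x \<in> L} \<union> {{y \<in> L. (y, x) \<in> r - Id} | x. x \<in> L})) V"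
    using assms(1) unfolding order_topology_on_def openin_topology_generated_by_iff .
  then have "\<forall>p\<in>V. ?P V p"
  proof induction
    case Empty
    then show ?case by simp
  next
    case (Int V W)
    show ?case
    proof (intro ballI conjI impI)
      fix p assume p: "p \<in> V \<inter> W"
      then have V: "?P V p" and W: "?P W p" using Int.IH by blast+
      show "p \<in> L" using V by blast
      show "\<exists>l. l \<sqsubset> p \<and> (\<forall>t. l \<sqsubset> t \<and> t \<sqsubseteq> p \<longrightarrow> t \<in> V \<inter> W)" if pa: "p \<noteq> a"
      proof -
        obtain l where l: "l \<sqsubset> p" "\<forall>t. l \<sqsubset> t \<and> t \<sqsubseteq> p \<longrightarrow> t \<in> V" using V pa by blast
        obtain m where m: "m \<sqsubset> p" "\<forall>t. m \<sqsubset> t \<and> t \<sqsubseteq> p \<longrightarrow> t \<in> W" using W pa by blast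
        have "l \<sqsubseteq> m \<or> m \<sqsubseteq> l"
          using l(1) m(1) sub[of l p] sub[of m p] le_total[of l m] by blast
        then show ?thesis
        proof
          assume "l \<sqsubseteq> m"
          then have "\<forall>t. m \<sqsubset> t \<and> t \<sqsubseteq> p \<longrightarrow> t \<in> V \<inter> W"
            using l(2) m(2) le_lt_trans[of l m] by blast
          then show ?thesis using m(1) by blast
        next
          assume "m \<sqsubseteq> l"
          then have "\<forall>t. l \<sqsubset> t \<and> t \<sqsubseteq> p \<longrightarrow> t \<in> V \<inter> W"
            using l(2) m(2) le_lt_trans[of m l] by blast
          then show ?thesis using l(1) by blast
        qed
      qed
      show "\<exists>u. p \<sqsubset> u \<and> (\<forall>t. p \<sqsubseteq> t \<and> t \<sqsubset> u \<longrightarrow> t \<in> V \<inter> W)" if pa: "p \<noteq> b"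
      proof -
        obtain l where l: "p \<sqsubset> l" "\<forall>t. p \<sqsubseteq> t \<and> t \<sqsubset> l \<longrightarrow> t \<in> V" using V pa by blast
        obtain m where m: "p \<sqsubset> m" "\<forall>t. p \<sqsubseteq> t \<and> t \<sqsubset> m \<longrightarrow> t \<in> W" using W pa by blast
        have "l \<sqsubseteq> m \<or> m \<sqsubseteq> l"
          using l(1) m(1) sub[of p l] sub[of p m] le_total[of l m] by blast
        then show ?thesis
        proof
          assume "l \<sqsubseteq> m"
          then have "\<forall>t. p \<sqsubseteq> t \<and> t \<sqsubset> l \<longrightarrow> t \<in> V \<inter> W"
            using l(2) m(2) lt_le_trans[of _ l m] by blast
          then show ?thesis using l(1) by blast
        next
          assume "m \<sqsubseteq> l"
          then have "\<forall>t. p \<sqsubseteq> t \<and> t \<sqsubset> m \<longrightarrow> t \<in> V \<inter> W"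
            using l(2) m(2) lt_le_trans[of _ m l] by blast
          then show ?thesis using m(1) by blast
        qed
      qed
    qed
  next
    case (UN K)
    show ?case
    proof
      fix p assume "p \<in> \<Union> K"
      then obtain V where V: "V \<in> K" "p \<in> V" by blast
      then have "?P V p" using UN.IH by blast
      moreover have "V \<subseteq> \<Union> K" using V by blast
      ultimately show "?P (\<Union> K) p" by (meson subsetD)
    qed
  next
    case (Basis V)
    then consider "V = L" | x where "x \<in> L" "V = {y \<in> L. (x, y) \<in> r - Id}"
      | x where "x \<in> L" "V = {y \<in> L. (y, x) \<in> r - Id}" by blast
    then show ?case
    proof cases
      case 1
      have all: "t \<in> V" if "t \<sqsubseteq> u \<or> u \<sqsubseteq> t" for t u using sub that 1 by blast
      show ?thesis
      proof (intro ballI conjI impI)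
        fix p assume p: "p \<in> V"
        show pL: "p \<in> L" using p 1 by blast
        show "\<exists>l. l \<sqsubset> p \<and> (\<forall>t. l \<sqsubset> t \<and> t \<sqsubseteq> p \<longrightarrow> t \<in> V)" if "p \<noteq> a"
          using a_le[OF pL] that all by (intro exI[of _ a]) auto
        show "\<exists>u. p \<sqsubset> u \<and> (\<forall>t. p \<sqsubseteq> t \<and> t \<sqsubset> u \<longrightarrow> t \<in> V)" if "p \<noteq> b"
          using le_b[OF pL] that all by (intro exI[of _ b]) auto
      qed
    next
      case (2 x)
      show ?thesis
      proof (intro ballI conjI impI)
        fix p assume p: "p \<in> V"
        show "p \<in> L" using p 2 by blast
        show "\<exists>l. l \<sqsubset> p \<and> (\<forall>t. l \<sqsubset> t \<and> t \<sqsubseteq> p \<longrightarrow> t \<in> V)"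
        proof (intro exI conjI allI impI)
          show "x \<sqsubseteq> p" "x \<noteq> p" using p 2 by auto
          show "t \<in> V" if "x \<sqsubset> t \<and> t \<sqsubseteq> p" for t using that sub 2 by blast
        qed
        assume "p \<noteq> b"
        moreover have "p \<sqsubseteq> b" using p 2 le_b by blast
        ultimately show "\<exists>u. p \<sqsubset> u \<and> (\<forall>t. p \<sqsubseteq> t \<and> t \<sqsubset> u \<longrightarrow> t \<in> V)"
        proof (intro exI conjI allI impI)
          have "x \<sqsubset> p" using p 2 by auto
          then show "t \<in> V" if "p \<sqsubseteq> t \<and> t \<sqsubset> b" for t
            using lt_le_trans[of x p t] sub[of p t] that 2 by blast
        qed
      qed
    next
      case (3 x)
      show ?thesis
      proof (intro ballI conjI impI)
        fix p assume p: "p \<in> V"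
        show "p \<in> L" using p 3 by blast
        show "\<exists>l. p \<sqsubset> l \<and> (\<forall>t. p \<sqsubseteq> t \<and> t \<sqsubset> l \<longrightarrow> t \<in> V)"
        proof (intro exI conjI allI impI)
          show "p \<sqsubseteq> x" "p \<noteq> x" using p 3 by auto
          show "t \<in> V" if "p \<sqsubseteq> t \<and> t \<sqsubset> x" for t using that sub 3 by blast
        qed
        assume "p \<noteq> a"
        then have "a \<noteq> p" by blast
        moreover have "a \<sqsubseteq> p" using p 3 a_le by blast
        ultimately show "\<exists>u. u \<sqsubset> p \<and> (\<forall>t. u \<sqsubset> t \<and> t \<sqsubseteq> p \<longrightarrow> t \<in> V)"
        proof (intro exI conjI allI impI)
          have "p \<sqsubset> x" using p 3 by auto
          then show "t \<in> V" if "a \<sqsubset> t \<and> t \<sqsubseteq> p" for t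
            using le_lt_trans[of t p x] sub[of t p] that 3 by blast
        qed
      qed
    qed
  qed
  then show ?thesis using assms(2) by blast
qed

definition cuts :: "'l set \<Rightarrow> 'l set set" where
  "cuts M = {A. A \<subseteq> M \<and> (\<forall>m\<in>M. (\<forall>u\<in>M. (\<forall>x\<in>A. x \<sqsubseteq> u) \<longrightarrow> m \<sqsubseteq> u) \<longrightarrow> m \<in> A)}"

definition cuts_le :: "'l set \<Rightarrow> 'l set rel" where
  "cuts_le M = {(A, B). A \<in> cuts M \<and> B \<in> cuts M \<and> A \<subseteq> B}"

definition down :: "'l set \<Rightarrow> 'l \<Rightarrow> 'l set" where
  "down M m = {x \<in> M. x \<sqsubseteq> m}"

context
  fixes M :: "'l set"
  assumes M_sub: "M \<subseteq> L" and aM: "a \<in> M" and bM: "b \<in> M"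
    and betweenM: "x \<in> M \<Longrightarrow> y \<in> M \<Longrightarrow> x \<sqsubset> y \<Longrightarrow> \<exists>z\<in>M. x \<sqsubset> z \<and> z \<sqsubset> y"
begin

lemma cuts_sub: "A \<in> cuts M \<Longrightarrow> A \<subseteq> M"
  by (auto simp: cuts_def)

lemma cuts_least_ub:
  assumes "A \<in> cuts M" "m \<in> M" "m \<notin> A"
  obtains u where "u \<in> M" "\<And>x. x \<in> A \<Longrightarrow> x \<sqsubseteq> u" "u \<sqsubset> m"
proof -
  obtain u where u: "u \<in> M" "\<forall>x\<in>A. x \<sqsubseteq> u" "\<not> m \<sqsubseteq> u"
    using assms unfolding cuts_def by blast
  then have "u \<sqsubset> m" using assms M_sub le_total by blast
  then show ?thesis using u that by blast
qed

lemma cuts_down: "A \<in> cuts M \<Longrightarrow> x \<in> A \<Longrightarrow> y \<in> M \<Longrightarrow> y \<sqsubseteq> x \<Longrightarrow> y \<in> A"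
  by (rule ccontr) (metis cuts_least_ub le_antisym le_trans)

lemma a_in_cut: "A \<in> cuts M \<Longrightarrow> a \<in> A"
  by (rule ccontr) (metis M_sub a_le aM cuts_least_ub le_antisym subsetD)

lemma down_cut: "m \<in> M \<Longrightarrow> down M m \<in> cuts M"
  using M_sub le_refl by (auto simp: cuts_def down_def)

lemma in_down: "m \<in> M \<Longrightarrow> m \<in> down M m"
  using M_sub le_refl by (auto simp: down_def)

lemma cuts_linear: "A \<in> cuts M \<Longrightarrow> B \<in> cuts M \<Longrightarrow> A \<subseteq> B \<or> B \<subseteq> A"
proof (rule ccontr)
  assume AB: "A \<in> cuts M" "B \<in> cuts M" "\<not> (A \<subseteq> B \<or> B \<subseteq> A)"
  then obtain x y where "x \<in> A" "x \<notin> B" "y \<in> B" "y \<notin> A" by blast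
  moreover have "x \<in> M" "y \<in> M" using AB calculation cuts_sub by blast+
  moreover have "x \<sqsubseteq> y \<or> y \<sqsubseteq> x" using calculation M_sub le_total by blast
  ultimately show False using AB cuts_down by blast
qed

lemma min_cuts: "minimum_of (cuts M) (cuts_le M) (down M a)"
proof -
  have "down M a \<subseteq> A" if "A \<in> cuts M" for A
    using a_in_cut[OF that] cuts_down[OF that] by (auto simp: down_def)
  then show ?thesis using down_cut[OF aM] by (auto simp: minimum_of_def cuts_le_def)
qed

lemma down_b: "down M b = M"
  using M_sub le_b by (auto simp: down_def)

lemma max_cuts: "maximum_of (cuts M) (cuts_le M) (down M b)"
proof -
  have "A \<subseteq> down M b" if "A \<in> cuts M" for A
    using cuts_sub[OF that] down_b by blast
  then show ?thesis using down_cut[OF bM] by (auto simp: maximum_of_def cuts_le_def)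
qed

lemma down_mono: "x \<sqsubseteq> y \<Longrightarrow> down M x \<subseteq> down M y"
  using le_trans by (auto simp: down_def)

lemma big_interval_cuts: "big_interval (cuts M) (cuts_le M)"
  unfolding big_interval_def
proof (intro conjI)
  show "linear_order_on (cuts M) (cuts_le M)"
    using cuts_linear
    by (auto simp: order_on_defs cuts_le_def refl_on_def trans_def antisym_def total_on_def)
  show "dense_order_on (cuts M) (cuts_le M)"
    unfolding dense_order_on_def
  proof (intro conjI ballI impI)
    have "b \<notin> down M a" using a_lt_b le_antisym by (auto simp: down_def)
    then have "down M a \<noteq> down M b" using in_down[OF bM] by blast
    then show "\<exists>x\<in>cuts M. \<exists>y\<in>cuts M. x \<noteq> y" using down_cut aM bM by blast
    fix A B assume AB: "A \<in> cuts M" "B \<in> cuts M" "(A, B) \<in> cuts_le M - Id"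
    then obtain y where y: "y \<in> B" "y \<notin> A" by (auto simp: cuts_le_def)
    have yM: "y \<in> M" using y AB cuts_sub by blast
    obtain u where u: "u \<in> M" "\<And>x. x \<in> A \<Longrightarrow> x \<sqsubseteq> u" "u \<sqsubset> y"
      using cuts_least_ub[OF AB(1) yM y(2)] by blast
    obtain v where v: "v \<in> M" "u \<sqsubset> v" "v \<sqsubset> y" using betweenM[OF u(1) yM u(3)] by blast
    have "A \<subseteq> down M v" using u(2) v(2) le_trans cuts_sub[OF AB(1)] by (auto simp: down_def)
    moreover have "v \<notin> A" using u(2) v(2) le_antisym by blast
    moreover have "v \<in> down M v" using in_down v by blast
    moreover have "down M v \<subseteq> B"
      using cuts_down[OF AB(2) y(1)] v le_trans unfolding down_def by blast
    moreover have "y \<notin> down M v" using v le_antisym by (auto simp: down_def)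
    ultimately show "\<exists>z\<in>cuts M. (A, z) \<in> cuts_le M - Id \<and> (z, B) \<in> cuts_le M - Id"
      using AB y down_cut[OF v(1)] unfolding cuts_le_def by (intro bexI[of _ "down M v"]) blast+
  qed
  show "order_complete_on (cuts M) (cuts_le M)"
    unfolding order_complete_on_def
  proof (intro allI impI, elim conjE exE)
    fix \<S> B assume S: "\<S> \<subseteq> cuts M" "\<S> \<noteq> {}"
    define D where "D = {m \<in> M. \<forall>u\<in>M. (\<forall>x\<in>\<Union>\<S>. x \<sqsubseteq> u) \<longrightarrow> m \<sqsubseteq> u}"
    have SM: "\<Union>\<S> \<subseteq> M" using S cuts_sub by blast
    have D: "D \<in> cuts M" unfolding cuts_def
    proof (intro CollectI conjI ballI impI)
      show "D \<subseteq> M" by (auto simp: D_def)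
      fix m assume m: "m \<in> M" "\<forall>u\<in>M. (\<forall>x\<in>D. x \<sqsubseteq> u) \<longrightarrow> m \<sqsubseteq> u"
      have "m \<sqsubseteq> u" if "u \<in> M" "\<forall>x\<in>\<Union>\<S>. x \<sqsubseteq> u" for u
        using m(2) that unfolding D_def by blast
      then show "m \<in> D" using m by (auto simp: D_def)
    qed
    have "A \<subseteq> D" if "A \<in> \<S>" for A using that SM unfolding D_def by blast
    then have "upper_bound_in (cuts M) (cuts_le M) \<S> D"
      using D S by (auto simp: upper_bound_in_def cuts_le_def)
    moreover have "D \<subseteq> B" if B: "upper_bound_in (cuts M) (cuts_le M) \<S> B" for B
    proof
      fix m assume m: "m \<in> D"
      have Bc: "B \<in> cuts M" "\<Union>\<S> \<subseteq> B" using B by (auto simp: upper_bound_in_def cuts_le_def)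
      show "m \<in> B"
      proof (rule ccontr)
        assume "m \<notin> B"
        then obtain u where "u \<in> M" "\<And>x. x \<in> B \<Longrightarrow> x \<sqsubseteq> u" "u \<sqsubset> m"
          using cuts_least_ub[OF Bc(1)] m unfolding D_def by blast
        then show False using m Bc(2) le_antisym unfolding D_def by blast
      qed
    qed
    ultimately have "supremum_in (cuts M) (cuts_le M) \<S> D"
      using D by (auto simp: supremum_in_def cuts_le_def upper_bound_in_def)
    then show "\<exists>s. supremum_in (cuts M) (cuts_le M) \<S> s" by blast
  qed
  show "\<exists>a. minimum_of (cuts M) (cuts_le M) a" "\<exists>b. maximum_of (cuts M) (cuts_le M) b"
    using min_cuts max_cuts by blast+
qed

lemma lub_cut:
  assumes "A \<in> cuts M"
  shows "lub A \<in> L" "x \<in> A \<Longrightarrow> x \<sqsubseteq> lub A" "c \<in> L \<Longrightarrow> (\<And>x. x \<in> A \<Longrightarrow> x \<sqsubseteq> c) \<Longrightarrow> lub A \<sqsubseteq> c"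
    "c \<sqsubset> lub A \<Longrightarrow> \<exists>x\<in>A. c \<sqsubset> x"
  using lub[of A] lt_lub[of A] a_in_cut[OF assms] cuts_sub[OF assms] M_sub by blast+

lemma lub_down: "m \<in> M \<Longrightarrow> lub (down M m) = m"
proof (rule le_antisym)
  assume m: "m \<in> M"
  show "lub (down M m) \<sqsubseteq> m" using lub_cut(3)[OF down_cut[OF m]] m M_sub by (auto simp: down_def)
  show "m \<sqsubseteq> lub (down M m)" using lub_cut(2)[OF down_cut[OF m]] in_down[OF m] by blast
qed

context
  fixes X :: "'a topology" and \<gamma> :: "'l \<Rightarrow> 'a"
  assumes cont: "continuous_map (order_topology_on L r) X \<gamma>"
    and leftM: "openin X U \<Longrightarrow> p \<in> M \<Longrightarrow> \<gamma> p \<in> U \<Longrightarrow> p \<noteq> a \<Longrightarrow>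
      \<exists>l\<in>M. l \<sqsubset> p \<and> (\<forall>t. l \<sqsubset> t \<and> t \<sqsubseteq> p \<longrightarrow> \<gamma> t \<in> U)"
    and rightM: "openin X U \<Longrightarrow> c \<in> M \<Longrightarrow> \<gamma> c \<in> U \<Longrightarrow>
      \<exists>e\<in>M. (\<forall>t. c \<sqsubseteq> t \<and> t \<sqsubset> e \<longrightarrow> \<gamma> t \<in> U) \<and>
        (\<forall>q. c \<sqsubseteq> q \<and> q \<noteq> b \<and> (\<forall>t. c \<sqsubseteq> t \<and> t \<sqsubseteq> q \<longrightarrow> \<gamma> t \<in> U) \<longrightarrow> q \<sqsubset> e)"
begin

lemma open_preimage: "openin X U \<Longrightarrow> openin (order_topology_on L r) {t \<in> L. \<gamma> t \<in> U}"
  using cont by (simp add: continuous_map_def)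

lemma cut_left:
  assumes U: "openin X U" and A: "A \<in> cuts M" "\<gamma> (lub A) \<in> U" "lub A \<noteq> a"
  obtains c where "c \<in> A" "c \<sqsubset> lub A" "\<And>t. c \<sqsubseteq> t \<Longrightarrow> t \<sqsubseteq> lub A \<Longrightarrow> \<gamma> t \<in> U"
proof (cases "lub A \<in> A")
  case True
  then have M: "lub A \<in> M" using cuts_sub A by blast
  obtain l where l: "l \<in> M" "l \<sqsubset> lub A" "\<forall>t. l \<sqsubset> t \<and> t \<sqsubseteq> lub A \<longrightarrow> \<gamma> t \<in> U"
    using leftM[OF U M A(2,3)] by blast
  obtain c where c: "c \<in> M" "l \<sqsubset> c" "c \<sqsubset> lub A" using betweenM[OF l(1) M l(2)] by blast
  have "c \<in> A" using cuts_down[OF A(1) True] c by blast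
  moreover have "\<gamma> t \<in> U" if "c \<sqsubseteq> t" "t \<sqsubseteq> lub A" for t
    using l(3) lt_le_trans[OF c(2) that(1)] that(2) by blast
  ultimately show ?thesis using c that by blast
next
  case False
  obtain l where l: "l \<sqsubset> lub A" "\<forall>t. l \<sqsubset> t \<and> t \<sqsubseteq> lub A \<longrightarrow> \<gamma> t \<in> U"
    using nbhd[OF open_preimage[OF U], of "lub A"] A(2,3) lub_cut(1)[OF A(1)] by auto
  obtain c where c: "c \<in> A" "l \<sqsubset> c" using lub_cut(4)[OF A(1) l(1)] by blast
  have "c \<sqsubset> lub A" using lub_cut(2)[OF A(1)] c False by blast
  moreover have "\<gamma> t \<in> U" if "c \<sqsubseteq> t" "t \<sqsubseteq> lub A" for t
    using l(2) lt_le_trans[OF c(2) that(1)] that(2) by blast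
  ultimately show ?thesis using c that by blast
qed

lemma cut_right:
  assumes U: "openin X U" and A: "A \<in> cuts M" "\<gamma> (lub A) \<in> U" "A \<noteq> M"
  obtains d where "d \<in> M" "d \<notin> A" "\<And>t. lub A \<sqsubseteq> t \<Longrightarrow> t \<sqsubseteq> d \<Longrightarrow> \<gamma> t \<in> U"
proof -
  have lb: "lub A \<noteq> b"
  proof
    assume lb: "lub A = b"
    have "m \<in> A" if m: "m \<in> M" for m
    proof (rule ccontr)
      assume "m \<notin> A"
      then obtain u where u: "u \<in> M" "\<And>x. x \<in> A \<Longrightarrow> x \<sqsubseteq> u" "u \<sqsubset> m"
        using cuts_least_ub[OF A(1) m] by blast
      then have "lub A \<sqsubseteq> u" using lub_cut(3)[OF A(1)] M_sub by blast
      moreover have "m \<sqsubseteq> b" using m M_sub le_b by blast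
      ultimately show False using u lb le_antisym le_trans by blast
    qed
    then show False using A cuts_sub by blast
  qed
  have lL: "lub A \<in> L" using lub_cut A by blast
  show ?thesis
  proof (cases "lub A \<in> A")
    case True
    then have M: "lub A \<in> M" using cuts_sub A by blast
    obtain e where e: "e \<in> M" "\<forall>t. lub A \<sqsubseteq> t \<and> t \<sqsubset> e \<longrightarrow> \<gamma> t \<in> U"
      "\<forall>q. lub A \<sqsubseteq> q \<and> q \<noteq> b \<and> (\<forall>t. lub A \<sqsubseteq> t \<and> t \<sqsubseteq> q \<longrightarrow> \<gamma> t \<in> U) \<longrightarrow> q \<sqsubset> e"
      using rightM[OF U M A(2)] by blast
    have "\<forall>t. lub A \<sqsubseteq> t \<and> t \<sqsubseteq> lub A \<longrightarrow> \<gamma> t \<in> U" using A(2) le_antisym by metis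
    then have "lub A \<sqsubset> e" using e(3) lb le_refl[OF lL] by blast
    then obtain d where d: "d \<in> M" "lub A \<sqsubset> d" "d \<sqsubset> e" using betweenM[OF M e(1)] by blast
    have "d \<notin> A" using d lub_cut(2)[OF A(1)] le_antisym by blast
    moreover have "\<gamma> t \<in> U" if "lub A \<sqsubseteq> t" "t \<sqsubseteq> d" for t
      using e(2) that le_lt_trans[OF that(2) d(3)] by blast
    ultimately show ?thesis using d that by blast
  next
    case False
    then have "lub A \<noteq> a" using a_in_cut A by metis
    then obtain c where c: "c \<in> A" "c \<sqsubset> lub A" "\<And>t. c \<sqsubseteq> t \<Longrightarrow> t \<sqsubseteq> lub A \<Longrightarrow> \<gamma> t \<in> U"
      using cut_left[OF U A(1,2)] by blast
    have cM: "c \<in> M" using c cuts_sub A by blast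
    have cU: "\<gamma> c \<in> U" using c le_refl M_sub cM by blast
    obtain e where e: "e \<in> M" "\<forall>t. c \<sqsubseteq> t \<and> t \<sqsubset> e \<longrightarrow> \<gamma> t \<in> U"
      "\<forall>q. c \<sqsubseteq> q \<and> q \<noteq> b \<and> (\<forall>t. c \<sqsubseteq> t \<and> t \<sqsubseteq> q \<longrightarrow> \<gamma> t \<in> U) \<longrightarrow> q \<sqsubset> e"
      using rightM[OF U cM cU] by blast
    have le: "lub A \<sqsubset> e" using e(3) c lb by blast
    then have "e \<notin> A" using lub_cut(2)[OF A(1)] le_antisym by blast
    then obtain d where d: "d \<in> M" "\<And>x. x \<in> A \<Longrightarrow> x \<sqsubseteq> d" "d \<sqsubset> e"
      using cuts_least_ub[OF A(1) e(1)] by blast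
    have ld: "lub A \<sqsubseteq> d" using lub_cut(3)[OF A(1)] d M_sub by blast
    have "d \<notin> A" using False ld lub_cut(2)[OF A(1)] le_antisym by metis
    moreover have "\<gamma> t \<in> U" if "lub A \<sqsubseteq> t" "t \<sqsubseteq> d" for t
      using e(2) le_trans[OF _ that(1)] c(2) le_lt_trans[OF that(2) d(3)] by blast
    ultimately show ?thesis using d that by blast
  qed
qed

lemma lub_mono: "A \<in> cuts M \<Longrightarrow> B \<in> cuts M \<Longrightarrow> A \<subseteq> B \<Longrightarrow> lub A \<sqsubseteq> lub B"
  using lub_cut(3)[of A "lub B"] lub_cut(1,2)[of B] by blast

lemma cuts_continuous: "continuous_map (order_topology_on (cuts M) (cuts_le M)) X (\<lambda>A. \<gamma> (lub A))"
  unfolding continuous_map_def topspace_order_topology_on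
proof (intro conjI allI impI)
  have "\<gamma> t \<in> topspace X" if "t \<in> L" for t
    using cont that by (auto simp: continuous_map_def)
  then show "(\<lambda>A. \<gamma> (lub A)) \<in> cuts M \<rightarrow> topspace X" using lub_cut(1) by blast
  fix U assume U: "openin X U"
  let ?T = "order_topology_on (cuts M) (cuts_le M)"
  let ?V = "{A \<in> cuts M. \<gamma> (lub A) \<in> U}"
  show "openin ?T ?V"
  proof (subst openin_subopen, intro ballI)
    fix A assume "A \<in> ?V"
    then have A: "A \<in> cuts M" "\<gamma> (lub A) \<in> U" by auto
    have top: "openin ?T (cuts M)"
      by (metis openin_topspace topspace_order_topology_on)
    have "\<exists>W. openin ?T W \<and> A \<in> W \<and> (\<forall>B\<in>W. B \<subseteq> A \<longrightarrow> B \<in> ?V)"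
    proof (cases "lub A = a")
      case True
      have "lub B = lub A" if B: "B \<in> cuts M" "B \<subseteq> A" for B
        using lub_mono[OF B(1) A(1) B(2)] a_le lub_cut(1)[OF B(1)] True le_antisym by metis
      then have "\<forall>B\<in>cuts M. B \<subseteq> A \<longrightarrow> B \<in> ?V" using A(2) by simp
      then show ?thesis using top A(1) by blast
    next
      case False
      obtain c where c: "c \<in> A" "c \<sqsubset> lub A" "\<And>t. c \<sqsubseteq> t \<Longrightarrow> t \<sqsubseteq> lub A \<Longrightarrow> \<gamma> t \<in> U"
        using cut_left[OF U A False] by blast
      have cM: "c \<in> M" using c cuts_sub A by blast
      let ?W = "{B \<in> cuts M. (down M c, B) \<in> cuts_le M - Id}"
      have "down M c \<subseteq> A" using cuts_down[OF A(1) c(1)] by (auto simp: down_def)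
      moreover have "down M c \<noteq> A" using lub_down[OF cM] c(2) by metis
      ultimately have "A \<in> ?W" using A down_cut[OF cM] by (auto simp: cuts_le_def)
      moreover have "B \<in> ?V" if B: "B \<in> ?W" "B \<subseteq> A" for B
      proof -
        have Bc: "B \<in> cuts M" "down M c \<subseteq> B" using B by (auto simp: cuts_le_def)
        have "c \<sqsubseteq> lub B" using lub_cut(2)[OF Bc(1)] Bc(2) in_down[OF cM] by blast
        moreover have "lub B \<sqsubseteq> lub A" using lub_mono Bc A B by blast
        ultimately show ?thesis using c(3) Bc by blast
      qed
      ultimately show ?thesis using openin_upper_ray[OF down_cut[OF cM]] by blast
    qed
    then obtain W1 where W1: "openin ?T W1" "A \<in> W1" "\<And>B. B \<in> W1 \<Longrightarrow> B \<subseteq> A \<Longrightarrow> B \<in> ?V"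
      by blast
    have "\<exists>W. openin ?T W \<and> A \<in> W \<and> (\<forall>B\<in>W. A \<subseteq> B \<longrightarrow> B \<in> ?V)"
    proof (cases "A = M")
      case True
      have "\<forall>B\<in>cuts M. A \<subseteq> B \<longrightarrow> B \<in> ?V"
      proof (intro ballI impI)
        fix B assume "B \<in> cuts M" "A \<subseteq> B"
        then have "B = A" using True cuts_sub by blast
        then show "B \<in> ?V" using A by simp
      qed
      then show ?thesis using top A(1) by blast
    next
      case False
      obtain d where d: "d \<in> M" "d \<notin> A" "\<And>t. lub A \<sqsubseteq> t \<Longrightarrow> t \<sqsubseteq> d \<Longrightarrow> \<gamma> t \<in> U"
        using cut_right[OF U A False] by blast
      let ?W = "{B \<in> cuts M. (B, down M d) \<in> cuts_le M - Id}"
      have "\<not> down M d \<subseteq> A" using d in_down by blast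
      then have "A \<subseteq> down M d" "A \<noteq> down M d"
        using cuts_linear[OF A(1) down_cut[OF d(1)]] by blast+
      then have "A \<in> ?W" using A down_cut[OF d(1)] by (auto simp: cuts_le_def)
      moreover have "B \<in> ?V" if B: "B \<in> ?W" "A \<subseteq> B" for B
      proof -
        have Bc: "B \<in> cuts M" "B \<subseteq> down M d" using B by (auto simp: cuts_le_def)
        have "lub B \<sqsubseteq> d"
          using lub_mono[OF Bc(1) down_cut[OF d(1)] Bc(2)] lub_down[OF d(1)] by simp
        moreover have "lub A \<sqsubseteq> lub B" using lub_mono Bc A B by blast
        ultimately show ?thesis using d(3) Bc by blast
      qed
      ultimately show ?thesis using openin_lower_ray[OF down_cut[OF d(1)]] by blast
    qed
    then obtain W2 where W2: "openin ?T W2" "A \<in> W2" "\<And>B. B \<in> W2 \<Longrightarrow> A \<subseteq> B \<Longrightarrow> B \<in> ?V"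
      by blast
    have "B \<in> ?V" if B: "B \<in> W1 \<inter> W2" for B
    proof -
      have "B \<in> cuts M" using openin_subset[OF W1(1)] B by auto
      then have "B \<subseteq> A \<or> A \<subseteq> B" using cuts_linear A by blast
      then show ?thesis using W1(3) W2(3) B by blast
    qed
    then show "\<exists>T. openin ?T T \<and> A \<in> T \<and> T \<subseteq> ?V"
      using openin_Int[OF W1(1) W2(1)] W1(2) W2(2) by (intro exI[of _ "W1 \<inter> W2"]) blast
  qed
qed

lemma big_path_cuts: "big_path X (cuts M) (cuts_le M) (\<lambda>A. \<gamma> (lub A)) (\<gamma> a) (\<gamma> b)"
  unfolding big_path_def
  using big_interval_cuts cuts_continuous min_cuts max_cuts lub_down[OF aM] lub_down[OF bM]
  by (intro conjI exI[of _ "down M a"] exI[of _ "down M b"]) auto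

end
end
end

lemma big_path_imp_joined:
  fixes X :: "'a topology" and L :: "'l set"
  assumes "big_path X L r \<gamma> x y"
  shows "big_path_joined X x y"
proof -
  obtain a b where bi: "big_interval L r" and cont: "continuous_map (order_topology_on L r) X \<gamma>"
    and ab: "minimum_of L r a" "maximum_of L r b" and xy: "\<gamma> a = x" "\<gamma> b = y"
    using assms unfolding big_path_def by blast
  interpret big_interval_ends L r a b using bi ab by unfold_locales
  have pre: "openin (order_topology_on L r) {t \<in> L. \<gamma> t \<in> U}" if "openin X U" for U
    using cont that by (simp add: continuous_map_def)
  note nb = nbhd[OF pre]
  let ?L = "\<lambda>U p l. (l, p) \<in> r \<and> l \<noteq> p \<and> (\<forall>t. (l, t) \<in> r \<and> l \<noteq> t \<and> (t, p) \<in> r \<longrightarrow> \<gamma> t \<in> U)"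
  let ?R = "\<lambda>U c e. e \<in> L \<and> (\<forall>t. (c, t) \<in> r \<and> (t, e) \<in> r \<and> t \<noteq> e \<longrightarrow> \<gamma> t \<in> U) \<and>
    (\<forall>q. (c, q) \<in> r \<and> q \<noteq> b \<and> (\<forall>t. (c, t) \<in> r \<and> (t, q) \<in> r \<longrightarrow> \<gamma> t \<in> U) \<longrightarrow> (q, e) \<in> r \<and> q \<noteq> e)"
  let ?D = "\<lambda>x y z. z \<in> L \<and> (x, z) \<in> r \<and> x \<noteq> z \<and> (z, y) \<in> r \<and> z \<noteq> y"
  have exL: "\<exists>l. ?L U p l" if "openin X U" "p \<in> L" "\<gamma> p \<in> U" "p \<noteq> a" for U p
    using nb[OF that(1), of p] that by auto
  have exR: "\<exists>e. ?R U c e" if U: "openin X U" and c: "c \<in> L" "\<gamma> c \<in> U" for U c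
  proof -
    define Q where "Q = {q. (c, q) \<in> r \<and> (\<forall>t. (c, t) \<in> r \<and> (t, q) \<in> r \<longrightarrow> \<gamma> t \<in> U)}"
    have QL: "Q \<subseteq> L" using sub unfolding Q_def by blast
    have cQ: "c \<in> Q" using c le_refl le_antisym unfolding Q_def by blast
    define e where "e = lub Q"
    have eL: "e \<in> L" and eub: "\<And>q. q \<in> Q \<Longrightarrow> (q, e) \<in> r"
      using lub[OF QL] cQ unfolding e_def by blast+
    have "\<gamma> t \<in> U" if t: "(c, t) \<in> r" "(t, e) \<in> r" "t \<noteq> e" for t
    proof -
      obtain q where "q \<in> Q" "(t, q) \<in> r"
        using lt_lub[OF QL, of t] cQ t unfolding e_def by blast
      then show ?thesis using t(1) unfolding Q_def by blast
    qed
    moreover have "(q, e) \<in> r \<and> q \<noteq> e"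
      if q: "(c, q) \<in> r" "q \<noteq> b" "\<forall>t. (c, t) \<in> r \<and> (t, q) \<in> r \<longrightarrow> \<gamma> t \<in> U" for q
    proof -
      have qL: "q \<in> L" using sub q by blast
      have qU: "\<gamma> q \<in> U" using q le_refl[OF qL] by blast
      obtain u where u: "(q, u) \<in> r" "q \<noteq> u" "\<forall>t. (q, t) \<in> r \<and> (t, u) \<in> r \<and> t \<noteq> u \<longrightarrow> \<gamma> t \<in> U"
        using nb[OF U, of q] qL qU q(2) by auto
      obtain v where v: "v \<in> L" "(q, v) \<in> r" "q \<noteq> v" "(v, u) \<in> r" "v \<noteq> u"
        using between[of q u] u by blast
      have "\<gamma> t \<in> U" if t: "(c, t) \<in> r" "(t, v) \<in> r" for t
      proof (cases "(t, q) \<in> r")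
        case True
        then show ?thesis using q t by blast
      next
        case False
        have "t \<in> L" using sub t by blast
        then have "(q, t) \<in> r" using False le_total qL by blast
        then show ?thesis using u(3) le_lt_trans[OF t(2)] v by blast
      qed
      then have "v \<in> Q" using le_trans[OF q(1) v(2)] unfolding Q_def by blast
      then show ?thesis using eub lt_le_trans v by blast
    qed
    ultimately show ?thesis using eL by blast
  qed
  have exD: "\<exists>z. ?D x y z" if "(x, y) \<in> r \<and> x \<noteq> y" for x y
    using between[OF that] by blast
  obtain M0 and e :: "'l \<Rightarrow> 'a set + nat" where M0: "a \<in> M0" "b \<in> M0" "inj_on e M0"
    "\<And>x y. x \<in> M0 \<Longrightarrow> y \<in> M0 \<Longrightarrow> (SOME z. ?D x y z) \<in> M0"
    "\<And>U x. x \<in> M0 \<Longrightarrow> (SOME l. ?L U x l) \<in> M0" "\<And>U x. x \<in> M0 \<Longrightarrow> (SOME l. ?R U x l) \<in> M0"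
    using small_closed_set[of a b "\<lambda>x y. SOME z. ?D x y z" "\<lambda>U x. SOME l. ?L U x l"
      "\<lambda>U x. SOME l. ?R U x l"] by blast
  define M where "M = M0 \<inter> L"
  have "big_path X (cuts M) (cuts_le M) (\<lambda>A. \<gamma> (lub A)) (\<gamma> a) (\<gamma> b)"
  proof (rule big_path_cuts[OF _ _ _ _ cont])
    show "M \<subseteq> L" "a \<in> M" "b \<in> M" using M0(1,2) aL bL by (auto simp: M_def)
    show "\<exists>z\<in>M. ((x, z) \<in> r \<and> x \<noteq> z) \<and> (z, y) \<in> r \<and> z \<noteq> y"
      if "x \<in> M" "y \<in> M" "(x, y) \<in> r \<and> x \<noteq> y" for x y
    proof -
      have "?D x y (SOME z. ?D x y z)" using exD[OF that(3)] by (rule someI_ex)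
      moreover have "(SOME z. ?D x y z) \<in> M0" using M0(4) that by (simp add: M_def)
      ultimately show ?thesis unfolding M_def by blast
    qed
    show "\<exists>l\<in>M. ((l, p) \<in> r \<and> l \<noteq> p) \<and> (\<forall>t. ((l, t) \<in> r \<and> l \<noteq> t) \<and> (t, p) \<in> r \<longrightarrow> \<gamma> t \<in> U)"
      if "openin X U" "p \<in> M" "\<gamma> p \<in> U" "p \<noteq> a" for U p
    proof -
      have "?L U p (SOME l. ?L U p l)"
        by (rule someI_ex, rule exL) (use that in \<open>auto simp: M_def\<close>)
      moreover have "(SOME l. ?L U p l) \<in> M0" using M0(5) that by (simp add: M_def)
      moreover have "(SOME l. ?L U p l) \<in> L" using calculation(1) sub by blast
      ultimately show ?thesis unfolding M_def by blast
    qed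
    show "\<exists>e\<in>M. (\<forall>t. (c, t) \<in> r \<and> (t, e) \<in> r \<and> t \<noteq> e \<longrightarrow> \<gamma> t \<in> U) \<and>
        (\<forall>q. (c, q) \<in> r \<and> q \<noteq> b \<and> (\<forall>t. (c, t) \<in> r \<and> (t, q) \<in> r \<longrightarrow> \<gamma> t \<in> U) \<longrightarrow>
          (q, e) \<in> r \<and> q \<noteq> e)"
      if "openin X U" "c \<in> M" "\<gamma> c \<in> U" for U c
    proof -
      have "?R U c (SOME e. ?R U c e)"
        by (rule someI_ex, rule exR) (use that in \<open>auto simp: M_def\<close>)
      moreover have "(SOME e. ?R U c e) \<in> M0" using M0(6) that by (simp add: M_def)
      ultimately show ?thesis unfolding M_def by blast
    qed
  qed
  then have p: "big_path X (cuts M) (cuts_le M) (\<lambda>A. \<gamma> (lub A)) x y" using xy by simp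
  have "cuts M \<subseteq> Pow M0" by (auto simp: cuts_def M_def)
  then have "inj_on ((`) e) (cuts M)"
    using inj_on_image_Pow[OF M0(3)] inj_on_subset by blast
  moreover have "big_interval (cuts M) (cuts_le M)" using p by (simp add: big_path_def)
  ultimately show ?thesis
    using transport_big_path[OF _ _ p] unfolding big_path_joined_def by blast
qed

end

theory Submission
  imports Defs
begin

text \<open>The four properties are linked in a cycle: compact 2-flimsy spaces are big circles, big circles
  are 2-flimsy and 2-big-path-flimsy, 2-flimsy spaces are Hausdorff, and Hausdorff 2-big-path-flimsy
  spaces are compact and 2-flimsy.

  The engine is a crossing property. Let \<open>X\<close> be 2-flimsy, let \<open>U\<close> and \<open>V\<close> separate the complement of
  \<open>{x, y}\<close>, let \<open>u \<in> U\<close>, \<open>v \<in> V\<close>, and let \<open>E\<close> and \<open>F\<close> separate the complement of \<open>{u, v}\<close>. Then \<open>x\<close> and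
  \<open>y\<close> lie on different sides of this second separation. Indeed, if both were in \<open>E\<close>, the sets
  \<open>F \<union> {u}\<close> and \<open>F \<union> {v}\<close> would be connected and avoid \<open>x\<close> and \<open>y\<close>, so \<open>F \<subseteq> U \<inter> V\<close>. In particular any
  two points are separated in the complement of two other points. Hence \<open>X\<close> is a T1 space, the sides
  of two points are open, and \<open>X\<close> is Hausdorff (\<open>splits_crossing\<close>, \<open>two_flimsy_Hausdorff\<close>).

  Let \<open>X\<close> be compact and 2-flimsy, and let \<open>p \<noteq> q\<close> with sides \<open>U\<close> and \<open>V\<close>. By the crossing property each
  point of \<open>U\<close> separates \<open>p\<close> from \<open>q\<close> in \<open>U \<union> {p, q}\<close>. Ordering the points by inclusion of the parts
  that contain \<open>p\<close> turns this compact connected space into a big interval: density and completeness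
  express connectedness, and compactness identifies the topologies (\<open>splits_big_interval\<close>). The same
  holds for \<open>V\<close>, and the concatenation of the two big intervals has the big circle \<open>X\<close> as quotient.

  In a Hausdorff 2-big-path-flimsy space the crossing property holds for big-path components in place
  of separations (\<open>avoid_crossing\<close>). It implies that the complement of \<open>{x, y}\<close> has exactly two
  components \<open>A\<close> and \<open>B\<close>, and that a big path from \<open>x\<close> to \<open>y\<close> in \<open>A \<union> {x, y}\<close> runs through all of \<open>A\<close>.
  So \<open>A \<union> {x, y}\<close> is compact, hence closed, and so is \<open>B \<union> {x, y}\<close>. Therefore \<open>X\<close> is compact, and
  \<open>A\<close> and \<open>B\<close> separate the complement of \<open>{x, y}\<close>.

  In a big circle any two points bound two open arcs, and they are joined along each of them. This
  shows that big circles are 2-flimsy. A connected set that contains \<open>x\<close> and \<open>y\<close> contains one of the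
  two arcs, by the crossing property again, so connected subsets are big-path-connected. The
  converse holds in every space, as big intervals are connected.\<close>

section \<open>Topology of big intervals\<close>

context big_interval_ends
begin

text \<open>Induction along a big interval: a property that passes from all points below \<open>x\<close> to \<open>x\<close>,
  and from \<open>x\<close> to some points above it, holds everywhere, by completeness. The limit premise \<open>lim\<close>
  at the minimum \<open>a\<close> is the base case.\<close>

lemma order_continuous_induct:
  assumes "x \<in> L"
    and lim: "\<And>x. x \<in> L \<Longrightarrow> (\<And>t. t \<sqsubset> x \<Longrightarrow> P t) \<Longrightarrow> P x"
    and suc: "\<And>x. x \<in> L \<Longrightarrow> x \<noteq> b \<Longrightarrow> P x \<Longrightarrow> \<exists>y. x \<sqsubset> y \<and> (\<forall>t. x \<sqsubset> t \<and> t \<sqsubset> y \<longrightarrow> P t)"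
  shows "P x"
proof -
  define S where "S = {x \<in> L. \<forall>t. t \<sqsubseteq> x \<longrightarrow> P t}"
  have SL: "S \<subseteq> L" by (auto simp: S_def)
  have "P t" if "t \<sqsubseteq> a" for t
    using that a_le[of t] sub[of t a] le_antisym[of t a] lim[OF aL] a_le le_antisym sub by metis
  then have "a \<in> S" using aL by (auto simp: S_def)
  then have ne: "S \<noteq> {}" by blast
  define s where "s = lub S"
  have sL: "s \<in> L" using lub[OF SL ne] s_def by blast
  have below: "P t" if "t \<sqsubset> s" for t
    using lt_lub[OF SL ne] that unfolding s_def S_def by blast
  then have Ps: "P s" using lim[OF sL] by blast
  have "s = b"
  proof (rule ccontr)
    assume "s \<noteq> b"
    then obtain y where y: "s \<sqsubset> y" "\<forall>t. s \<sqsubset> t \<and> t \<sqsubset> y \<longrightarrow> P t"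
      using suc[OF sL] Ps by blast
    obtain z where z: "z \<in> L" "s \<sqsubset> z" "z \<sqsubset> y" using between[OF y(1)] by blast
    have "P t" if "t \<sqsubseteq> z" for t
    proof (cases "s \<sqsubset> t")
      case True then show ?thesis using y(2) le_lt_trans[OF that z(3)] by blast
    next
      case False
      then have "t \<sqsubseteq> s" using le_total[of t s] sub[OF that] sL by blast
      then show ?thesis using below Ps by blast
    qed
    then have "z \<in> S" using z by (auto simp: S_def)
    then have "z \<sqsubseteq> s" using lub(2)[OF SL ne] s_def by blast
    then show False using z le_antisym by blast
  qed
  then show ?thesis using below Ps le_b[OF \<open>x \<in> L\<close>] by blast
qed

lemma open_left:
  "openin (order_topology_on L r) V \<Longrightarrow> p \<in> V \<Longrightarrow> p \<noteq> a \<Longrightarrow> \<exists>l. l \<sqsubset> p \<and> (\<forall>t. l \<sqsubset> t \<and> t \<sqsubseteq> p \<longrightarrow> t \<in> V)"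
  and open_right:
  "openin (order_topology_on L r) V \<Longrightarrow> p \<in> V \<Longrightarrow> p \<noteq> b \<Longrightarrow> \<exists>u. p \<sqsubset> u \<and> (\<forall>t. p \<sqsubseteq> t \<and> t \<sqsubset> u \<longrightarrow> t \<in> V)"
  using nbhd[of V p] by simp_all

text \<open>The converse of the local description of open sets by half-open intervals.\<close>

lemma order_openI:
  assumes VL: "V \<subseteq> L"
    and left: "\<And>p. p \<in> V \<Longrightarrow> p \<noteq> a \<Longrightarrow> \<exists>l. l \<sqsubset> p \<and> (\<forall>t. l \<sqsubset> t \<and> t \<sqsubset> p \<longrightarrow> t \<in> V)"
    and right: "\<And>p. p \<in> V \<Longrightarrow> p \<noteq> b \<Longrightarrow> \<exists>u. p \<sqsubset> u \<and> (\<forall>t. p \<sqsubset> t \<and> t \<sqsubset> u \<longrightarrow> t \<in> V)"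
  shows "openin (order_topology_on L r) V"
proof (subst openin_subopen, intro ballI)
  fix p assume p: "p \<in> V"
  let ?T = "order_topology_on L r"
  have top: "openin ?T L" by (metis openin_topspace topspace_order_topology_on)
  have "\<exists>W. openin ?T W \<and> p \<in> W \<and> (\<forall>t\<in>W. t \<sqsubset> p \<longrightarrow> t \<in> V)"
  proof (cases "p = a")
    case True
    then show ?thesis using top p VL a_le le_antisym sub by blast
  next
    case False
    then obtain l where l: "l \<sqsubset> p" "\<forall>t. l \<sqsubset> t \<and> t \<sqsubset> p \<longrightarrow> t \<in> V" using left p by blast
    then show ?thesis using openin_upper_ray[of l L r] sub[of l p] p
      by (intro exI[of _ "{y \<in> L. (l, y) \<in> r - Id}"]) auto
  qed
  then obtain W1 where W1: "openin ?T W1" "p \<in> W1" "\<forall>t\<in>W1. t \<sqsubset> p \<longrightarrow> t \<in> V" by blast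
  have "\<exists>W. openin ?T W \<and> p \<in> W \<and> (\<forall>t\<in>W. p \<sqsubset> t \<longrightarrow> t \<in> V)"
  proof (cases "p = b")
    case True
    then show ?thesis using top p VL le_b le_antisym sub by blast
  next
    case False
    then obtain l where l: "p \<sqsubset> l" "\<forall>t. p \<sqsubset> t \<and> t \<sqsubset> l \<longrightarrow> t \<in> V" using right p by blast
    then show ?thesis using openin_lower_ray[of l L r] sub[of p l] p
      by (intro exI[of _ "{y \<in> L. (y, l) \<in> r - Id}"]) auto
  qed
  then obtain W2 where W2: "openin ?T W2" "p \<in> W2" "\<forall>t\<in>W2. p \<sqsubset> t \<longrightarrow> t \<in> V" by blast
  have "t \<in> V" if t: "t \<in> W1 \<inter> W2" for t
  proof -
    have "t \<in> L" using openin_subset[OF W1(1)] t by auto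
    then have "t \<sqsubset> p \<or> t = p \<or> p \<sqsubset> t" using le_total[of t p] p VL by blast
    then show ?thesis using W1 W2 t p by blast
  qed
  then show "\<exists>T. openin ?T T \<and> p \<in> T \<and> T \<subseteq> V"
    using openin_Int[OF W1(1) W2(1)] W1(2) W2(2) by (intro exI[of _ "W1 \<inter> W2"]) blast
qed

lemma compact_order_topology: "compact_space (order_topology_on L r)"
  unfolding compact_space_alt topspace_order_topology_on
proof (intro allI impI)
  fix \<U> assume "(\<forall>U\<in>\<U>. openin (order_topology_on L r) U) \<and> L \<subseteq> \<Union>\<U>"
  then have op: "\<And>U. U \<in> \<U> \<Longrightarrow> openin (order_topology_on L r) U" and cov: "L \<subseteq> \<Union>\<U>" by auto
  \<comment> \<open>\<open>P x\<close>: finitely many members of the cover suffice for the interval from \<open>a\<close> to \<open>x\<close>.\<close>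
  define P where "P = (\<lambda>x. \<exists>\<F>. finite \<F> \<and> \<F> \<subseteq> \<U> \<and> {t. t \<sqsubseteq> x} \<subseteq> \<Union>\<F>)"
  have "P b"
  proof (rule order_continuous_induct[OF bL])
    fix x assume x: "x \<in> L" and IH: "\<And>t. t \<sqsubset> x \<Longrightarrow> P t"
    obtain U where U: "U \<in> \<U>" "x \<in> U" using cov x by blast
    show "P x"
    proof (cases "x = a")
      case True
      then have "{t. t \<sqsubseteq> x} \<subseteq> {a}" using a_le le_antisym sub by blast
      then have "{t. t \<sqsubseteq> x} \<subseteq> \<Union>{U}" using U True by blast
      then show ?thesis unfolding P_def using U by blast
    next
      case False
      then obtain l where l: "l \<sqsubset> x" "\<forall>t. l \<sqsubset> t \<and> t \<sqsubseteq> x \<longrightarrow> t \<in> U"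
        using open_left[OF op[OF U(1)] U(2)] by blast
      obtain \<F> where F: "finite \<F>" "\<F> \<subseteq> \<U>" "{t. t \<sqsubseteq> l} \<subseteq> \<Union>\<F>"
        using IH[OF l(1)] unfolding P_def by blast
      have "{t. t \<sqsubseteq> x} \<subseteq> \<Union>(insert U \<F>)"
      proof
        fix t assume "t \<in> {t. t \<sqsubseteq> x}"
        then have t: "t \<sqsubseteq> x" by simp
        then have "t \<sqsubseteq> l \<or> l \<sqsubset> t" using le_total[of t l] sub[of l x] sub[of t x] l by blast
        then show "t \<in> \<Union>(insert U \<F>)" using F l t by blast
      qed
      then show ?thesis unfolding P_def using F U by (intro exI[of _ "insert U \<F>"]) auto
    qed
  next
    fix x assume x: "x \<in> L" "x \<noteq> b" and "P x"
    then obtain \<F> where F: "finite \<F>" "\<F> \<subseteq> \<U>" "{t. t \<sqsubseteq> x} \<subseteq> \<Union>\<F>"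
      unfolding P_def by blast
    obtain U where U: "U \<in> \<U>" "x \<in> U" using cov x by blast
    obtain u where u: "x \<sqsubset> u" "\<forall>t. x \<sqsubseteq> t \<and> t \<sqsubset> u \<longrightarrow> t \<in> U"
      using open_right[OF op[OF U(1)] U(2) x(2)] by blast
    have "P t" if t: "x \<sqsubset> t" "t \<sqsubset> u" for t
    proof -
      have "{y. y \<sqsubseteq> t} \<subseteq> \<Union>(insert U \<F>)"
      proof
        fix y assume "y \<in> {y. y \<sqsubseteq> t}"
        then have y: "y \<sqsubseteq> t" by simp
        then have "y \<sqsubseteq> x \<or> x \<sqsubseteq> y" using le_total[of y x] sub[of y t] x by blast
        then show "y \<in> \<Union>(insert U \<F>)" using F u(2) le_lt_trans[OF y t(2)] by blast
      qed
      then show ?thesis unfolding P_def using F U by (intro exI[of _ "insert U \<F>"]) auto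
    qed
    then show "\<exists>y. x \<sqsubset> y \<and> (\<forall>t. x \<sqsubset> t \<and> t \<sqsubset> y \<longrightarrow> P t)" using u(1) by blast
  qed
  moreover have "L \<subseteq> {t. t \<sqsubseteq> b}" using le_b by blast
  ultimately show "\<exists>\<F>. finite \<F> \<and> \<F> \<subseteq> \<U> \<and> L \<subseteq> \<Union>\<F>" unfolding P_def by blast
qed

lemma connected_order_topology: "connected_space (order_topology_on L r)"
proof -
  let ?T = "order_topology_on L r"
  have "L \<subseteq> E" if E: "openin ?T E" "openin ?T F" "L \<subseteq> E \<union> F" "E \<inter> F = {}" "a \<in> E" for E F
  proof
    fix x assume "x \<in> L"
    then show "x \<in> E"
    proof (rule order_continuous_induct)
      fix x assume x: "x \<in> L" and IH: "\<And>t. t \<sqsubset> x \<Longrightarrow> t \<in> E"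
      show "x \<in> E"
      proof (rule ccontr)
        assume "x \<notin> E"
        then have "x \<in> F" "x \<noteq> a" using E x by auto
        then obtain l where l: "l \<sqsubset> x" "\<forall>t. l \<sqsubset> t \<and> t \<sqsubseteq> x \<longrightarrow> t \<in> F"
          using open_left[OF E(2)] by blast
        then show False using between[OF l(1)] IH E(4) by blast
      qed
    next
      fix x assume "x \<in> E" "x \<noteq> b"
      then show "\<exists>y. x \<sqsubset> y \<and> (\<forall>t. x \<sqsubset> t \<and> t \<sqsubset> y \<longrightarrow> t \<in> E)"
        using open_right[OF E(1)] by blast
    qed
  qed
  note * = this
  have emp: "F = {}" if "openin ?T E" "openin ?T F" "L \<subseteq> E \<union> F" "E \<inter> F = {}" "a \<in> E" for E F
  proof -
    have "F \<subseteq> L" using openin_subset[OF that(2)] by simp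
    then show ?thesis using that(4) *[OF that] by blast
  qed
  show ?thesis
    unfolding connected_space_def topspace_order_topology_on
  proof clarify
    fix E F assume 1: "openin ?T E" "openin ?T F" "L \<subseteq> E \<union> F" "E \<inter> F = {}" "E \<noteq> {}" "F \<noteq> {}"
    then have "a \<in> E \<or> a \<in> F" using aL by blast
    then show False using emp[of E F] emp[of F E] 1 by blast
  qed
qed

lemma Hausdorff_order_topology: "Hausdorff_space (order_topology_on L r)"
proof -
  let ?T = "order_topology_on L r"
  have sep: "\<exists>U V. openin ?T U \<and> openin ?T V \<and> x \<in> U \<and> y \<in> V \<and> disjnt U V" if xy: "x \<sqsubset> y" for x y
  proof -
    obtain z where z: "z \<in> L" "x \<sqsubset> z" "z \<sqsubset> y" using between[OF xy] by blast
    have "disjnt {t \<in> L. (t, z) \<in> r - Id} {t \<in> L. (z, t) \<in> r - Id}"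
      using le_antisym by (auto simp: disjnt_def)
    then show ?thesis
      using openin_lower_ray[OF z(1), of r] openin_upper_ray[OF z(1), of r] z sub[OF conjunct1[OF xy]]
      by (intro exI[of _ "{t \<in> L. (t, z) \<in> r - Id}"] exI[of _ "{t \<in> L. (z, t) \<in> r - Id}"]) auto
  qed
  show ?thesis unfolding Hausdorff_space_def topspace_order_topology_on
  proof (intro allI impI)
    fix x y assume "x \<in> L \<and> y \<in> L \<and> x \<noteq> y"
    then have "x \<sqsubset> y \<or> y \<sqsubset> x" using le_total by blast
    then show "\<exists>U V. openin ?T U \<and> openin ?T V \<and> x \<in> U \<and> y \<in> V \<and> disjnt U V"
    proof
      assume "y \<sqsubset> x" 
      then show ?thesis using sep[of y x] disjnt_sym by blast
    qed (rule sep)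
  qed
qed

subsection \<open>Subintervals and reversal\<close>

text \<open>Only the continuity of the inclusion is needed, not that the order topology of the subinterval
  is the subspace topology.\<close>

lemma big_interval_subinterval:
  assumes st: "s \<sqsubset> t"
  defines "I \<equiv> {x. s \<sqsubseteq> x \<and> x \<sqsubseteq> t}"
  shows "big_interval I (r \<inter> I \<times> I)" "minimum_of I (r \<inter> I \<times> I) s" "maximum_of I (r \<inter> I \<times> I) t"
    "continuous_map (order_topology_on I (r \<inter> I \<times> I)) (order_topology_on L r) id"
proof -
  let ?r = "r \<inter> I \<times> I"
  have IL: "I \<subseteq> L" using sub by (auto simp: I_def)
  have sI: "s \<in> I" and tI: "t \<in> I" using st le_refl sub by (auto simp: I_def)
  show mn: "minimum_of I ?r s" and mx: "maximum_of I ?r t"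
    using sI tI by (auto simp: minimum_of_def maximum_of_def I_def)
  have lin': "linear_order_on I ?r"
    unfolding order_on_defs
  proof (intro conjI)
    show "refl_on I ?r" using IL le_refl by (auto simp: refl_on_def)
    show "trans ?r" using le_trans by (intro transI) blast
    show "antisym ?r" using le_antisym by (intro antisymI) blast
    show "total_on I ?r" using IL le_total by (auto simp: total_on_def) 
  qed auto
  have "dense_order_on I ?r"
    unfolding dense_order_on_def
  proof (intro conjI ballI impI)
    show "\<exists>x\<in>I. \<exists>y\<in>I. x \<noteq> y" using sI tI st by blast
    fix x y assume xy: "x \<in> I" "y \<in> I" "(x, y) \<in> ?r - Id"
    then obtain z where z: "z \<in> L" "x \<sqsubset> z" "z \<sqsubset> y" using between[of x y] by blast
    then have "z \<in> I" using xy le_trans unfolding I_def by blast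
    then show "\<exists>z\<in>I. (x, z) \<in> ?r - Id \<and> (z, y) \<in> ?r - Id" using z xy by blast
  qed
  moreover have "order_complete_on I ?r"
    unfolding order_complete_on_def
  proof (intro allI impI, elim conjE exE)
    fix S assume S: "S \<subseteq> I" "S \<noteq> {}"
    have SL: "S \<subseteq> L" using S IL by blast
    have "lub S \<sqsubseteq> t" using lub(3)[OF SL S(2), of t] S tI IL unfolding I_def by blast
    moreover have "s \<sqsubseteq> lub S" using lub(2)[OF SL S(2)] S le_trans unfolding I_def by blast
    ultimately have "lub S \<in> I" by (simp add: I_def)
    then have "supremum_in I ?r S (lub S)"
      using lub[OF SL S(2)] S IL unfolding supremum_in_def upper_bound_in_def by blast
    then show "\<exists>s. supremum_in I ?r S s" by blast
  qed
  ultimately show "big_interval I ?r" using lin' mn mx unfolding big_interval_def by blast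
  let ?T = "order_topology_on I ?r"
  have top: "openin ?T I" by (metis openin_topspace topspace_order_topology_on)
  have up: "openin ?T {y \<in> I. x \<sqsubset> y}" if x: "x \<in> L" for x
  proof (cases "x \<in> I")
    case True
    have "{y \<in> I. x \<sqsubset> y} = {y \<in> I. (x, y) \<in> ?r - Id}" using True by auto
    then show ?thesis using openin_upper_ray[OF True, of ?r] by (simp only:)
  next
    case False
    then have "x \<sqsubset> s \<or> t \<sqsubset> x" using x st sub le_total unfolding I_def by blast
    then show ?thesis
    proof
      assume "x \<sqsubset> s"
      then have "{y \<in> I. x \<sqsubset> y} = I" using lt_le_trans unfolding I_def by blast
      then show ?thesis using top by (simp only:)
    next
      assume "t \<sqsubset> x"
      then have "{y \<in> I. x \<sqsubset> y} = {}" using lt_le_trans le_antisym unfolding I_def by blast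
      then show ?thesis by (simp only: openin_empty)
    qed
  qed
  have lo: "openin ?T {y \<in> I. y \<sqsubset> x}" if x: "x \<in> L" for x
  proof (cases "x \<in> I")
    case True
    have "{y \<in> I. y \<sqsubset> x} = {y \<in> I. (y, x) \<in> ?r - Id}" using True by auto
    then show ?thesis using openin_lower_ray[OF True, of ?r] by (simp only:)
  next
    case False
    then have "x \<sqsubset> s \<or> t \<sqsubset> x" using x st sub le_total unfolding I_def by blast
    then show ?thesis
    proof
      assume "t \<sqsubset> x"
      then have "{y \<in> I. y \<sqsubset> x} = I" using le_lt_trans unfolding I_def by blast
      then show ?thesis using top by (simp only:)
    next
      assume "x \<sqsubset> s"
      then have "{y \<in> I. y \<sqsubset> x} = {}" using le_lt_trans le_antisym unfolding I_def by blast
      then show ?thesis by (simp only: openin_empty)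
    qed
  qed
  show "continuous_map ?T (order_topology_on L r) id"
    unfolding order_topology_on_def[of L r]
  proof (rule continuous_on_generated_topo)
    fix U assume "U \<in> insert L ({{y \<in> L. (x, y) \<in> r - Id} | x. x \<in> L} \<union> {{y \<in> L. (y, x) \<in> r - Id} | x. x \<in> L})"
    then consider "U = L" | x where "x \<in> L" "U = {y \<in> L. (x, y) \<in> r - Id}"
      | x where "x \<in> L" "U = {y \<in> L. (y, x) \<in> r - Id}" by blast
    then show "openin ?T (id -` U \<inter> topspace ?T)"
    proof cases
      case 1
      then have "id -` U \<inter> topspace ?T = I" using IL by auto
      then show ?thesis using top by simp
    next
      case (2 x)
      have "id -` U \<inter> topspace ?T = {y \<in> I. x \<sqsubset> y}" using IL 2 by auto
      then show ?thesis using up[OF 2(1)] by simp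
    next
      case (3 x)
      have "id -` U \<inter> topspace ?T = {y \<in> I. y \<sqsubset> x}" using IL 3 by auto
      then show ?thesis using lo[OF 3(1)] by simp
    qed
  qed (use IL in auto)
qed

lemma big_interval_converse:
  "big_interval L (r\<inverse>)" "minimum_of L (r\<inverse>) b" "maximum_of L (r\<inverse>) a"
  "order_topology_on L (r\<inverse>) = order_topology_on L r"
proof -
  show mn: "minimum_of L (r\<inverse>) b" and mx: "maximum_of L (r\<inverse>) a"
    using mina maxb by (auto simp: minimum_of_def maximum_of_def)
  have "dense_order_on L (r\<inverse>)"
    unfolding dense_order_on_def
  proof (intro conjI ballI impI)
    show "\<exists>x\<in>L. \<exists>y\<in>L. x \<noteq> y" using a_lt_b aL bL by blast
    fix x y assume "x \<in> L" "y \<in> L" "(x, y) \<in> r\<inverse> - Id"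
    then show "\<exists>z\<in>L. (x, z) \<in> r\<inverse> - Id \<and> (z, y) \<in> r\<inverse> - Id" using between[of y x] by blast
  qed
  moreover have "order_complete_on L (r\<inverse>)"
    unfolding order_complete_on_def
  proof (intro allI impI, elim conjE exE)
    fix S assume S: "S \<subseteq> L" "S \<noteq> {}"
    define B where "B = {y \<in> L. \<forall>x\<in>S. y \<sqsubseteq> x}"
    have "a \<in> B" using S aL a_le by (auto simp: B_def)
    then have B: "B \<subseteq> L" "B \<noteq> {}" by (auto simp: B_def)
    have "lub B \<sqsubseteq> x" if "x \<in> S" for x using lub(3)[OF B, of x] that S by (auto simp: B_def)
    moreover have "y \<sqsubseteq> lub B" if "y \<in> B" for y using lub(2)[OF B that] .
    ultimately have "supremum_in L (r\<inverse>) S (lub B)"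
      using lub(1)[OF B] unfolding supremum_in_def upper_bound_in_def by (auto simp: B_def)
    then show "\<exists>s. supremum_in L (r\<inverse>) S s" by blast
  qed
  ultimately show "big_interval L (r\<inverse>)"
    using lin mn mx unfolding big_interval_def by (auto simp: linear_order_on_converse)
  have "{y \<in> L. (x, y) \<in> r\<inverse> - Id} = {y \<in> L. (y, x) \<in> r - Id}"
       "{y \<in> L. (y, x) \<in> r\<inverse> - Id} = {y \<in> L. (x, y) \<in> r - Id}" for x by auto
  then show "order_topology_on L (r\<inverse>) = order_topology_on L r"
    unfolding order_topology_on_def by (simp add: Un_commute)
qed

end

section \<open>Big paths\<close>

subsection \<open>Concatenation\<close>

text \<open>Two big intervals \<open>L1\<close> and \<open>L2\<close> are placed one after the other, with the maximum of \<open>L1\<close>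
  glued to the minimum \<open>c\<close> of \<open>L2\<close>. The glued point is represented by its copy in \<open>L1\<close>, so that
  \<open>c\<close> is deleted from \<open>L2\<close>.\<close>

definition concat_set :: "'l set \<Rightarrow> 'm set \<Rightarrow> 'm \<Rightarrow> ('l + 'm) set" where
  "concat_set L1 L2 c = Inl ` L1 \<union> Inr ` (L2 - {c})"

text \<open>The order of the concatenation: all points of \<open>L1\<close> come before those of \<open>L2\<close>.\<close>

definition concat_order :: "'l set \<Rightarrow> 'l rel \<Rightarrow> 'm set \<Rightarrow> 'm rel \<Rightarrow> 'm \<Rightarrow> ('l + 'm) rel" where
  "concat_order L1 r1 L2 r2 c = {(Inl x, Inl y) | x y. (x, y) \<in> r1} \<union>
     {(Inl x, Inr y) | x y. x \<in> L1 \<and> y \<in> L2 \<and> y \<noteq> c} \<union>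
     {(Inr x, Inr y) | x y. (x, y) \<in> r2 \<and> x \<noteq> c \<and> y \<noteq> c}"

lemma concat_set_simps [simp]:
  "Inl x \<in> concat_set L1 L2 c \<longleftrightarrow> x \<in> L1"
  "Inr y \<in> concat_set L1 L2 c \<longleftrightarrow> y \<in> L2 \<and> y \<noteq> c"
  by (auto simp: concat_set_def)

lemma concat_order_simps [simp]:
  "(Inl x, Inl x') \<in> concat_order L1 r1 L2 r2 c \<longleftrightarrow> (x, x') \<in> r1"
  "(Inl x, Inr y) \<in> concat_order L1 r1 L2 r2 c \<longleftrightarrow> x \<in> L1 \<and> y \<in> L2 \<and> y \<noteq> c"
  "(Inr y, Inl x) \<notin> concat_order L1 r1 L2 r2 c"
  "(Inr y, Inr y') \<in> concat_order L1 r1 L2 r2 c \<longleftrightarrow> (y, y') \<in> r2 \<and> y \<noteq> c \<and> y' \<noteq> c"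
  by (auto simp: concat_order_def)

lemma big_interval_ends_concat:
  assumes "big_interval_ends L1 r1 a1 b1" "big_interval_ends L2 r2 a2 b2"
  shows "big_interval_ends (concat_set L1 L2 a2) (concat_order L1 r1 L2 r2 a2) (Inl a1) (Inr b2)"
proof -
  interpret I: big_interval_ends L1 r1 a1 b1 by fact
  interpret J: big_interval_ends L2 r2 a2 b2 by fact
  let ?L = "concat_set L1 L2 a2" and ?r = "concat_order L1 r1 L2 r2 a2"
  have b2: "b2 \<noteq> a2" using J.a_lt_b by blast
  have mn: "minimum_of ?L ?r (Inl a1)"
    unfolding minimum_of_def
  proof (intro conjI ballI)
    show "(Inl a1, x) \<in> ?r" if "x \<in> ?L" for x
      using that I.aL I.a_le by (cases x) auto
  qed (use I.aL in simp)
  have mx: "maximum_of ?L ?r (Inr b2)"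
    unfolding maximum_of_def
  proof (intro conjI ballI)
    show "(x, Inr b2) \<in> ?r" if "x \<in> ?L" for x
      using that J.bL b2 J.le_b by (cases x) auto
  qed (use J.bL b2 in simp)
  have "linear_order_on ?L ?r"
    unfolding order_on_defs
  proof (intro conjI)
    show "?r \<subseteq> ?L \<times> ?L" using I.sub J.sub by (auto simp: concat_order_def)
    show "refl_on ?L ?r"
    proof (rule refl_onI)
      show "(x, x) \<in> ?r" if "x \<in> ?L" for x
        using that I.le_refl J.le_refl by (cases x) auto
    qed 
    show "trans ?r"
    proof (rule transI)
      fix x y z assume "(x, y) \<in> ?r" "(y, z) \<in> ?r"
      then show "(x, z) \<in> ?r"
        by (cases x; cases y; cases z)
          (auto intro: I.le_trans J.le_trans simp: I.sub[THEN conjunct1] J.sub[THEN conjunct2])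
    qed
    show "antisym ?r"
    proof (rule antisymI)
      fix x y assume "(x, y) \<in> ?r" "(y, x) \<in> ?r"
      then show "x = y" by (cases x; cases y) (auto intro: I.le_antisym J.le_antisym)
    qed
    show "total_on ?L ?r"
    proof (rule total_onI)
      fix x y assume "x \<in> ?L" "y \<in> ?L" "x \<noteq> y"
      then show "(x, y) \<in> ?r \<or> (y, x) \<in> ?r"
        by (cases x; cases y) (auto dest: I.le_total J.le_total)
    qed
  qed
  moreover have "dense_order_on ?L ?r"
    unfolding dense_order_on_def
  proof (intro conjI ballI impI)
    show "\<exists>x\<in>?L. \<exists>y\<in>?L. x \<noteq> y"
      using I.aL J.bL b2 by (intro bexI[of _ "Inl a1"] bexI[of _ "Inr b2"]) auto
    fix x y assume xy: "x \<in> ?L" "y \<in> ?L" "(x, y) \<in> ?r - Id"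
    show "\<exists>z\<in>?L. (x, z) \<in> ?r - Id \<and> (z, y) \<in> ?r - Id"
    proof (cases y)
      case (Inl y1)
      then obtain x1 where x1: "x = Inl x1" using xy by (cases x) auto
      have "(x1, y1) \<in> r1 \<and> x1 \<noteq> y1" using xy x1 Inl by auto
      then obtain z where "z \<in> L1" "(x1, z) \<in> r1 \<and> x1 \<noteq> z" "(z, y1) \<in> r1 \<and> z \<noteq> y1"
        using I.between by blast
      then show ?thesis using Inl x1 by (intro bexI[of _ "Inl z"]) auto
    next
      case y: (Inr y2)
      have y2: "y2 \<in> L2" "(a2, y2) \<in> r2 \<and> a2 \<noteq> y2" using xy y J.a_le by auto
      show ?thesis
      proof (cases x)
        case (Inl x1)
        obtain z where "z \<in> L2" "(a2, z) \<in> r2 \<and> a2 \<noteq> z" "(z, y2) \<in> r2 \<and> z \<noteq> y2"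
          using J.between[OF y2(2)] by blast
        then show ?thesis using Inl xy y y2 by (intro bexI[of _ "Inr z"]) auto
      next
        case (Inr x2)
        have "(x2, y2) \<in> r2 \<and> x2 \<noteq> y2" using xy Inr y by auto
        then obtain z where z: "z \<in> L2" "(x2, z) \<in> r2 \<and> x2 \<noteq> z" "(z, y2) \<in> r2 \<and> z \<noteq> y2"
          using J.between by blast
        then have "z \<noteq> a2" using J.a_le[of x2] J.le_antisym[of x2 z] J.sub by blast
        then show ?thesis using Inr xy y y2 z by (intro bexI[of _ "Inr z"]) auto
      qed
    qed
  qed
  moreover have "order_complete_on ?L ?r"
    unfolding order_complete_on_def
  proof (intro allI impI, elim conjE exE)
    fix S assume S: "S \<subseteq> ?L" "S \<noteq> {}"
    define S1 S2 where "S1 = {x. Inl x \<in> S}" and "S2 = {y. Inr y \<in> S}"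
    have S1: "S1 \<subseteq> L1" and S2: "S2 \<subseteq> L2 - {a2}" using S(1) by (auto simp: S1_def S2_def)
    have Sx: "P x" if "x \<in> S" "\<And>u. u \<in> S1 \<Longrightarrow> P (Inl u)" "\<And>u. u \<in> S2 \<Longrightarrow> P (Inr u)" for P x
      using that by (cases x) (auto simp: S1_def S2_def)
    show "\<exists>s. supremum_in ?L ?r S s"
    proof (cases "S2 = {}")
      case True
      have ne: "S1 \<noteq> {}" using Sx True S(2) by blast
      note l = I.lub[OF S1 ne]
      have "(Inl (I.lub S1), c) \<in> ?r" if c: "upper_bound_in ?L ?r S c" for c
      proof (cases c)
        case (Inl c1)
        then have "c1 \<in> L1" "\<And>u. u \<in> S1 \<Longrightarrow> (u, c1) \<in> r1"
          using c by (auto simp: upper_bound_in_def S1_def)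
        then show ?thesis using l(3)[of c1] Inl by simp
      qed (use c l(1) in \<open>auto simp: upper_bound_in_def\<close>)
      moreover have "(x, Inl (I.lub S1)) \<in> ?r" if "x \<in> S" for x
        by (rule Sx[OF that]) (use True l in auto)
      ultimately show ?thesis using l(1) unfolding supremum_in_def upper_bound_in_def
        by (intro exI[of _ "Inl (I.lub S1)"]) auto
    next
      case False
      have S2L: "S2 \<subseteq> L2" using S2 by blast
      note l = J.lub[OF S2L False]
      have la: "J.lub S2 \<noteq> a2" using False S2 l(2) J.a_le J.le_antisym by (metis Diff_iff S2L ex_in_conv singletonI subset_iff)
      have "(Inr (J.lub S2), c) \<in> ?r" if c: "upper_bound_in ?L ?r S c" for c
      proof (cases c)
        case (Inl c1)
        then show ?thesis using c False by (fastforce simp: upper_bound_in_def S2_def)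
      next
        case (Inr c2)
        then have "c2 \<in> L2" "c2 \<noteq> a2" "\<And>u. u \<in> S2 \<Longrightarrow> (u, c2) \<in> r2"
          using c by (auto simp: upper_bound_in_def S2_def)
        then show ?thesis using l(3)[of c2] la Inr by simp
      qed
      moreover have "(x, Inr (J.lub S2)) \<in> ?r" if "x \<in> S" for x
        by (rule Sx[OF that]) (use l S1 S2 la in auto)
      ultimately show ?thesis using l(1) la unfolding supremum_in_def upper_bound_in_def
        by (intro exI[of _ "Inr (J.lub S2)"]) auto
    qed
  qed
  ultimately show ?thesis
    using mn mx unfolding big_interval_ends_def big_interval_def by blast
qed

lemma continuous_map_concat:
  assumes "big_interval_ends L1 r1 a1 b1" "big_interval_ends L2 r2 a2 b2"
    and f: "continuous_map (order_topology_on L1 r1) X f"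
    and g: "continuous_map (order_topology_on L2 r2) X g" and fg: "f b1 = g a2"
  shows "continuous_map (order_topology_on (concat_set L1 L2 a2) (concat_order L1 r1 L2 r2 a2)) X
    (case_sum f g)"
proof -
  interpret I: big_interval_ends L1 r1 a1 b1 by fact
  interpret J: big_interval_ends L2 r2 a2 b2 by fact
  let ?L = "concat_set L1 L2 a2" and ?r = "concat_order L1 r1 L2 r2 a2"
  interpret C: big_interval_ends ?L ?r "Inl a1" "Inr b2"
    by (rule big_interval_ends_concat) fact+
  show ?thesis unfolding continuous_map_def topspace_order_topology_on
  proof (intro conjI allI impI)
    show "case_sum f g \<in> ?L \<rightarrow> topspace X"
      using f g by (auto simp: continuous_map_def concat_set_def)
    fix U assume "openin X U"
    then have oI: "openin (order_topology_on L1 r1) {t \<in> L1. f t \<in> U}"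
      and oJ: "openin (order_topology_on L2 r2) {t \<in> L2. g t \<in> U}"
      using f g by (auto simp: continuous_map_def)
    show "openin (order_topology_on ?L ?r) {t \<in> ?L. case_sum f g t \<in> U}"
    proof (rule C.order_openI)
      fix p assume p: "p \<in> {t \<in> ?L. case_sum f g t \<in> U}"
      show "\<exists>l. ((l, p) \<in> ?r \<and> l \<noteq> p) \<and>
          (\<forall>t. ((l, t) \<in> ?r \<and> l \<noteq> t) \<and> (t, p) \<in> ?r \<and> t \<noteq> p \<longrightarrow> t \<in> {t \<in> ?L. case_sum f g t \<in> U})"
        if pa: "p \<noteq> Inl a1"
      proof (cases p)
        case (Inl p1)
        then obtain l where l: "(l, p1) \<in> r1 \<and> l \<noteq> p1"
          "\<forall>t. ((l, t) \<in> r1 \<and> l \<noteq> t) \<and> (t, p1) \<in> r1 \<longrightarrow> t \<in> {t \<in> L1. f t \<in> U}"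
          using I.open_left[OF oI, of p1] p pa by auto
        have "t \<in> {t \<in> ?L. case_sum f g t \<in> U}"
          if "((Inl l, t) \<in> ?r \<and> Inl l \<noteq> t) \<and> (t, p) \<in> ?r \<and> t \<noteq> p" for t
          using that l(2) Inl by (cases t) auto
        then show ?thesis using l(1) Inl by (intro exI[of _ "Inl l"]) auto
      next
        case (Inr p2)
        then obtain l where l: "(l, p2) \<in> r2 \<and> l \<noteq> p2"
          "\<forall>t. ((l, t) \<in> r2 \<and> l \<noteq> t) \<and> (t, p2) \<in> r2 \<longrightarrow> t \<in> {t \<in> L2. g t \<in> U}"
          using J.open_left[OF oJ, of p2] p by auto
        \<comment> \<open>If \<open>l\<close> is the deleted minimum of the second interval, the junction replaces it.\<close>
        define l' where "l' = (if l = a2 then Inl b1 else Inr l)"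
        have "t \<in> {t \<in> ?L. case_sum f g t \<in> U}"
          if t: "((l', t) \<in> ?r \<and> l' \<noteq> t) \<and> (t, p) \<in> ?r \<and> t \<noteq> p" for t
        proof (cases t)
          case tl: (Inl t1)
          then have "(b1, t1) \<in> r1 \<and> b1 \<noteq> t1" using t by (auto simp: l'_def split: if_splits)
          then show ?thesis using I.le_b[of t1] I.le_antisym I.sub by blast
        next
          case tr: (Inr t2)
          then have "((l, t2) \<in> r2 \<and> l \<noteq> t2) \<and> (t2, p2) \<in> r2"
            using t Inr J.a_le by (auto simp: l'_def split: if_splits)
          then show ?thesis using l(2) tr t Inr by auto
        qed
        moreover have "(l', p) \<in> ?r \<and> l' \<noteq> p"
          using l(1) Inr p I.bL by (auto simp: l'_def)
        ultimately show ?thesis by blast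
      qed
      show "\<exists>u. ((p, u) \<in> ?r \<and> p \<noteq> u) \<and>
          (\<forall>t. ((p, t) \<in> ?r \<and> p \<noteq> t) \<and> (t, u) \<in> ?r \<and> t \<noteq> u \<longrightarrow> t \<in> {t \<in> ?L. case_sum f g t \<in> U})"
        if pb: "p \<noteq> Inr b2"
      proof (cases "\<exists>p1. p = Inl p1 \<and> p1 \<noteq> b1")
        case True
        then obtain p1 where p1: "p = Inl p1" "p1 \<noteq> b1" by blast
        then obtain u where u: "(p1, u) \<in> r1 \<and> p1 \<noteq> u"
          "\<forall>t. (p1, t) \<in> r1 \<and> (t, u) \<in> r1 \<and> t \<noteq> u \<longrightarrow> t \<in> {t \<in> L1. f t \<in> U}"
          using I.open_right[OF oI, of p1] p by auto
        have "t \<in> {t \<in> ?L. case_sum f g t \<in> U}"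
          if "((p, t) \<in> ?r \<and> p \<noteq> t) \<and> (t, Inl u) \<in> ?r \<and> t \<noteq> Inl u" for t
          using that u(2) p1 by (cases t) auto
        then show ?thesis using u(1) p1 by (intro exI[of _ "Inl u"]) auto
      next
        case False
        \<comment> \<open>A point \<open>p\<close> from the junction on is seen as a point \<open>p2\<close> of the second interval.\<close>
        define p2 where "p2 = (case p of Inl _ \<Rightarrow> a2 | Inr y \<Rightarrow> y)"
        have "p2 \<in> {t \<in> L2. g t \<in> U}" "p2 \<noteq> b2"
          using False p pb J.aL J.a_lt_b fg by (auto simp: p2_def split: sum.splits)
        then obtain u where u: "(p2, u) \<in> r2 \<and> p2 \<noteq> u"
          "\<forall>t. (p2, t) \<in> r2 \<and> (t, u) \<in> r2 \<and> t \<noteq> u \<longrightarrow> t \<in> {t \<in> L2. g t \<in> U}"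
          using J.open_right[OF oJ, of p2] by auto
        have uL: "u \<in> L2" "u \<noteq> a2" using u J.sub J.a_le J.le_antisym by blast+
        have "t \<in> {t \<in> ?L. case_sum f g t \<in> U}"
          if t: "((p, t) \<in> ?r \<and> p \<noteq> t) \<and> (t, Inr u) \<in> ?r \<and> t \<noteq> Inr u" for t
        proof (cases t)
          case (Inl t1)
          then have "p = Inl b1" using t False by (cases p) auto
          then have "(b1, t1) \<in> r1 \<and> b1 \<noteq> t1" using t Inl by auto
          then show ?thesis using I.le_b[of t1] I.le_antisym I.sub by blast
        next
          case (Inr t2)
          have "(p2, t2) \<in> r2"
            using t Inr J.a_le by (auto simp: p2_def split: sum.splits)
          then show ?thesis using u(2) t Inr by auto
        qed
        moreover have "(p, Inr u) \<in> ?r \<and> p \<noteq> Inr u"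
          using u(1) uL p by (auto simp: p2_def split: sum.splits)
        ultimately show ?thesis by blast
      qed
    qed auto
  qed
qed

subsection \<open>Joining points by big paths\<close>

lemma (in big_interval_ends) subpath_joined:
  assumes cont: "continuous_map (order_topology_on L r) X \<gamma>" and st: "s \<sqsubset> t"
    and S: "\<And>u. s \<sqsubseteq> u \<Longrightarrow> u \<sqsubseteq> t \<Longrightarrow> \<gamma> u \<in> S"
  shows "big_path_joined (subtopology X S) (\<gamma> s) (\<gamma> t)"
proof -
  define I where "I = {x. s \<sqsubseteq> x \<and> x \<sqsubseteq> t}"
  note I = big_interval_subinterval[OF st, folded I_def]
  have "continuous_map (order_topology_on I (r \<inter> I \<times> I)) X (\<gamma> \<circ> id)"
    by (rule continuous_map_compose[OF I(4) cont])
  then have "continuous_map (order_topology_on I (r \<inter> I \<times> I)) (subtopology X S) \<gamma>"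
    using S by (auto simp: continuous_map_in_subtopology I_def)
  then have "big_path (subtopology X S) I (r \<inter> I \<times> I) \<gamma> (\<gamma> s) (\<gamma> t)"
    unfolding big_path_def using I(1-3) by blast
  then show ?thesis by (rule big_path_imp_joined)
qed

lemma big_path_endsE:
  assumes "big_path X L r \<gamma> x y"
  obtains a b where "big_interval_ends L r a b" "continuous_map (order_topology_on L r) X \<gamma>"
    "\<gamma> a = x" "\<gamma> b = y"
  using assms unfolding big_path_def big_interval_ends_def by blast

lemma big_pathI:
  assumes "big_interval_ends L r a b" "continuous_map (order_topology_on L r) X \<gamma>"
  shows "big_path X L r \<gamma> (\<gamma> a) (\<gamma> b)"
  using assms unfolding big_path_def big_interval_ends_def by blast

lemma big_path_image:
  assumes "big_path X L r \<gamma> x y"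
  shows "compactin X (\<gamma> ` L)" "connectedin X (\<gamma> ` L)" "x \<in> \<gamma> ` L" "y \<in> \<gamma> ` L"
proof -
  obtain a b where I: "big_interval_ends L r a b" and c: "continuous_map (order_topology_on L r) X \<gamma>"
    and xy: "\<gamma> a = x" "\<gamma> b = y"
    using assms by (rule big_path_endsE)
  interpret big_interval_ends L r a b by fact
  show "compactin X (\<gamma> ` L)"
    using image_compactin[OF _ c, of L] compact_order_topology by (simp add: compact_space_def)
  show "connectedin X (\<gamma> ` L)"
    using connectedin_continuous_map_image[OF c, of L] connected_order_topology
    by (metis connectedin_topspace topspace_order_topology_on)
  show "x \<in> \<gamma> ` L" "y \<in> \<gamma> ` L" using xy aL bL by blast+
qed

lemma joined_in_topspace:
  assumes "big_path_joined X x y"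
  shows "x \<in> topspace X" "y \<in> topspace X"
proof -
  obtain L :: "'a big set" and r \<gamma> where p: "big_path X L r \<gamma> x y"
    using assms unfolding big_path_joined_def by blast
  show "x \<in> topspace X" "y \<in> topspace X"
    using big_path_image(3,4)[OF p] compactin_subset_topspace[OF big_path_image(1)[OF p]] by blast+
qed

text \<open>The real unit interval shows that constant big paths exist.\<close>

lemma big_interval_unit:
  "big_interval_ends {0..1::real} {(x, y). 0 \<le> x \<and> x \<le> y \<and> y \<le> 1} 0 1"
proof -
  let ?L = "{0..1::real}" and ?r = "{(x, y::real). 0 \<le> x \<and> x \<le> y \<and> y \<le> 1}"
  have "linear_order_on ?L ?r"
    by (auto simp: order_on_defs refl_on_def trans_def antisym_def total_on_def)
  moreover have "dense_order_on ?L ?r"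
    unfolding dense_order_on_def
  proof (intro conjI ballI impI)
    show "\<exists>x\<in>?L. \<exists>y\<in>?L. x \<noteq> y" by (intro bexI[of _ 0] bexI[of _ 1]) auto
    show "\<exists>z\<in>?L. (x, z) \<in> ?r - Id \<and> (z, y) \<in> ?r - Id" if "(x, y) \<in> ?r - Id" for x y
      using that by (intro bexI[of _ "(x + y) / 2"]) auto
  qed
  moreover have "order_complete_on ?L ?r"
    unfolding order_complete_on_def
  proof (intro allI impI, elim conjE exE)
    fix S assume S: "S \<subseteq> ?L" "S \<noteq> {}"
    have bdd: "bdd_above S" using S by (meson bdd_above_Icc bdd_above_mono)
    have le: "Sup S \<le> c" if "\<forall>x\<in>S. x \<le> c" for c using S(2) that by (simp add: cSup_least)
    have ge: "x \<le> Sup S" if "x \<in> S" for x using that bdd by (rule cSup_upper)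
    obtain x where x: "x \<in> S" using S by blast
    have "0 \<le> Sup S" using ge[OF x] x S by force
    moreover have "Sup S \<le> 1" using S by (intro le) auto
    moreover have "0 \<le> x" if "x \<in> S" for x using that S by auto
    ultimately have "supremum_in ?L ?r S (Sup S)"
      using ge le by (auto simp: supremum_in_def upper_bound_in_def)
    then show "\<exists>s. supremum_in ?L ?r S s" by blast
  qed
  moreover have mn: "minimum_of ?L ?r 0" and mx: "maximum_of ?L ?r 1"
    by (auto simp: minimum_of_def maximum_of_def)
  ultimately show ?thesis unfolding big_interval_ends_def big_interval_def by blast
qed

lemma joined_refl: "x \<in> topspace X \<Longrightarrow> big_path_joined X x x"
  using big_path_imp_joined[OF big_pathI[OF big_interval_unit, of X "\<lambda>_. x"]] by simp

lemma joined_sym: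
  assumes "big_path_joined X x y" shows "big_path_joined X y x"
proof -
  obtain L :: "'a big set" and r \<gamma> where "big_path X L r \<gamma> x y"
    using assms unfolding big_path_joined_def by blast
  then obtain a b where I: "big_interval_ends L r a b" and c: "continuous_map (order_topology_on L r) X \<gamma>"
    and xy: "\<gamma> a = x" "\<gamma> b = y" by (rule big_path_endsE)
  interpret big_interval_ends L r a b by fact
  have "big_interval_ends L (r\<inverse>) b a"
    using big_interval_converse by (simp add: big_interval_ends_def)
  moreover have "continuous_map (order_topology_on L (r\<inverse>)) X \<gamma>"
    using c big_interval_converse(4) by simp
  ultimately have "big_path X L (r\<inverse>) \<gamma> (\<gamma> b) (\<gamma> a)" by (rule big_pathI)
  from big_path_imp_joined[OF this] show ?thesis using xy by simp
qed

lemma joined_trans: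
  assumes "big_path_joined X x y" "big_path_joined X y z" shows "big_path_joined X x z"
proof -
  obtain L :: "'a big set" and r \<gamma> where "big_path X L r \<gamma> x y"
    using assms unfolding big_path_joined_def by blast
  then obtain a b where I: "big_interval_ends L r a b"
    "continuous_map (order_topology_on L r) X \<gamma>" "\<gamma> a = x" "\<gamma> b = y" by (rule big_path_endsE)
  obtain L' :: "'a big set" and r' \<gamma>' where "big_path X L' r' \<gamma>' y z"
    using assms unfolding big_path_joined_def by blast
  then obtain a' b' where J: "big_interval_ends L' r' a' b'"
    "continuous_map (order_topology_on L' r') X \<gamma>'" "\<gamma>' a' = y" "\<gamma>' b' = z" by (rule big_path_endsE)
  have "\<gamma> b = \<gamma>' a'" using I J by simp
  from big_path_imp_joined[OF big_pathI[OF big_interval_ends_concat[OF I(1) J(1)]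
      continuous_map_concat[OF I(1) J(1) I(2) J(2) this]]]
  show ?thesis using I J by simp
qed

lemma joined_mono:
  assumes "big_path_joined (subtopology X S) x y" "S \<subseteq> T"
  shows "big_path_joined (subtopology X T) x y"
proof -
  obtain L :: "'a big set" and r \<gamma> where p: "big_path (subtopology X S) L r \<gamma> x y"
    using assms unfolding big_path_joined_def by blast
  then have "continuous_map (order_topology_on L r) (subtopology X T) \<gamma>"
    using assms(2) by (auto simp: big_path_def continuous_map_in_subtopology)
  then have "big_path (subtopology X T) L r \<gamma> x y"
    using p unfolding big_path_def by blast
  then show ?thesis by (rule big_path_imp_joined)
qed

lemma joined_in: "big_path_joined (subtopology X S) x y \<Longrightarrow> x \<in> topspace X \<inter> S \<and> y \<in> topspace X \<inter> S"
  using joined_in_topspace by fastforce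

text \<open>Points that are joined in \<open>S\<close> are joined already in a compact connected subset of \<open>S\<close>, the image
  of a big path.\<close>

lemma joined_image:
  assumes "big_path_joined (subtopology X S) x y"
  obtains K where "compactin X K" "connectedin X K" "x \<in> K" "y \<in> K" "K \<subseteq> S"
    "big_path_joined (subtopology X K) x y"
proof -
  obtain L :: "'a big set" and r \<gamma> where p: "big_path (subtopology X S) L r \<gamma> x y"
    using assms unfolding big_path_joined_def by blast
  have "continuous_map (order_topology_on L r) (subtopology X (\<gamma> ` L)) \<gamma>"
    using p by (auto simp: big_path_def continuous_map_in_subtopology)
  then have "big_path (subtopology X (\<gamma> ` L)) L r \<gamma> x y"
    using p unfolding big_path_def by blast
  then show ?thesis
    using big_path_image[OF p] big_path_imp_joined by (intro that[of "\<gamma> ` L"])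
      (auto simp: compactin_subtopology connectedin_subtopology)
qed

lemma big_path_connected_imp_connected:
  assumes "big_path_connected_space X" shows "connected_space X"
  unfolding connected_space_subconnected
proof (intro ballI)
  fix x y assume "x \<in> topspace X" "y \<in> topspace X"
  then have "big_path_joined (subtopology X UNIV) x y"
    using assms by (simp add: big_path_connected_space_def)
  then show "\<exists>S. connectedin X S \<and> x \<in> S \<and> y \<in> S"
    by (rule joined_image) blast
qed

section \<open>Separations of 2-flimsy spaces\<close>

text \<open>If the complement of \<open>x\<close> in a connected set is separated into two parts, then each part becomes
  connected when \<open>x\<close> is put back: a piece of \<open>A\<close> cut off from \<open>x\<close> would be cut off from \<open>B\<close> too.\<close>

lemma connectedin_insert_part:
  assumes C: "connectedin X (insert x (A \<union> B))" and AB: "separatedin X A B"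
  shows "connectedin X (insert x A)"
  unfolding connectedin_eq_not_separated
proof (intro conjI notI)
  show "insert x A \<subseteq> topspace X" using C connectedin_subset_topspace by blast
  assume "\<exists>C1 C2. C1 \<union> C2 = insert x A \<and> C1 \<noteq> {} \<and> C2 \<noteq> {} \<and> separatedin X C1 C2"
  then obtain C1 C2 where 1: "C1 \<union> C2 = insert x A" "C1 \<noteq> {}" "C2 \<noteq> {}" "separatedin X C1 C2"
    by blast
  have no: False
    if D: "D1 \<union> D2 = insert x A" "D2 \<noteq> {}" "separatedin X D1 D2" "x \<in> D1" for D1 D2
  proof -
    have "D2 \<subseteq> A" using D separatedin_imp_disjoint[OF D(3)] by (auto simp: disjnt_def)
    then have "separatedin X (D1 \<union> B) D2"
      using D(3) separatedin_mono[OF AB, of D2 B] by (simp add: separatedin_sym)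
    then show False using C D unfolding connectedin_eq_not_separated
      by (metis Un_assoc Un_commute Un_empty empty_iff insert_is_Un)
  qed
  show False
  proof (cases "x \<in> C1")
    case True
    then show ?thesis using no[of C1 C2] 1 by blast
  next
    case False
    then show ?thesis using no[of C2 C1] 1 separatedin_sym[of X C1 C2] by blast
  qed
qed

text \<open>\<open>U\<close> and \<open>V\<close> form a separation of the complement of the points \<open>x\<close> and \<open>y\<close>.\<close>

definition splits :: "'a topology \<Rightarrow> 'a \<Rightarrow> 'a \<Rightarrow> 'a set \<Rightarrow> 'a set \<Rightarrow> bool" where
  "splits X x y U V \<longleftrightarrow> U \<noteq> {} \<and> V \<noteq> {} \<and> separatedin X U V \<and> U \<union> V = topspace X - {x, y}"

lemma splits_swap: "splits X x y U V \<Longrightarrow> splits X y x U V" "splits X x y U V \<Longrightarrow> splits X x y V U"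
  by (auto simp: splits_def separatedin_sym insert_commute)

lemma splits_disjoint: "splits X x y U V \<Longrightarrow> U \<inter> V = {}"
  using separatedin_imp_disjoint by (auto simp: splits_def disjnt_def)

lemma two_flimsy_splits:
  assumes "two_flimsy X" "x \<in> topspace X" "y \<in> topspace X" "x \<noteq> y"
  obtains U V where "splits X x y U V"
proof -
  have "\<not> connected_space (subtopology X (topspace X - {x, y}))"
    using assms by (auto simp: two_flimsy_def)
  then have "\<not> connectedin X (topspace X - {x, y})" by (simp add: connectedin_def)
  then show ?thesis unfolding connectedin_eq_not_separated splits_def using that
    by (metis Diff_subset splits_def)
qed

lemma two_flimsy_connectedin:
  assumes "two_flimsy X"
  shows "connectedin X (topspace X - {x})"
proof -
  have "finite (topspace X \<inter> {x}) \<and> card (topspace X \<inter> {x}) < 2"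
    using card_mono[of "{x}" "topspace X \<inter> {x}"] by simp
  then have "connected_space (subtopology X (topspace X - topspace X \<inter> {x}))"
    using assms unfolding two_flimsy_def by blast
  then show ?thesis by (simp add: connectedin_def Diff_Int)
qed

lemma splits_connectedin:
  assumes X: "two_flimsy X" and xy: "x \<in> topspace X" "x \<noteq> y" and s: "splits X x y U V"
  shows "connectedin X (insert x U)"
proof (rule connectedin_insert_part)
  have "insert x (U \<union> V) = topspace X - {y}" using s xy by (auto simp: splits_def)
  then show "connectedin X (insert x (U \<union> V))" using two_flimsy_connectedin[OF X, of y] by simp
  show "separatedin X U V" using s by (simp add: splits_def)
qed

text \<open>The crossing property: if \<open>u\<close> and \<open>v\<close> lie on different sides of \<open>x\<close> and \<open>y\<close>, then
  \<open>x\<close> and \<open>y\<close> lie on different sides of \<open>u\<close> and \<open>v\<close>.\<close>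

lemma splits_crossing:
  assumes X: "two_flimsy X" and s: "splits X x y U V" and uv: "u \<in> U" "v \<in> V"
    and t: "splits X u v E F" and xE: "x \<in> E" and y: "y \<in> topspace X"
  shows "y \<in> F"
proof (rule ccontr)
  assume "y \<notin> F"
  have top: "u \<in> topspace X" "v \<in> topspace X" "u \<notin> {x, y}" "v \<notin> {x, y}" "u \<noteq> v"
    using s uv splits_disjoint[OF s] by (auto simp: splits_def)
  have F: "F \<noteq> {}" "F \<subseteq> topspace X" "F \<inter> {x, y} = {}"
    using t \<open>y \<notin> F\<close> xE splits_disjoint[OF t] by (auto simp: splits_def)
  \<comment> \<open>If \<open>x\<close> and \<open>y\<close> were both in \<open>E\<close>, then \<open>F\<close> with \<open>u\<close> or \<open>v\<close> would be connected and avoid \<open>x\<close> and \<open>y\<close>,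
    hence \<open>F\<close> would lie on both sides of \<open>x\<close> and \<open>y\<close>.\<close>
  have "connectedin X (insert u F)" "connectedin X (insert v F)"
    using splits_connectedin[OF X] top splits_swap t by metis+
  moreover have "insert u F \<subseteq> U \<union> V" "insert v F \<subseteq> U \<union> V"
    using F uv s by (auto simp: splits_def)
  moreover have sep: "separatedin X U V" using s by (simp add: splits_def)
  ultimately have "(insert u F \<subseteq> U \<or> insert u F \<subseteq> V) \<and> (insert v F \<subseteq> U \<or> insert v F \<subseteq> V)"
    using connectedin_subset_separated_union by metis
  then have "F \<subseteq> U \<inter> V" using uv splits_disjoint[OF s] by blast
  then show False using F splits_disjoint[OF s] by blast
qed

lemma splits_crossingE:
  assumes X: "two_flimsy X" and s: "splits X x y U V" and uv: "u \<in> U" "v \<in> V"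
    and xy: "x \<in> topspace X" "y \<in> topspace X"
  obtains E F where "splits X u v E F" "x \<in> E" "y \<in> F"
proof -
  have top: "u \<in> topspace X" "v \<in> topspace X" "x \<notin> {u, v}" "u \<noteq> v"
    using s uv splits_disjoint[OF s] by (auto simp: splits_def)
  obtain E F where t: "splits X u v E F" using two_flimsy_splits[OF X top(1,2,4)] by blast
  then consider "x \<in> E" | "x \<in> F" using top xy unfolding splits_def by blast
  then show ?thesis
  proof cases
    case 1
    then show ?thesis using that t splits_crossing[OF X s uv t] xy by blast
  next
    case 2
    then show ?thesis using that splits_swap(2)[OF t] splits_crossing[OF X s uv splits_swap(2)[OF t]] xy
      by blast
  qed
qed

lemma two_flimsy_separates:
  assumes X: "two_flimsy X" and xy: "x \<in> topspace X" "y \<in> topspace X" "x \<noteq> y"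
  obtains u v E F where "splits X u v E F" "x \<in> E" "y \<in> F" 
proof -
  obtain U V where s: "splits X x y U V" using two_flimsy_splits[OF X xy] by blast
  then obtain u v where "u \<in> U" "v \<in> V" by (auto simp: splits_def)
  then show ?thesis using splits_crossingE[OF X s _ _ xy(1,2)] that by metis
qed

text \<open>No separation axiom is part of the definition of a 2-flimsy space. The crossing property yields
  first that points are closed, then that the sides of two points are open, and so the Hausdorff
  property.\<close>

lemma two_flimsy_t1: assumes X: "two_flimsy X" shows "t1_space X"
  unfolding t1_space_def
proof (intro ballI impI)
  fix x y assume xy: "x \<in> topspace X" "y \<in> topspace X" "x \<noteq> y"
  obtain u v E F where t: "splits X u v E F" "x \<in> E" "y \<in> F"
    using two_flimsy_separates[OF X xy] by blast
  then have "x \<notin> X closure_of F" "F \<subseteq> X closure_of F"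
    by (auto simp: splits_def separatedin_def intro!: closure_of_subset)
  then show "\<exists>U. openin X U \<and> x \<in> U \<and> y \<notin> U"
    using xy t by (intro exI[of _ "topspace X - X closure_of F"]) (auto intro: openin_diff)
qed

lemma splits_openin:
  assumes X: "two_flimsy X" and s: "splits X x y U V"
  shows "openin X U" "openin X V"
proof -
  have "closedin X (topspace X \<inter> {x, y})"
    using two_flimsy_t1[OF X] by (simp add: t1_space_closedin_finite)
  then have "openin X (topspace X - topspace X \<inter> {x, y})" by blast
  moreover have "topspace X - topspace X \<inter> {x, y} = U \<union> V" using s by (auto simp: splits_def)
  ultimately have "openin X (U \<union> V)" by simp
  moreover have "openin (subtopology X (U \<union> V)) U" "openin (subtopology X (U \<union> V)) V"
    using s unfolding splits_def separation_openin_Un_gen by blast+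
  ultimately show "openin X U" "openin X V" by (simp_all add: openin_open_subtopology)
qed

lemma two_flimsy_Hausdorff: assumes X: "two_flimsy X" shows "Hausdorff_space X"
  unfolding Hausdorff_space_def
proof (intro allI impI)
  fix x y assume xy: "x \<in> topspace X \<and> y \<in> topspace X \<and> x \<noteq> y"
  then obtain u v E F where t: "splits X u v E F" "x \<in> E" "y \<in> F"
    using two_flimsy_separates[OF X] by metis
  then show "\<exists>U V. openin X U \<and> openin X V \<and> x \<in> U \<and> y \<in> V \<and> disjnt U V"
    using splits_openin[OF X t(1)] splits_disjoint[OF t(1)] by (auto simp: disjnt_def)
qed

section \<open>A characterization of big intervals\<close>

text \<open>A connected space in which every point other than \<open>p\<close> and \<open>q\<close> separates \<open>p\<close> from \<open>q\<close>. The open sets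
  \<open>D x\<close> and \<open>R x\<close> are the sides of \<open>x\<close> that contain \<open>p\<close> and \<open>q\<close>. The ends are included in the notation:
  \<open>D p\<close> and \<open>R q\<close> are empty, so that \<open>R p\<close> and \<open>D q\<close> are the complements of the points \<open>p\<close> and \<open>q\<close>.\<close>

locale cut_space =
  fixes T :: "'a topology" and p q :: 'a and D R :: "'a \<Rightarrow> 'a set"
  assumes conn: "connected_space T" and pT: "p \<in> topspace T" and qT: "q \<in> topspace T" and pq: "p \<noteq> q"
    and D_open: "x \<in> topspace T \<Longrightarrow> openin T (D x)" and R_open: "x \<in> topspace T \<Longrightarrow> openin T (R x)"
    and DR: "x \<in> topspace T \<Longrightarrow> D x \<union> R x = topspace T - {x}" "x \<in> topspace T \<Longrightarrow> D x \<inter> R x = {}"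
    and pD: "x \<in> topspace T \<Longrightarrow> x \<noteq> p \<Longrightarrow> p \<in> D x" and qR: "x \<in> topspace T \<Longrightarrow> x \<noteq> q \<Longrightarrow> q \<in> R x"
    and Dp: "D p = {}" and Rq: "R q = {}"
begin

text \<open>The point \<open>x\<close> lies before \<open>y\<close> if it is on the side of \<open>y\<close> that contains \<open>p\<close>.\<close>

definition cut_order :: "'a rel" where
  "cut_order = {(x, y). x \<in> topspace T \<and> y \<in> topspace T \<and> (x = y \<or> x \<in> D y)}"

lemma sides_separated: "x \<in> topspace T \<Longrightarrow> separatedin T (D x) (R x)"
  using D_open R_open DR(2) by (simp add: separatedin_open_sets disjnt_def)

lemma connectedin_D: "x \<in> topspace T \<Longrightarrow> connectedin T (insert x (D x))"
  and connectedin_R: "x \<in> topspace T \<Longrightarrow> connectedin T (insert x (R x))"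
proof -
  assume x: "x \<in> topspace T"
  have *: "connectedin T (insert x (D x \<union> R x))"
    using conn x DR(1)[OF x] by (simp add: insert_absorb connectedin_topspace)
  show "connectedin T (insert x (D x))"
    by (rule connectedin_insert_part[OF * sides_separated[OF x]])
  show "connectedin T (insert x (R x))"
    using connectedin_insert_part[of T x "R x" "D x"] * sides_separated[OF x]
    by (simp add: Un_commute separatedin_sym)
qed

text \<open>If \<open>y\<close> is beyond \<open>x\<close>, the connected set of \<open>x\<close> and \<open>D x\<close> contains \<open>p\<close> and misses \<open>y\<close>, hence it lies
  in \<open>D y\<close>.\<close>

lemma D_nested:
  assumes x: "x \<in> topspace T" and y: "y \<in> R x" shows "insert x (D x) \<subseteq> D y"
proof -
  have yT: "y \<in> topspace T" and yx: "y \<noteq> x" using DR(1)[OF x] y by blast+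
  have "y \<notin> insert x (D x)" using y yx DR(2)[OF x] by blast
  then have "insert x (D x) \<subseteq> D y \<union> R y"
    using DR(1)[OF yT] DR(1)[OF x] x by blast
  then have "insert x (D x) \<subseteq> D y \<or> insert x (D x) \<subseteq> R y"
    using connectedin_subset_separated_union[OF connectedin_D[OF x] sides_separated[OF yT]] by blast
  moreover have "y \<noteq> p" using \<open>y \<notin> insert x (D x)\<close> pD[OF x] by blast
  then have "p \<in> D y" "p \<in> insert x (D x)" using pD x yT by blast+
  ultimately show ?thesis using DR(2)[OF yT] by blast
qed

lemma R_nested:
  assumes x: "x \<in> topspace T" and y: "y \<in> D x" shows "insert x (R x) \<subseteq> R y"
proof -
  have yT: "y \<in> topspace T" and yx: "y \<noteq> x" using DR(1)[OF x] y by blast+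
  have "y \<notin> insert x (R x)" using y yx DR(2)[OF x] by blast
  then have "insert x (R x) \<subseteq> D y \<union> R y"
    using DR(1)[OF yT] DR(1)[OF x] x by blast
  then have "insert x (R x) \<subseteq> D y \<or> insert x (R x) \<subseteq> R y"
    using connectedin_subset_separated_union[OF connectedin_R[OF x] sides_separated[OF yT]] by blast
  moreover have "y \<noteq> q" using \<open>y \<notin> insert x (R x)\<close> qR[OF x] by blast
  then have "q \<in> R y" "q \<in> insert x (R x)" using qR x yT by blast+
  ultimately show ?thesis using DR(2)[OF yT] by blast
qed

lemma D_iff_R: "x \<in> topspace T \<Longrightarrow> y \<in> topspace T \<Longrightarrow> x \<in> D y \<longleftrightarrow> y \<in> R x"
  using D_nested[of x y] R_nested[of y x] by blast

lemma D_trans: "y \<in> topspace T \<Longrightarrow> z \<in> topspace T \<Longrightarrow> x \<in> D y \<Longrightarrow> y \<in> D z \<Longrightarrow> x \<in> D z"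
  using D_nested[of y z] D_iff_R[of y z] by blast

lemma D_irrefl: "x \<in> topspace T \<Longrightarrow> x \<notin> D x"
  using DR(1) by blast

lemma D_total: "x \<in> topspace T \<Longrightarrow> y \<in> topspace T \<Longrightarrow> x = y \<or> x \<in> D y \<or> y \<in> D x"
  using DR(1)[of y] D_iff_R[of y x] by blast

lemma D_sub: "x \<in> topspace T \<Longrightarrow> D x \<subseteq> topspace T"
  using DR(1) by blast

lemma rays:
  assumes "x \<in> topspace T"
  shows "{y \<in> topspace T. (y, x) \<in> cut_order - Id} = D x"
    "{y \<in> topspace T. (x, y) \<in> cut_order - Id} = R x"
proof -
  show "{y \<in> topspace T. (y, x) \<in> cut_order - Id} = D x"
    using assms D_irrefl D_sub by (auto simp: cut_order_def)
  have "y \<in> topspace T \<and> x \<in> D y \<and> x \<noteq> y \<longleftrightarrow> y \<in> R x" for y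
    using D_iff_R[OF assms, of y] DR(1)[OF assms] by blast
  then show "{y \<in> topspace T. (x, y) \<in> cut_order - Id} = R x"
    using assms by (auto simp: cut_order_def)
qed

lemma cut_big_interval: "big_interval_ends (topspace T) cut_order p q"
proof -
  let ?K = "topspace T"
  have noclopen: False if "openin T A" "openin T B" "A \<noteq> {}" "B \<noteq> {}" "A \<inter> B = {}" "?K \<subseteq> A \<union> B" for A B
    using conn that unfolding connected_space_def by blast
  have "linear_order_on ?K cut_order"
    unfolding order_on_defs
  proof (intro conjI)
    show "refl_on ?K cut_order" by (auto simp: refl_on_def cut_order_def)
    show "trans cut_order"
    proof (rule transI)
      fix x y z assume "(x, y) \<in> cut_order" "(y, z) \<in> cut_order"
      then show "(x, z) \<in> cut_order" using D_trans[of y z x] by (auto simp: cut_order_def)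
    qed
    show "antisym cut_order"
    proof (rule antisymI)
      fix x y assume "(x, y) \<in> cut_order" "(y, x) \<in> cut_order"
      then show "x = y" using D_trans[of y x x] D_irrefl[of x] by (auto simp: cut_order_def)
    qed
    show "total_on ?K cut_order" using D_total by (auto simp: total_on_def cut_order_def)
  qed (auto simp: cut_order_def)
  moreover have "dense_order_on ?K cut_order"
    unfolding dense_order_on_def
  proof (intro conjI ballI impI)
    show "\<exists>x\<in>?K. \<exists>y\<in>?K. x \<noteq> y" using pT qT pq by blast
    fix x y assume xy: "x \<in> ?K" "y \<in> ?K" "(x, y) \<in> cut_order - Id"
    then have xD: "x \<in> D y" "y \<in> R x" using rays by blast+
    have "?K \<subseteq> R x \<union> D y"
    proof
      fix z assume z: "z \<in> ?K"
      show "z \<in> R x \<union> D y"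
        using DR(1)[OF xy(2)] z R_nested[OF xy(2) xD(1)] by blast
    qed
    \<comment> \<open>Connectedness makes \<open>R x\<close> and \<open>D y\<close> meet; every common point lies strictly between.\<close>
    then obtain z where z: "z \<in> R x" "z \<in> D y"
      using noclopen[of "R x" "D y"] R_open D_open xy xD by blast
    have "(x, z) \<in> cut_order - Id" "(z, y) \<in> cut_order - Id" "z \<in> ?K"
      using z rays[OF xy(1)] rays[OF xy(2)] by blast+
    then show "\<exists>z\<in>?K. (x, z) \<in> cut_order - Id \<and> (z, y) \<in> cut_order - Id" by blast
  qed
  moreover have "order_complete_on ?K cut_order"
    unfolding order_complete_on_def
  proof (intro allI impI, elim conjE exE)
    fix S c assume S: "S \<subseteq> ?K" "S \<noteq> {}" and c: "upper_bound_in ?K cut_order S c"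
    \<comment> \<open>Without a supremum, the upper bounds and the other points would be two open sets.\<close>
    define B where "B = {y. upper_bound_in ?K cut_order S y}"
    have BK: "B \<subseteq> ?K" by (auto simp: B_def upper_bound_in_def)
    show "\<exists>s. supremum_in ?K cut_order S s"
    proof (rule ccontr)
      assume no: "\<not> ?thesis"
      have up: "R y \<subseteq> B" if y: "y \<in> B" for y
      proof
        fix z assume z: "z \<in> R y"
        then have zK: "z \<in> ?K" and yz: "insert y (D y) \<subseteq> D z" using y BK DR(1) D_nested by blast+
        have "(x, z) \<in> cut_order" if "x \<in> S" for x
          using y that yz zK unfolding B_def upper_bound_in_def cut_order_def by auto
        then show "z \<in> B" using zK by (simp add: B_def upper_bound_in_def)
      qed
      have "\<exists>y'\<in>B. y \<in> R y'" if y: "y \<in> B" for y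
      proof -
        obtain y' where y': "y' \<in> B" "(y, y') \<notin> cut_order"
          using no y unfolding supremum_in_def B_def by blast
        then have "y' \<in> D y" using y BK D_total[of y y'] unfolding cut_order_def by blast
        then show ?thesis using y' y BK D_iff_R by blast
      qed
      then have "B = (\<Union>y\<in>B. R y)" using up by blast
      moreover have "openin T (\<Union>y\<in>B. R y)" using R_open BK by blast
      ultimately have oB: "openin T B" by simp
      have "?K - B = (\<Union>x\<in>S. D x)"
      proof
        show "?K - B \<subseteq> (\<Union>x\<in>S. D x)"
        proof
          fix z assume z: "z \<in> ?K - B"
          then obtain x where x: "x \<in> S" "(x, z) \<notin> cut_order"
            unfolding B_def upper_bound_in_def by blast
          then show "z \<in> (\<Union>x\<in>S. D x)"
            using z S(1) D_total[of x z] unfolding cut_order_def by blast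
        qed
        show "(\<Union>x\<in>S. D x) \<subseteq> ?K - B"
        proof
          fix z assume "z \<in> (\<Union>x\<in>S. D x)"
          then obtain x where x: "x \<in> S" "z \<in> D x" by blast
          then have xK: "x \<in> ?K" and zK: "z \<in> ?K" using S D_sub by blast+
          have "(x, z) \<notin> cut_order"
            using x xK zK D_trans[of z x x] D_irrefl[of x] unfolding cut_order_def by blast
          then show "z \<in> ?K - B" using x zK unfolding B_def upper_bound_in_def by blast
        qed
      qed
      moreover have "openin T (\<Union>x\<in>S. D x)" using D_open S by blast
      ultimately have oC: "openin T (?K - B)" by simp
      obtain x where x: "x \<in> S" using S by blast
      have "x \<notin> B"
      proof
        assume "x \<in> B"
        moreover have "(x, y) \<in> cut_order" if "y \<in> B" for y
          using x that unfolding B_def upper_bound_in_def by blast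
        ultimately show False using no unfolding supremum_in_def B_def by blast
      qed
      then show False using noclopen[OF oB oC] x S c unfolding B_def by blast
    qed
  qed
  moreover have "minimum_of ?K cut_order p"
    using pT pD unfolding minimum_of_def cut_order_def by blast
  moreover have "(x, q) \<in> cut_order" if "x \<in> ?K" for x
    using that qT qR D_iff_R unfolding cut_order_def by blast
  then have "maximum_of ?K cut_order q"
    using qT unfolding maximum_of_def by blast
  ultimately show ?thesis unfolding big_interval_ends_def big_interval_def by blast
qed

text \<open>The order topology is coarser than the topology of \<open>T\<close> and is Hausdorff, so for compact \<open>T\<close> they
  agree.\<close>

lemma cut_order_topology:
  assumes "compact_space T"
  shows "order_topology_on (topspace T) cut_order = T"
proof -
  interpret I: big_interval_ends "topspace T" cut_order p q by (rule cut_big_interval)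
  let ?O = "order_topology_on (topspace T) cut_order"
  have "continuous_map T ?O id"
    unfolding order_topology_on_def
  proof (rule continuous_on_generated_topo)
    fix U assume "U \<in> insert (topspace T) ({{y \<in> topspace T. (x, y) \<in> cut_order - Id} |x. x \<in> topspace T} \<union>
        {{y \<in> topspace T. (y, x) \<in> cut_order - Id} |x. x \<in> topspace T})"
    then consider "U = topspace T" | x where "x \<in> topspace T" "U = {y \<in> topspace T. (x, y) \<in> cut_order - Id}"
      | x where "x \<in> topspace T" "U = {y \<in> topspace T. (y, x) \<in> cut_order - Id}" by blast
    then have "openin T U"
    proof cases
      case (2 x)
      then show ?thesis using rays(2)[of x] R_open by simp
    next
      case (3 x)
      then show ?thesis using rays(1)[of x] D_open by simp
    qed simp
    then show "openin T (id -` U \<inter> topspace T)" by (simp add: openin_Int)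
  qed auto
  then have "homeomorphic_map T ?O id"
    using assms I.Hausdorff_order_topology by (intro continuous_imp_homeomorphic_map) auto
  then show ?thesis by simp
qed

end

section \<open>Compact 2-flimsy spaces are big circles\<close>

text \<open>A side of two points \<open>p\<close> and \<open>q\<close>, together with \<open>p\<close> and \<open>q\<close>, is a big interval: a point \<open>x\<close> of
  the side and a fixed point \<open>v\<close> of the other side separate \<open>p\<close> from \<open>q\<close> by the crossing property.\<close>

lemma splits_big_interval:
  assumes comp: "compact_space X" and X: "two_flimsy X"
    and pq: "p \<in> topspace X" "q \<in> topspace X" "p \<noteq> q" and s: "splits X p q U V"
  defines "K \<equiv> insert p (insert q U)"
  obtains r where "big_interval_ends K r p q" "order_topology_on K r = subtopology X K"
proof -
  let ?T = "subtopology X K"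
  have UV: "U \<union> V = topspace X - {p, q}" "U \<noteq> {}" "U \<inter> V = {}"
    using s splits_disjoint[OF s] by (auto simp: splits_def)
  have KX: "K \<subseteq> topspace X" using UV pq by (auto simp: K_def)
  then have topK [simp]: "topspace ?T = K" by auto
  have "K = topspace X - V" using UV pq by (auto simp: K_def)
  then have "closedin X K" using splits_openin(2)[OF X s] by (simp add: closedin_diff)
  then have compK: "compact_space ?T"
    using comp by (simp add: closedin_compact_space compact_space_subtopology)
  have "connectedin X (insert p U)" "connectedin X (insert q U)"
    using splits_connectedin[OF X pq(1,3) s] splits_connectedin[OF X pq(2) _ splits_swap(1)[OF s]] pq(3)
    by auto
  then have "connectedin X (insert p U \<union> insert q U)" using UV(2) by (intro connectedin_Un) auto
  moreover have "insert p U \<union> insert q U = K" by (auto simp: K_def)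
  ultimately have connK: "connected_space ?T" by (simp add: connectedin_def)
  obtain v where v: "v \<in> V" using s by (auto simp: splits_def)
  have "\<exists>E F. splits X x v E F \<and> p \<in> E \<and> q \<in> F" if "x \<in> U" for x
    using splits_crossingE[OF X s that v pq(1,2)] by metis
  then obtain E F where EF: "\<And>x. x \<in> U \<Longrightarrow> splits X x v (E x) (F x) \<and> p \<in> E x \<and> q \<in> F x"
    by metis
  define D where "D = (\<lambda>x. if x = p then {} else if x = q then K - {q} else K \<inter> E x)"
  define R where "R = (\<lambda>x. if x = q then {} else if x = p then K - {p} else K \<inter> F x)"
  have EFK: "K \<inter> E x \<union> K \<inter> F x = K - {x}" "E x \<inter> F x = {}" "openin X (E x)" "openin X (F x)"
    if "x \<in> U" for x
  proof -
    have sx: "splits X x v (E x) (F x)" using EF that by blast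
    have "v \<notin> K" using v UV by (auto simp: K_def)
    then show "K \<inter> E x \<union> K \<inter> F x = K - {x}" using sx KX unfolding splits_def by blast
    show "E x \<inter> F x = {}" using splits_disjoint[OF sx] .
    show "openin X (E x)" "openin X (F x)" using splits_openin[OF X sx] .
  qed
  have delete: "openin ?T (K - {x})" if "x \<in> K" for x
  proof -
    have "closedin X {x}" using two_flimsy_t1[OF X] that KX by (auto simp: t1_space_closedin_singleton)
    then have "openin X (topspace X - {x})" by blast
    moreover have "K - {x} = (topspace X - {x}) \<inter> K" using KX by blast
    ultimately show ?thesis unfolding openin_subtopology by blast
  qed
  have cases: "P x" if "x \<in> K" "P p" "P q" "\<And>x. x \<in> U \<Longrightarrow> x \<noteq> p \<Longrightarrow> x \<noteq> q \<Longrightarrow> P x" for P x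
    using that unfolding K_def by blast
  have pK: "p \<in> K" "q \<in> K" by (auto simp: K_def)
  interpret cut_space ?T p q D R
  proof
    show "connected_space ?T" by (fact connK)
    show "p \<in> topspace ?T" "q \<in> topspace ?T" "p \<noteq> q" using pK pq by auto
    show "D p = {}" "R q = {}" by (simp_all add: D_def R_def)
    fix x assume "x \<in> topspace ?T"
    then have x: "x \<in> K" by simp
    show "openin ?T (D x)" using x
      by (rule cases) (use delete[OF pK(2)] EFK(3) in \<open>auto simp: D_def openin_subtopology_Int2\<close>)
    show "openin ?T (R x)" using x
      by (rule cases) (use delete[OF pK(1)] EFK(4) in \<open>auto simp: R_def openin_subtopology_Int2\<close>)
    show "D x \<union> R x = topspace ?T - {x}" unfolding topK using x
      by (rule cases) (use pq(3) EFK(1) in \<open>simp_all add: D_def R_def\<close>)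
    show "D x \<inter> R x = {}" using x
      by (rule cases) (use pq(3) EFK(2) in \<open>auto simp: D_def R_def\<close>)
    show "p \<in> D x" if "x \<noteq> p"
    proof (cases "x = q")
      case False
      then have "x \<in> U" using x that by (simp add: K_def)
      then show ?thesis using EF[of x] False that pK by (simp add: D_def)
    qed (use that pK in \<open>auto simp: D_def\<close>)
    show "q \<in> R x" if "x \<noteq> q"
    proof (cases "x = p")
      case False
      then have "x \<in> U" using x that by (simp add: K_def)
      then show ?thesis using EF[of x] False that pK by (simp add: R_def)
    qed (use that pK in \<open>auto simp: R_def\<close>)
  qed
  show ?thesis
    using that[of cut_order] cut_big_interval cut_order_topology[OF compK] unfolding topK by blast
qed

text \<open>The two closed arcs between \<open>p\<close> and \<open>q\<close> are concatenated to a big interval that starts and ends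
  at \<open>p\<close>; its map to the space is a continuous surjection from a compact to a Hausdorff space,
  hence a quotient map.\<close>

lemma compact_two_flimsy_imp_big_circle:
  assumes comp: "compact_space X" and X: "two_flimsy X"
  shows "big_circle X"
proof -
  have "topspace X \<noteq> {}" using X by (auto simp: two_flimsy_def)
  then obtain p where p: "p \<in> topspace X" by blast
  have "topspace X \<noteq> {p}" using X by (auto simp: two_flimsy_def)
  then obtain q where q: "q \<in> topspace X" "p \<noteq> q" using p by blast
  obtain U V where s: "splits X p q U V" using two_flimsy_splits[OF X p q] by blast
  have UV: "U \<union> V = topspace X - {p, q}" "U \<inter> V = {}"
    using s splits_disjoint[OF s] by (auto simp: splits_def)
  let ?K = "insert p (insert q U)" and ?M = "insert q (insert p V)"
  have s': "splits X q p V U" using s splits_swap by metis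
  obtain r1 where r1: "big_interval_ends ?K r1 p q" "order_topology_on ?K r1 = subtopology X ?K"
    using splits_big_interval[OF comp X p q s] by metis
  obtain r2 where r2: "big_interval_ends ?M r2 q p" "order_topology_on ?M r2 = subtopology X ?M"
    using splits_big_interval[OF comp X q(1) p q(2)[symmetric] s'] by metis
  let ?L = "concat_set ?K ?M q" and ?r = "concat_order ?K r1 ?M r2 q" and ?f = "case_sum id id"
  have id1: "continuous_map (order_topology_on ?K r1) X id"
    and id2: "continuous_map (order_topology_on ?M r2) X id"
    using r1 r2 by (simp_all add: continuous_map_from_subtopology)
  interpret C: big_interval_ends ?L ?r "Inl p" "Inr p"
    by (rule big_interval_ends_concat[OF r1(1) r2(1)])
  have "continuous_map (order_topology_on ?L ?r) X ?f"
    using continuous_map_concat[OF r1(1) r2(1) id1 id2] by simp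
  moreover have "?f ` ?L = topspace X"
  proof -
    have "?f ` ?L = ?K \<union> (?M - {q})" by (force simp: concat_set_def image_Un image_image)
    then show ?thesis using UV p q by auto
  qed
  ultimately have "quotient_map (order_topology_on ?L ?r) X ?f"
    using C.compact_order_topology two_flimsy_Hausdorff[OF X]
    by (intro continuous_closed_imp_quotient_map T1_Spaces.continuous_imp_closed_map) auto
  moreover have "?f s = ?f t \<longleftrightarrow> s = t \<or> {s, t} = {Inl p, Inr p}" if "s \<in> ?L" "t \<in> ?L" for s t
    using that UV(2) by (cases s; cases t) (auto simp: doubleton_eq_iff UV(1))
  ultimately have "big_circle_from ?L ?r X"
    unfolding big_circle_from_def using C.bi C.mina C.maxb
    by (intro conjI exI[of _ "Inl p"] exI[of _ "Inr p"] exI[of _ ?f]) auto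
  then show ?thesis by (rule big_circle_from_imp_big_circle)
qed

section \<open>Hausdorff 2-big-path-flimsy spaces\<close>

text \<open>Following a big path in \<open>S\<close> that meets \<open>x\<close> until it first meets \<open>x\<close>, one stays, before the end, in
  the big-path component of its starting point in \<open>S - {x}\<close>.\<close>

lemma (in big_interval_ends) path_first_hit:
  assumes X: "t1_space X" and c: "continuous_map (order_topology_on L r) (subtopology X S) \<gamma>"
    and ax: "\<gamma> a \<noteq> x"
    and n: "\<not> big_path_joined (subtopology X (S - {x})) (\<gamma> a) (\<gamma> b)"
  defines "A \<equiv> {c. big_path_joined (subtopology X (S - {x})) (\<gamma> a) c}"
  shows "big_path_joined (subtopology X (insert x A)) (\<gamma> a) x"
proof -
  have cX: "continuous_map (order_topology_on L r) X \<gamma>" and cS: "\<And>t. t \<in> L \<Longrightarrow> \<gamma> t \<in> topspace X \<inter> S"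
    using c continuous_map_image_subset_topspace[OF c]
    by (auto simp: continuous_map_in_subtopology)
  have "\<exists>z\<in>L. \<gamma> z = x"
  proof (rule ccontr)
    assume "\<not> ?thesis"
    then have "\<gamma> u \<in> S - {x}" if "a \<sqsubseteq> u" for u using cS sub[OF that] by blast
    then have "big_path_joined (subtopology X (S - {x})) (\<gamma> a) (\<gamma> b)"
      using subpath_joined[OF cX a_lt_b] by blast
    then show False using n by simp
  qed
  then obtain z where z: "z \<in> L" "\<gamma> z = x" by blast
  \<comment> \<open>The supremum of \<open>N\<close> is the first parameter at which the path meets \<open>x\<close>.\<close>
  define N where "N = {t \<in> L. \<forall>s. s \<sqsubseteq> t \<longrightarrow> \<gamma> s \<noteq> x}"
  have NL: "N \<subseteq> L" by (auto simp: N_def)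
  have "\<gamma> s \<noteq> x" if "s \<sqsubseteq> a" for s using that a_le le_antisym sub ax by metis
  then have "a \<in> N" using aL by (simp add: N_def)
  then have ne: "N \<noteq> {}" by blast
  define t where "t = lub N"
  have tL: "t \<in> L" using lub(1)[OF NL ne] t_def by simp
  have before: "\<gamma> s \<noteq> x" if "s \<sqsubset> t" for s
    using lt_lub[OF NL ne] that unfolding t_def N_def by blast
  have tx: "\<gamma> t = x"
  proof (rule ccontr)
    assume tx: "\<gamma> t \<noteq> x"
    have "t \<sqsubseteq> z" using before z le_total[OF tL z(1)] by blast
    then have "t \<noteq> b" using z tx le_b[OF z(1)] le_antisym by blast
    have "x \<in> topspace X" using cS[OF z(1)] z(2) by simp
    then have "openin X (topspace X - {x})" using X by (simp add: openin_diff t1_space_closedin_singleton)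
    then have "openin (order_topology_on L r) {s \<in> L. \<gamma> s \<in> topspace X - {x}}"
      using cX unfolding continuous_map_def topspace_order_topology_on by blast
    moreover have "t \<in> {s \<in> L. \<gamma> s \<in> topspace X - {x}}" using tL tx cS by blast
    ultimately obtain u where u: "t \<sqsubset> u"
      "\<forall>s. t \<sqsubseteq> s \<and> s \<sqsubset> u \<longrightarrow> s \<in> {s \<in> L. \<gamma> s \<in> topspace X - {x}}"
      using open_right \<open>t \<noteq> b\<close> by blast
    obtain w where w: "w \<in> L" "t \<sqsubset> w" "w \<sqsubset> u" using between[OF u(1)] by blast
    have "\<gamma> s \<noteq> x" if s: "s \<sqsubseteq> w" for s
    proof (cases "s \<sqsubset> t")
      case True
      then show ?thesis by (rule before)
    next
      case False
      then have "t \<sqsubseteq> s" using le_total[of t s] tL sub[OF s] by blast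
      then show ?thesis using u(2) le_lt_trans[OF s w(3)] by blast
    qed
    then have "w \<in> N" using w by (simp add: N_def)
    then have "w \<sqsubseteq> t" using lub(2)[OF NL ne] t_def by simp
    then show False using w le_antisym by blast
  qed
  have lt: "a \<sqsubset> t" using a_le[OF tL] ax tx by blast
  have "\<gamma> s \<in> insert x A" if s: "s \<sqsubseteq> t" for s
  proof (cases "s = t")
    case True
    then show ?thesis using tx by simp
  next
    case False
    have "\<gamma> u \<in> S - {x}" if "u \<sqsubseteq> s" for u
      using before[of u] le_lt_trans[OF that] False s cS sub[OF that] by blast
    then have "big_path_joined (subtopology X (S - {x})) (\<gamma> a) (\<gamma> s)"
    proof (cases "s = a")
      case True
      then have "\<gamma> a \<in> topspace (subtopology X (S - {x}))" using cS[OF aL] ax by auto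
      from joined_refl[OF this] show ?thesis using True by simp
    next
      case False
      then have "a \<sqsubset> s" using a_le sub[OF s] by blast
      then show ?thesis using subpath_joined[OF cX] \<open>\<And>u. u \<sqsubseteq> s \<Longrightarrow> \<gamma> u \<in> S - {x}\<close> by blast
    qed
    then show ?thesis by (simp add: A_def)
  qed
  then have "big_path_joined (subtopology X (insert x A)) (\<gamma> a) (\<gamma> t)"
    using subpath_joined[OF cX lt] by blast
  then show ?thesis using tx by simp
qed

lemma joined_first_hit:
  assumes X: "t1_space X" and j: "big_path_joined (subtopology X S) a b" and ax: "a \<noteq> x"
    and n: "\<not> big_path_joined (subtopology X (S - {x})) a b"
  shows "big_path_joined (subtopology X (insert x {c. big_path_joined (subtopology X (S - {x})) a c})) a x"
proof -
  obtain L :: "'a big set" and r \<gamma> where "big_path (subtopology X S) L r \<gamma> a b"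
    using j unfolding big_path_joined_def by blast
  then obtain l m where I: "big_interval_ends L r l m"
    and c: "continuous_map (order_topology_on L r) (subtopology X S) \<gamma>"
    and ab: "\<gamma> l = a" "\<gamma> m = b" by (rule big_path_endsE)
  show ?thesis
    using big_interval_ends.path_first_hit[OF I X c, of x] ax n unfolding ab by blast
qed

context
  fixes X :: "'a topology"
  assumes H: "Hausdorff_space X" and F: "two_big_path_flimsy X"
begin

text \<open>The relation of being joined by a big path that avoids the points \<open>x\<close> and \<open>y\<close>.\<close>

definition avoid :: "'a \<Rightarrow> 'a \<Rightarrow> 'a \<Rightarrow> 'a \<Rightarrow> bool" where
  "avoid x y a b \<longleftrightarrow> big_path_joined (subtopology X (topspace X - {x, y})) a b"

lemma avoid_in: "avoid x y a b \<Longrightarrow> a \<in> topspace X - {x, y} \<and> b \<in> topspace X - {x, y}"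
  unfolding avoid_def using joined_in by fastforce

lemma avoid_refl: "a \<in> topspace X - {x, y} \<Longrightarrow> avoid x y a a"
  unfolding avoid_def by (rule joined_refl) auto

lemma avoid_sym: "avoid x y a b \<Longrightarrow> avoid x y b a"
  unfolding avoid_def by (rule joined_sym)

lemma avoid_trans: "avoid x y a b \<Longrightarrow> avoid x y b c \<Longrightarrow> avoid x y a c"
  unfolding avoid_def by (rule joined_trans)

lemma avoid_swap: "avoid x y a b \<longleftrightarrow> avoid y x a b"
  unfolding avoid_def by (simp add: insert_commute)

lemma joined_avoid:
  "big_path_joined (subtopology X K) a b \<Longrightarrow> K \<subseteq> topspace X - {x, y} \<Longrightarrow> avoid x y a b"
  unfolding avoid_def by (rule joined_mono)

text \<open>Outside two points \<open>x\<close> and \<open>y\<close>, each big-path component reaches both \<open>x\<close> and \<open>y\<close>, since deleting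
  only one of them leaves a big-path-connected space.\<close>

lemma component_reaches:
  assumes xy: "x \<in> topspace X" "y \<in> topspace X" "x \<noteq> y"
    and ab: "a \<in> topspace X - {x, y}" "b \<in> topspace X - {x, y}" "\<not> avoid x y a b"
  shows "big_path_joined (subtopology X (insert x {c. avoid x y a c})) a x"
    "big_path_joined (subtopology X (insert y {c. avoid x y a c})) a y"
proof -
  have 1: "big_path_joined (subtopology X (insert x {c. avoid x y a c})) a x"
    if xy: "x \<in> topspace X" "y \<in> topspace X" "x \<noteq> y"
    and ab: "a \<in> topspace X - {x, y}" "b \<in> topspace X - {x, y}" "\<not> avoid x y a b" for x y
  proof -
    have "big_path_connected_space (subtopology X (topspace X - {y}))"
      using F xy unfolding two_big_path_flimsy_def by simp
    then have "big_path_joined (subtopology X (topspace X - {y})) a b"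
      using ab unfolding big_path_connected_space_def by auto
    moreover have e: "topspace X - {y} - {x} = topspace X - {x, y}" by blast
    ultimately show ?thesis
      using joined_first_hit[of X "topspace X - {y}" a b x] ab Hausdorff_imp_t1_space[OF H]
      unfolding e avoid_def by blast
  qed
  show "big_path_joined (subtopology X (insert x {c. avoid x y a c})) a x" by (rule 1) fact+
  have "{c. avoid x y a c} = {c. avoid y x a c}" using avoid_swap by blast
  then show "big_path_joined (subtopology X (insert y {c. avoid x y a c})) a y"
    using 1[of y x] xy ab avoid_swap by (simp add: insert_commute)
qed

lemma obtain_not_avoid:
  assumes xy: "x \<in> topspace X" "y \<in> topspace X" "x \<noteq> y"
  obtains a b where "a \<in> topspace X - {x, y}" "b \<in> topspace X - {x, y}" "\<not> avoid x y a b"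
proof -
  have "\<not> big_path_connected_space (subtopology X (topspace X - {x, y}))"
    using F xy unfolding two_big_path_flimsy_def by simp
  then show ?thesis using that unfolding big_path_connected_space_def avoid_def by auto
qed

text \<open>The crossing property for big-path components.\<close>

lemma avoid_crossing:
  assumes xy: "x \<in> topspace X" "y \<in> topspace X" "x \<noteq> y"
    and uv: "u \<in> topspace X - {x, y}" "v \<in> topspace X - {x, y}" "\<not> avoid x y u v"
  shows "\<not> avoid u v x y"
proof
  assume j: "avoid u v x y"
  have top: "u \<in> topspace X" "v \<in> topspace X" "u \<noteq> v" using uv avoid_refl by blast+
  obtain d e where de: "d \<in> topspace X - {u, v}" "e \<in> topspace X - {u, v}" "\<not> avoid u v d e"
    using obtain_not_avoid[OF top] by blast
  then have "\<not> avoid u v x d \<or> \<not> avoid u v x e" using avoid_trans avoid_sym by blast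
  then obtain c where c: "c \<in> topspace X - {u, v}" "\<not> avoid u v c x" using de avoid_sym by blast
  let ?C = "{d. avoid u v c d}"
  have xC: "x \<notin> ?C" using c by simp
  have yC: "y \<notin> ?C" using c avoid_trans[of u v c y x] avoid_sym[OF j] by blast
  have "x \<in> topspace X - {u, v}" using xy uv by blast
  note * = component_reaches[OF top c(1) this c(2)]
  have "?C \<subseteq> topspace X" using avoid_in by blast
  then have "insert u ?C \<subseteq> topspace X - {x, y}" "insert v ?C \<subseteq> topspace X - {x, y}"
    using xC yC uv by blast+
  then have "avoid x y c u" "avoid x y c v" using * joined_avoid by blast+
  then show False using uv(3) avoid_trans avoid_sym by blast
qed

text \<open>A component together with \<open>x\<close> and \<open>y\<close> is the image of a big path: a path from \<open>x\<close> to \<open>y\<close> in this set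
  that misses a point \<open>u\<close> of the component would avoid \<open>u\<close> and \<open>b\<close>, against the crossing property.\<close>

lemma compactin_component:
  assumes xy: "x \<in> topspace X" "y \<in> topspace X" "x \<noteq> y"
    and ab: "a \<in> topspace X - {x, y}" "b \<in> topspace X - {x, y}" "\<not> avoid x y a b"
  shows "compactin X (insert x (insert y {c. avoid x y a c}))"
proof -
  let ?A = "{c. avoid x y a c}"
  let ?K = "insert x (insert y ?A)"
  have "big_path_joined (subtopology X ?K) a x" "big_path_joined (subtopology X ?K) a y"
    using component_reaches[OF xy ab] joined_mono by (metis insert_commute subset_insertI)+
  then have "big_path_joined (subtopology X ?K) x y" using joined_sym joined_trans by metis
  then obtain K where K: "compactin X K" "x \<in> K" "y \<in> K" "K \<subseteq> ?K"
    "big_path_joined (subtopology X K) x y" by (rule joined_image)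
  have "u \<in> K" if u: "u \<in> ?A" for u
  proof (rule ccontr)
    assume "u \<notin> K"
    moreover have "b \<notin> K" using K(4) ab by blast
    ultimately have "avoid u b x y"
      using joined_avoid[OF K(5)] compactin_subset_topspace[OF K(1)] by blast
    moreover have "avoid x y a u" using u by simp
    then have "u \<in> topspace X - {x, y}" "\<not> avoid x y u b"
      using avoid_in ab(3) avoid_trans by blast+
    ultimately show False using avoid_crossing[OF xy] ab(2) by blast
  qed
  then have "K = ?K" using K by blast
  then show ?thesis using K(1) by simp
qed

text \<open>There are exactly two components outside \<open>x\<close> and \<open>y\<close>: through a third one, \<open>x\<close> and \<open>y\<close> could be
  joined while avoiding a point of each of the other two.\<close>

lemma two_components:
  assumes xy: "x \<in> topspace X" "y \<in> topspace X" "x \<noteq> y"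
  obtains A B where "compactin X (insert x (insert y A))" "compactin X (insert x (insert y B))"
    "A \<noteq> {}" "B \<noteq> {}" "A \<inter> B = {}" "A \<union> B = topspace X - {x, y}"
proof -
  obtain a b where ab: "a \<in> topspace X - {x, y}" "b \<in> topspace X - {x, y}" "\<not> avoid x y a b"
    using obtain_not_avoid[OF xy] by blast
  let ?A = "{c. avoid x y a c}" and ?B = "{c. avoid x y b c}"
  have ba: "\<not> avoid x y b a" using ab(3) avoid_sym by blast
  have "d \<in> ?A \<union> ?B" if d: "d \<in> topspace X - {x, y}" for d
  proof (rule ccontr)
    assume "d \<notin> ?A \<union> ?B"
    then have n: "\<not> avoid x y d a" "\<not> avoid x y d b" using avoid_sym by blast+
    let ?D = "{c. avoid x y d c}"
    have "insert x ?D \<subseteq> topspace X - {a, b}" "insert y ?D \<subseteq> topspace X - {a, b}"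
      using n avoid_in ab xy by blast+
    then have "avoid a b d x" "avoid a b d y"
      using component_reaches[OF xy d ab(1) n(1)] joined_avoid by blast+
    then have "avoid a b x y" using avoid_sym avoid_trans by blast
    then show False using avoid_crossing[OF xy ab] by blast
  qed
  then have "?A \<union> ?B = topspace X - {x, y}" using avoid_in by blast
  moreover have "?A \<inter> ?B = {}" using ab(3) avoid_sym avoid_trans by blast
  moreover have "?A \<noteq> {}" "?B \<noteq> {}" using avoid_refl ab by blast+
  ultimately show ?thesis
    using that compactin_component[OF xy ab] compactin_component[OF xy ab(2,1) ba] by blast
qed

lemma big_path_flimsy_compact: "compact_space X"
proof -
  have "topspace X \<noteq> {}" using F by (auto simp: two_big_path_flimsy_def)
  then obtain p where p: "p \<in> topspace X" by blast
  have "topspace X \<noteq> {p}" using F by (auto simp: two_big_path_flimsy_def)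
  then obtain q where q: "q \<in> topspace X" "p \<noteq> q" using p by blast
  obtain A B where "compactin X (insert p (insert q A))" "compactin X (insert p (insert q B))"
    "A \<union> B = topspace X - {p, q}" using two_components[OF p q] by metis
  moreover have "topspace X = insert p (insert q A) \<union> insert p (insert q B)"
    using calculation(3) p q by blast
  ultimately show ?thesis unfolding compact_space_def by (metis compactin_Un)
qed

text \<open>In a Hausdorff space the two compact sets of the previous lemmas are closed, so the two components
  outside \<open>x\<close> and \<open>y\<close> are separated.\<close>

lemma big_path_flimsy_imp_flimsy: "two_flimsy X"
  unfolding two_flimsy_def
proof (intro conjI allI impI)
  show "infinite (topspace X) \<or> card (topspace X) > 2"
    using F by (simp add: two_big_path_flimsy_def)
  fix S assume S: "S \<subseteq> topspace X"
  show "connected_space (subtopology X (topspace X - S))" if "finite S \<and> card S < 2"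
    using F S that big_path_connected_imp_connected unfolding two_big_path_flimsy_def by blast
  show "\<not> connected_space (subtopology X (topspace X - S))" if "card S = 2"
  proof -
    have "\<exists>x y. S = {x, y} \<and> x \<noteq> y" using that by (simp add: card_2_iff)
    then obtain x y where S2: "S = {x, y}" "x \<noteq> y" by blast
    then obtain A B where AB: "compactin X (insert x (insert y A))" "compactin X (insert x (insert y B))"
      "A \<noteq> {}" "B \<noteq> {}" "A \<inter> B = {}" "A \<union> B = topspace X - {x, y}"
      using two_components[of x y] S by (metis insert_subset)
    have "closedin X (insert x (insert y A))" "closedin X (insert x (insert y B))"
      using AB(1,2) compactin_imp_closedin[OF H] by blast+
    then have "separatedin X (insert x (insert y A) - insert x (insert y B))
        (insert x (insert y B) - insert x (insert y A))"
      by (rule separatedin_closedin_diff)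
    moreover have "insert x (insert y A) - insert x (insert y B) = A"
      "insert x (insert y B) - insert x (insert y A) = B" using AB by blast+
    ultimately have "separatedin X A B" by simp
    then have "\<not> connectedin X (topspace X - S)"
      using AB S2 unfolding connectedin_eq_not_separated by metis
    then show ?thesis by (simp add: connectedin_def)
  qed
qed

end

section \<open>Big circles\<close>

text \<open>Disjoint nonempty open sets \<open>U\<close> and \<open>V\<close> make up the complement of \<open>x\<close> and \<open>y\<close>, and \<open>x\<close> and \<open>y\<close> are
  joined by a big path along each of them. Any two points of a big circle have such arcs.\<close>

definition arcs :: "'a topology \<Rightarrow> 'a \<Rightarrow> 'a \<Rightarrow> 'a set \<Rightarrow> 'a set \<Rightarrow> bool" where
  "arcs X x y U V \<longleftrightarrow> openin X U \<and> openin X V \<and> U \<noteq> {} \<and> V \<noteq> {} \<and> U \<inter> V = {} \<and>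
     U \<union> V = topspace X - {x, y} \<and>
     big_path_joined (subtopology X (insert x (insert y U))) x y \<and>
     big_path_joined (subtopology X (insert x (insert y V))) x y"

text \<open>One arc is the image of the open interval from \<open>s\<close> to \<open>t\<close>; the other one runs from \<open>t\<close> through the
  identified ends to \<open>s\<close>. The case \<open>s = a\<close>, in which \<open>b\<close> represents the point \<open>q s\<close> too, is allowed.\<close>

lemma (in big_interval_ends) quotient_arcs:
  assumes q: "quotient_map (order_topology_on L r) X q"
    and fib: "\<And>s t. s \<in> L \<Longrightarrow> t \<in> L \<Longrightarrow> q s = q t \<longleftrightarrow> s = t \<or> {s, t} = {a, b}"
    and st: "s \<sqsubset> t" "t \<sqsubset> b"
  shows "\<exists>U V. arcs X (q s) (q t) U V"
proof -
  let ?T = "order_topology_on L r"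
  let ?x = "q s" and ?y = "q t"
  have surj: "q ` L = topspace X" using quotient_imp_surjective_map[OF q] by simp
  have cont: "continuous_map ?T X q" by (rule quotient_imp_continuous_map[OF q])
  have open_iff: "openin X U \<longleftrightarrow> openin ?T {z \<in> L. q z \<in> U}" if "U \<subseteq> topspace X" for U
    using q that by (simp add: quotient_map_def)
  have sL: "s \<in> L" and tL: "t \<in> L" using st sub by blast+
  have sb: "s \<noteq> b" using st le_antisym by blast
  have ta: "t \<noteq> a" using a_le[OF sL] st le_antisym by blast
  have qab: "q a = q b" using fib[OF aL bL] by simp
  have inner: "q z = q u \<longleftrightarrow> z = u" if "z \<in> L" "u \<in> L" "u \<noteq> a" "u \<noteq> b" for z u
    using fib[OF that(1,2)] that(3,4) by (auto simp: doubleton_eq_iff)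
  define U where "U = q ` {u. s \<sqsubset> u \<and> u \<sqsubset> t}"
  define V where "V = topspace X - q ` {u. s \<sqsubseteq> u \<and> u \<sqsubseteq> t}"
  have preU: "{z \<in> L. q z \<in> U} = {z \<in> L. (s, z) \<in> r - Id} \<inter> {z \<in> L. (z, t) \<in> r - Id}"
  proof -
    have "z = u" if "z \<in> L" "s \<sqsubset> u" "u \<sqsubset> t" "q z = q u" for z u
    proof -
      have "u \<in> L" "u \<noteq> a" "u \<noteq> b"
        using that st sub a_le[OF sL] le_b[OF tL] le_antisym by blast+
      then show ?thesis using inner that by blast
    qed
    then show ?thesis unfolding U_def by blast
  qed
  have preV: "{z \<in> L. q z \<in> V} = {z \<in> L. (z \<sqsubset> s \<or> t \<sqsubset> z) \<and> (s = a \<longrightarrow> z \<noteq> b)}" (is "?l = ?r")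
  proof
    show "?l \<subseteq> ?r"
    proof
      fix z assume z: "z \<in> ?l"
      then have zL: "z \<in> L" and "\<not> (s \<sqsubseteq> z \<and> z \<sqsubseteq> t)" unfolding V_def by blast+
      then have "z \<sqsubset> s \<or> t \<sqsubset> z" using le_total sL tL by blast
      moreover have "z \<noteq> b" if "s = a"
      proof
        assume "z = b"
        then have "q z = q s" using qab that by simp
        then show False using z st le_refl[OF sL] unfolding V_def by blast
      qed
      ultimately show "z \<in> ?r" using zL by blast
    qed
    show "?r \<subseteq> ?l"
    proof
      fix z assume z: "z \<in> ?r"
      have "q z \<noteq> q u" if u: "s \<sqsubseteq> u" "u \<sqsubseteq> t" for u
      proof
        assume e: "q z = q u"
        have uL: "u \<in> L" "u \<noteq> b" using u st sub le_antisym by blast+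
        show False
        proof (cases "u = a")
          case True
          then have "s = a" using u a_le[OF sL] le_antisym by blast
          moreover have "z = a \<or> z = b" using fib[of z u] z uL e True by (auto simp: doubleton_eq_iff)
          ultimately have "z = a" using z by blast
          then show False using z \<open>s = a\<close> ta le_antisym[of t a] a_le[OF tL] by blast
        next
          case False
          then have "z = u" using inner[of z u] z uL e by blast
          then show False using z u le_antisym by blast
        qed
      qed
      then show "z \<in> ?l" using z surj unfolding V_def by blast
    qed
  qed
  have UX: "U \<subseteq> topspace X" and VX: "V \<subseteq> topspace X"
    using surj sub unfolding U_def V_def by blast+
  have "openin X U"
    unfolding open_iff[OF UX] preU using openin_upper_ray[OF sL] openin_lower_ray[OF tL] by (rule openin_Int)
  moreover have "openin X V"
    unfolding open_iff[OF VX] preV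
  proof (cases "s = a")
    case True
    have "{z \<in> L. (z \<sqsubset> s \<or> t \<sqsubset> z) \<and> (s = a \<longrightarrow> z \<noteq> b)} =
        {z \<in> L. (t, z) \<in> r - Id} \<inter> {z \<in> L. (z, b) \<in> r - Id}"
      using True a_le le_b le_antisym by blast
    then show "openin ?T {z \<in> L. (z \<sqsubset> s \<or> t \<sqsubset> z) \<and> (s = a \<longrightarrow> z \<noteq> b)}"
      using openin_Int[OF openin_upper_ray[OF tL, of r] openin_lower_ray[OF bL, of r]] by (simp only:)
  next
    case False
    then have "{z \<in> L. (z \<sqsubset> s \<or> t \<sqsubset> z) \<and> (s = a \<longrightarrow> z \<noteq> b)} =
        {z \<in> L. (z, s) \<in> r - Id} \<union> {z \<in> L. (t, z) \<in> r - Id}"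
      by blast
    then show "openin ?T {z \<in> L. (z \<sqsubset> s \<or> t \<sqsubset> z) \<and> (s = a \<longrightarrow> z \<noteq> b)}"
      using openin_Un[OF openin_lower_ray[OF sL, of r] openin_upper_ray[OF tL, of r]] by (simp only:)
  qed
  moreover have "U \<noteq> {}" using between[OF st(1)] unfolding U_def by blast
  moreover have "V \<noteq> {}"
  proof -
    obtain z where "z \<in> L" "t \<sqsubset> z" "z \<sqsubset> b" using between[OF st(2)] by blast
    then have "z \<in> {z \<in> L. q z \<in> V}" unfolding preV by blast
    then show ?thesis by blast
  qed
  moreover have "U \<inter> V = {}" unfolding U_def V_def by blast
  moreover have "U \<union> V = topspace X - {?x, ?y}"
  proof -
    have im: "q ` {u. s \<sqsubseteq> u \<and> u \<sqsubseteq> t} = insert ?x (insert ?y U)"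
    proof -
      have "{u. s \<sqsubseteq> u \<and> u \<sqsubseteq> t} = insert s (insert t {u. s \<sqsubset> u \<and> u \<sqsubset> t})"
        using st(1) le_refl[OF sL] le_refl[OF tL] by blast
      then show ?thesis unfolding U_def by simp
    qed
    have "s \<notin> {z \<in> L. q z \<in> U}" "t \<notin> {z \<in> L. q z \<in> U}" unfolding preU by blast+
    then have "?x \<notin> U" "?y \<notin> U" using sL tL by blast+
    then show ?thesis using UX unfolding V_def im by blast
  qed
  moreover have "big_path_joined (subtopology X (insert ?x (insert ?y U))) ?x ?y"
  proof (rule subpath_joined[OF cont st(1)])
    show "q u \<in> insert ?x (insert ?y U)" if "s \<sqsubseteq> u" "u \<sqsubseteq> t" for u
      using that unfolding U_def by blast
  qed
  moreover have "big_path_joined (subtopology X (insert ?x (insert ?y V))) ?x ?y"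
  proof -
    let ?S = "insert ?x (insert ?y V)"
    have "q u \<in> ?S" if u: "t \<sqsubseteq> u" for u
    proof (cases "u = t \<or> s = a \<and> u = b")
      case True
      then show ?thesis using qab by auto
    next
      case False
      then have "u \<in> {z \<in> L. q z \<in> V}" unfolding preV using u sub by blast
      then show ?thesis by blast
    qed
    then have tb: "big_path_joined (subtopology X ?S) ?y (q b)"
      using subpath_joined[OF cont st(2)] by blast
    have "big_path_joined (subtopology X ?S) (q a) ?x"
    proof (cases "s = a")
      case True
      have "?x \<in> topspace (subtopology X ?S)" using surj sL by auto
      from joined_refl[OF this] show ?thesis using True by simp
    next
      case False
      then have as: "a \<sqsubset> s" using a_le[OF sL] by blast
      have "q u \<in> ?S" if u: "u \<sqsubseteq> s" for u
      proof (cases "u = s")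
        case False
        then have "u \<in> {z \<in> L. q z \<in> V}" unfolding preV using u as sub by blast
        then show ?thesis by blast
      qed simp
      then show ?thesis using subpath_joined[OF cont as] by blast
    qed
    then show ?thesis using tb qab joined_trans joined_sym by metis
  qed
  ultimately have "arcs X ?x ?y U V" unfolding arcs_def by (intro conjI)
  then show ?thesis by blast
qed

lemma arcs_swap:
  assumes "arcs X x y U V" shows "arcs X y x U V"
proof -
  have "insert y (insert x W) = insert x (insert y W)" for W by blast
  then show ?thesis
    using assms joined_sym[of _ x y] unfolding arcs_def by (intro conjI) auto
qed

lemma arcs_joined:
  assumes UV: "arcs X x y U V" and A: "x \<in> A" "y \<in> A" "U \<subseteq> A \<or> V \<subseteq> A"
  shows "big_path_joined (subtopology X A) x y"
proof -
  have U: "big_path_joined (subtopology X (insert x (insert y U))) x y"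
    and V: "big_path_joined (subtopology X (insert x (insert y V))) x y"
    using UV by (simp_all add: arcs_def)
  have "insert x (insert y U) \<subseteq> A \<or> insert x (insert y V) \<subseteq> A" using A by blast
  then show ?thesis using joined_mono[OF U] joined_mono[OF V] by metis
qed

lemma arcs_splits: "arcs X x y U V \<Longrightarrow> splits X x y U V"
  unfolding arcs_def splits_def by (simp add: separatedin_open_sets disjnt_def)

lemma big_circleE:
  fixes X :: "'a topology"
  assumes "big_circle X"
  obtains L :: "'a big set" and r a b f where "big_interval_ends L r a b"
    "quotient_map (order_topology_on L r) X f"
    "\<forall>s\<in>L. \<forall>t\<in>L. f s = f t \<longleftrightarrow> s = t \<or> {s, t} = {a, b}"
proof -
  obtain L :: "'a big set" and r where "big_circle_from L r X"
    using assms unfolding big_circle_def by blast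
  then obtain a b f where bi: "big_interval L r" "minimum_of L r a" "maximum_of L r b"
    and f: "quotient_map (order_topology_on L r) X f"
    and fib: "\<forall>s\<in>L. \<forall>t\<in>L. f s = f t \<longleftrightarrow> s = t \<or> {s, t} = {a, b}"
    unfolding big_circle_from_def by (elim conjE exE, intro that)
  have "big_interval_ends L r a b" using bi by unfold_locales
  then show ?thesis by (rule that) (fact f fib)+
qed

lemma big_circle_arcs:
  fixes X :: "'a topology"
  assumes "big_circle X" and xy: "x \<in> topspace X" "y \<in> topspace X" "x \<noteq> y"
  obtains U V where "arcs X x y U V"
proof -
  obtain L :: "'a big set" and r a b f where I: "big_interval_ends L r a b"
    and f: "quotient_map (order_topology_on L r) X f"
    and "\<forall>s\<in>L. \<forall>t\<in>L. f s = f t \<longleftrightarrow> s = t \<or> {s, t} = {a, b}"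
    by (rule big_circleE[OF assms(1)])
  note fib = this(3)[rule_format]
  interpret big_interval_ends L r a b by (fact I)
  have "\<exists>s\<in>L. s \<noteq> b \<and> f s = z" if "z \<in> topspace X" for z
  proof -
    have "z \<in> f ` L" using quotient_imp_surjective_map[OF f] that by simp
    then obtain s where "s \<in> L" "f s = z" by blast
    moreover have "f a = f b" "a \<noteq> b" using fib[OF aL bL] a_lt_b by auto
    ultimately show ?thesis using aL by metis
  qed
  \<comment> \<open>The identified point is represented by the minimum \<open>a\<close>.\<close>
  then obtain s t where s: "s \<in> L" "s \<noteq> b" "f s = x" and t: "t \<in> L" "t \<noteq> b" "f t = y"
    using xy by metis
  have "(s, t) \<in> r \<and> s \<noteq> t \<or> (t, s) \<in> r \<and> t \<noteq> s" using le_total[OF s(1) t(1)] s t xy(3) by blast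
  then show ?thesis
  proof
    assume "(s, t) \<in> r \<and> s \<noteq> t"
    then show ?thesis using quotient_arcs[OF f fib, of s t] le_b[OF t(1)] t(2) that unfolding s(3) t(3) by blast
  next
    assume "(t, s) \<in> r \<and> t \<noteq> s"
    then show ?thesis using quotient_arcs[OF f fib, of t s] le_b[OF s(1)] s(2) that arcs_swap[of X y x] unfolding s(3) t(3)
      by blast
  qed
qed

lemma big_circle_two_points:
  fixes X :: "'a topology"
  assumes "big_circle X" obtains x y where "x \<in> topspace X" "y \<in> topspace X" "x \<noteq> y"
proof -
  obtain L :: "'a big set" and r a b f where I: "big_interval_ends L r a b"
    and f: "quotient_map (order_topology_on L r) X f"
    and "\<forall>s\<in>L. \<forall>t\<in>L. f s = f t \<longleftrightarrow> s = t \<or> {s, t} = {a, b}"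
    by (rule big_circleE[OF assms(1)])
  note fib = this(3)[rule_format]
  interpret big_interval_ends L r a b by (fact I)
  obtain z where z: "z \<in> L" "z \<noteq> a" "z \<noteq> b" using between[OF a_lt_b] by blast
  have "f a \<noteq> f z" using fib[OF aL z(1)] z by (auto simp: doubleton_eq_iff)
  moreover have "f a \<in> topspace X" "f z \<in> topspace X"
    using quotient_imp_surjective_map[OF f] aL z(1) by auto
  ultimately show ?thesis using that by blast
qed

lemma big_circle_delete_point:
  fixes X :: "'a topology"
  assumes X: "big_circle X"
  shows "big_path_connected_space (subtopology X (topspace X - {p}))"
  unfolding big_path_connected_space_def
proof (intro ballI)
  let ?X = "subtopology X (topspace X - {p})"
  fix x y assume xy: "x \<in> topspace ?X" "y \<in> topspace ?X"
  show "big_path_joined ?X x y"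
  proof (cases "x = y")
    case True
    then show ?thesis using joined_refl[OF xy(1)] by simp
  next
    case False
    have xy': "x \<in> topspace X" "y \<in> topspace X" "x \<noteq> p" "y \<noteq> p" using xy by auto
    obtain U V where UV: "arcs X x y U V" using big_circle_arcs[OF X xy'(1,2) False] by blast
    then have "U \<subseteq> topspace X - {p} \<or> V \<subseteq> topspace X - {p}" unfolding arcs_def by blast
    then show ?thesis using arcs_joined[OF UV, of "topspace X - {p}"] xy' by simp
  qed
qed

lemma big_circle_two_flimsy:
  fixes X :: "'a topology"
  assumes X: "big_circle X" shows "two_flimsy X"
  unfolding two_flimsy_def
proof (intro conjI allI impI)
  obtain x y where xy: "x \<in> topspace X" "y \<in> topspace X" "x \<noteq> y"
    using big_circle_two_points[OF X] by blast
  obtain U V where UV: "arcs X x y U V" using big_circle_arcs[OF X xy] by blast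
  then obtain u where u: "u \<in> topspace X - {x, y}" unfolding arcs_def by blast
  then have "{x, y, u} \<subseteq> topspace X" "card {x, y, u} = 3" using xy by auto
  then have "3 \<le> card (topspace X)" if "finite (topspace X)" using card_mono[OF that] by metis
  then show "infinite (topspace X) \<or> card (topspace X) > 2" by fastforce
  fix S assume S: "S \<subseteq> topspace X"
  show "connected_space (subtopology X (topspace X - S))" if "finite S \<and> card S < 2"
  proof -
    have del: "connectedin X (topspace X - {z})" for z
      using big_path_connected_imp_connected[OF big_circle_delete_point[OF X, of z]]
      by (simp add: connectedin_def)
    show ?thesis
    proof (cases "S = {}")
      case True
      have "connectedin X ((topspace X - {x}) \<union> (topspace X - {y}))"
        using u by (intro connectedin_Un del) blast
      moreover have "(topspace X - {x}) \<union> (topspace X - {y}) = topspace X - S" using xy True by blast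
      ultimately show ?thesis by (simp add: connectedin_def)
    next
      case False
      then have "card S = 1" using that card_gt_0_iff[of S] by linarith
      then obtain p where "S = {p}" by (rule card_1_singletonE)
      then show ?thesis using del[of p] by (simp add: connectedin_def)
    qed
  qed
  show "\<not> connected_space (subtopology X (topspace X - S))" if "card S = 2"
  proof -
    have "\<exists>x y. S = {x, y} \<and> x \<noteq> y" using that by (simp add: card_2_iff)
    then obtain x y where S2: "S = {x, y}" "x \<noteq> y" by blast
    then obtain U V where "arcs X x y U V" using big_circle_arcs[OF X] S by blast
    then have "splits X x y U V" by (rule arcs_splits)
    then have "\<not> connectedin X (topspace X - S)"
      unfolding connectedin_eq_not_separated splits_def S2 by blast
    then show ?thesis by (simp add: connectedin_def)
  qed
qed

text \<open>A connected set containing \<open>x\<close> and \<open>y\<close> contains one of the two arcs between them: otherwise it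
  would miss a point of each arc, and these two points separate \<open>x\<close> from \<open>y\<close>.\<close>

lemma big_circle_connected_imp_big_path_connected:
  fixes X :: "'a topology"
  assumes X: "big_circle X" and A: "connectedin X A"
  shows "big_path_connected_space (subtopology X A)"
  unfolding big_path_connected_space_def
proof (intro ballI)
  note F = big_circle_two_flimsy[OF X]
  fix x y assume xyA: "x \<in> topspace (subtopology X A)" "y \<in> topspace (subtopology X A)"
  show "big_path_joined (subtopology X A) x y"
  proof (cases "x = y")
    case True
    then show ?thesis using joined_refl[OF xyA(1)] by simp
  next
    case False
    have xy: "x \<in> topspace X" "y \<in> topspace X" "x \<in> A" "y \<in> A" using xyA by auto
    obtain U V where UV: "arcs X x y U V" using big_circle_arcs[OF X xy(1,2) False] by blast
    have "U \<subseteq> A \<or> V \<subseteq> A"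
    proof (rule ccontr)
      assume "\<not> ?thesis"
      then obtain u v where uv: "u \<in> U" "v \<in> V" "u \<notin> A" "v \<notin> A" by blast
      obtain E F where EF: "splits X u v E F" "x \<in> E" "y \<in> F"
        using splits_crossingE[OF F arcs_splits[OF UV] uv(1,2) xy(1,2)] by blast
      have "A \<subseteq> E \<union> F" using EF(1) uv connectedin_subset_topspace[OF A] unfolding splits_def by blast
      then have "A \<subseteq> E \<or> A \<subseteq> F"
        using connectedin_subset_separated_union[OF A] EF(1) unfolding splits_def by blast
      then show False using EF splits_disjoint[OF EF(1)] xy by blast
    qed
    then show ?thesis using arcs_joined[OF UV, of A] xy by simp
  qed
qed

lemma big_circle_two_big_path_flimsy:
  assumes X: "big_circle X" shows "two_big_path_flimsy X"
  unfolding two_big_path_flimsy_def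
proof (intro conjI allI impI)
  note F = big_circle_two_flimsy[OF X, unfolded two_flimsy_def]
  show "infinite (topspace X) \<or> card (topspace X) > 2" using F by (rule conjunct1)
  fix S assume S: "S \<subseteq> topspace X"
  show "big_path_connected_space (subtopology X (topspace X - S))" if "finite S \<and> card S < 2"
  proof (rule big_circle_connected_imp_big_path_connected[OF X])
    have "connected_space (subtopology X (topspace X - S))" using F S that by blast
    then show "connectedin X (topspace X - S)" by (simp add: connectedin_def)
  qed
  show "\<not> big_path_connected_space (subtopology X (topspace X - S))" if "card S = 2"
    using F S that big_path_connected_imp_connected by blast
qed

section \<open>The equivalence\<close>

theorem theorem1p7:
  fixes X :: "'a topology"
  shows "(compact_space X \<and> two_flimsy X \<longleftrightarrow> Hausdorff_space X \<and> two_big_path_flimsy X) \<and>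
    (Hausdorff_space X \<and> two_big_path_flimsy X \<longleftrightarrow> two_flimsy X \<and> two_big_path_flimsy X) \<and>
    (two_flimsy X \<and> two_big_path_flimsy X \<longleftrightarrow> big_circle X) \<and>
    (big_circle X \<longrightarrow> (\<forall>A \<subseteq> topspace X.
       connectedin X A \<longleftrightarrow> big_path_connected_space (subtopology X A)))"
proof -
  have i_iv: "big_circle X" if "compact_space X" "two_flimsy X"
    using compact_two_flimsy_imp_big_circle that .
  have iv_iii: "two_flimsy X" "two_big_path_flimsy X" if "big_circle X"
    using big_circle_two_flimsy[OF that] big_circle_two_big_path_flimsy[OF that] .
  have iii_ii: "Hausdorff_space X" if "two_flimsy X"
    using two_flimsy_Hausdorff that .
  have ii_i: "compact_space X" "two_flimsy X" if "Hausdorff_space X" "two_big_path_flimsy X"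
    using big_path_flimsy_compact[OF that] big_path_flimsy_imp_flimsy[OF that] .
  have "connectedin X A \<longleftrightarrow> big_path_connected_space (subtopology X A)"
    if X: "big_circle X" and A: "A \<subseteq> topspace X" for A
    using big_circle_connected_imp_big_path_connected[OF X] A
      big_path_connected_imp_connected[of "subtopology X A"] by (auto simp: connectedin_def)
  then show ?thesis using i_iv iv_iii iii_ii ii_i by blast
qed

end
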